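(* Assume the standing setting with $\rho_n\in(0,1)$ for all $n$, and assume $1-F(1-t^{-1})\in 2RV_{-\alpha,\tau}$ with $\alpha>0$, $\tau\le 0$ and auxiliary function $A$. Let $\lambda\in(0,\infty)$ and suppose there is a sequence $c_n\to 0$ ($c_n\neq 0$) such that, with $\lambda_n=\left(\frac{1-\rho_n}{2a_n}\right)^{1/2}$, $$\lim_{n\to\infty}\frac{\lambda_n-\lambda}{c_n}=\gamma\in\mathbb{R}.$$ Fix $x<0$, $y<0$ with $\lambda^2+x+y+\frac{(x-y)^2}{4\lambda^2}<0$. Then, as $n\to\infty$, $$\mathbb{P}(M_{n1}\le 1+a_nx,\ M_{n2}\le 1+a_ny)-H_{\alpha+\frac12,\lambda}(x,y)=H_{\alpha+\frac12,\lambda}(x,y)\Big\{-\tfrac12 n^{-1}\big(|x|^{\alpha+\frac12}\psi_\alpha(z_x)+|y|^{\alpha+\frac12}\psi_\alpha(z_y)\big)^2+Q_n(x,y)+o\big(a_n+c_n+|A(a_n^{-1})|+n^{-1}\big)\Big\},$$ where $$Q_n(x,y)=|x|^{\alpha+\frac12}\Big\{-\frac{a_n|x|}{c_\alpha}\int_{-1}^{z_x}(1-s^2)^{\alpha-1}s^2\big(\alpha+1-\tfrac32\alpha s^2-s^2\big)ds-\frac{A(a_n^{-1})|x|^{-\tau}}{c_\alpha}\int_{-1}^{z_x}(1-s^2)^\alpha\frac{(1-s^2)^{-\tau}-1}{\tau}ds$$ $$+\psi_\alpha(z_x)\Big(-A(a_n^{-1})\frac{|x|^{-\tau}-1}{\tau}+\frac{a_n}{c_\alpha}I_1+\frac{A(a_n^{-1})}{c_\alpha}I_2\Big)-\frac{(1-z_x^2)^\alpha}{c_\alpha\sqrt{2|x|}}\Big(c_n\gamma\Big(1-\frac{y-x}{2\lambda^2}\Big)-\frac{a_n}{2}\Big(\lambda(y-x)+\frac{x(y-x)}{\lambda}+\frac{3(y-x)^2}{4\lambda}+\frac{(y-x)^3}{8\lambda^3}\Big)\Big)\Big\}$$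 $$+|y|^{\alpha+\frac12}\Big\{-\frac{a_n|y|}{c_\alpha}\int_{-1}^{z_y}(1-s^2)^{\alpha-1}s^2\big(\alpha+1-\tfrac32\alpha s^2-s^2\big)ds-\frac{A(a_n^{-1})|y|^{-\tau}}{c_\alpha}\int_{-1}^{z_y}(1-s^2)^\alpha\frac{(1-s^2)^{-\tau}-1}{\tau}ds$$ $$+\psi_\alpha(z_y)\Big(-A(a_n^{-1})\frac{|y|^{-\tau}-1}{\tau}+\frac{a_n}{c_\alpha}I_1+\frac{A(a_n^{-1})}{c_\alpha}I_2\Big)-\frac{(1-z_y^2)^\alpha}{c_\alpha\sqrt{2|y|}}\Big(c_n\gamma\Big(1-\frac{x-y}{2\lambda^2}\Big)+\frac{a_n}{2}\Big(\lambda(y-x)+\frac{x(y-x)}{\lambda}+\frac{(y-x)^2}{4\lambda}+\frac{(y-x)^3}{8\lambda^3}\Big)\Big)\Big\},$$ with $I_1=\int_{-1}^1(1-s^2)^{\alpha-1}s^2(\alpha+1-\frac32\alpha s^2-s^2)ds$ and $I_2=\int_{-1}^1\frac{(1-s^2)^{\alpha-\tau}-(1-s^2)^\alpha}{\tau}ds$.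
   Context: Standing setting: Let $(S_1,S_2)$ be a bivariate spherical random vector (i.e. $(S_1,S_2)\overset{d}{=}R(\cos\Theta,\sin\Theta)$ with $\Theta$ uniform on $[0,2\pi)$ independent of $R$), whose radius $R=\sqrt{S_1^2+S_2^2}$ is almost surely positive with distribution function $F$ having upper endpoint $\sup\{t:F(t)<1\}=1$. Let $G$ be the distribution function of $S_1$ (upper endpoint 1), $G^{\leftarrow}$ its generalized inverse, and $a_n=1-G^{\leftarrow}(1-n^{-1})$. Given $\rho_n\in[-1,1]$, let $\{(\xi_{ni},\eta_{ni}),1\le i\le n,n\ge1\}$ be a triangular array such that for each $n$ the vectors $(\xi_{ni},\eta_{ni})$, $1\le i\le n$, are independent with $(\xi_{ni},\eta_{ni})\overset{d}{=}(S_1,\rho_nS_1+\sqrt{1-\rho_n^2}\,S_2)$; $M_{n1}=\max_{1\le i\le n}\xi_{ni}$, $M_{n2}=\max_{1\le i\le n}\eta_{ni}$. Second-order regular variation: $1-F(1-t^{-1})\in 2RV_{-\alpha,\tau}$ with auxiliary function $A$ means $A$ is eventually of constant sign, $A(t)\to0$ as $t\to\infty$, and for every $s>0$, $\lim_{t\to\infty}\frac{\frac{1-F(1-(ts)^{-1})}{1-F(1-t^{-1})}-s^{-\alpha}}{A(t)}=s^{-\alpha}\frac{s^\tau-1}{\tau}$. Throughout, $\frac{u^\tau-1}{\tau}$ is read as $\log u$ when $\tau=0$; correspondingly expressions like $\frac{|x|^{-\tau}-1}{\tau}$, $\frac{(1-s)^{-\tau}-1}{\tau}$, $\frac{(1-s)^{\alpha-\tau}-(1-s)^\alpha}{\tau}$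 are read as $-\log|x|$, $-\log(1-s)$, $-(1-s)^\alpha\log(1-s)$ when $\tau=0$. Notation: $c_\alpha=\int_0^1(1-s)^\alpha s^{-1/2}ds=\frac{\Gamma(\alpha+1)\sqrt\pi}{\Gamma(\alpha+3/2)}$; $\psi_\alpha(z)=c_\alpha^{-1}\int_{-1}^z(1-s^2)^\alpha ds$ for $z\in[-1,1]$, $\psi_\alpha(z)=0$ for $z<-1$ and $\psi_\alpha(z)=1$ for $z>1$. For $\lambda\in(0,\infty)$ and $x,y<0$: $z_x=\frac{\lambda+\frac{y-x}{2\lambda}}{\sqrt{2|x|}}$, $z_y=\frac{\lambda+\frac{x-y}{2\lambda}}{\sqrt{2|y|}}$, and $H_{\alpha+\frac12,\lambda}(x,y)=\exp\big(-|x|^{\alpha+\frac12}\psi_\alpha(z_x)-|y|^{\alpha+\frac12}\psi_\alpha(z_y)\big)$. An $o(r_n)$ term denotes a sequence whose ratio to $r_n$ tends to $0$ as $n\to\infty$.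
   Formalization: The error term is taken as o(a_n+|c_n|+|A(1/a_n)|+1/n), with |c_n| in place of c_n, since c_n may be negative and the sum a_n+c_n+|A(1/a_n)|+1/n could then vanish, leaving the o-term undefined. *)

theory Defs
  imports "HOL-Probability.Probability" "HOL-Library.Landau_Symbols"
begin

definition gen_inv :: "(real \<Rightarrow> real) \<Rightarrow> real \<Rightarrow> real" where
  "gen_inv G p = Inf {t. p \<le> G t}"

definition bc :: "real \<Rightarrow> real \<Rightarrow> real" where
  "bc \<tau> u = (if \<tau> = 0 then ln u else (u powr \<tau> - 1) / \<tau>)"

definition qt :: "real \<Rightarrow> real \<Rightarrow> real" where
  "qt \<tau> u = (if \<tau> = 0 then - ln u else (u powr (- \<tau>) - 1) / \<tau>)"

definition rt :: "real \<Rightarrow> real \<Rightarrow> real \<Rightarrow> real" where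
  "rt \<tau> \<alpha> w = (if \<tau> = 0 then - (w powr \<alpha>) * ln w
                  else (w powr (\<alpha> - \<tau>) - w powr \<alpha>) / \<tau>)"

definition second_order_RV ::
  "(real \<Rightarrow> real) \<Rightarrow> real \<Rightarrow> real \<Rightarrow> (real \<Rightarrow> real) \<Rightarrow> bool" where
  "second_order_RV f \<alpha> \<tau> A \<longleftrightarrow>
     ((\<forall>\<^sub>F t in at_top. A t > 0) \<or> (\<forall>\<^sub>F t in at_top. A t < 0)) \<and>
     (A \<longlongrightarrow> 0) at_top \<and>
     (\<forall>s>0. ((\<lambda>t. (f (t * s) / f t - s powr (- \<alpha>)) / A t)
               \<longlongrightarrow> s powr (- \<alpha>) * bc \<tau> s) at_top)"

definition c_alpha :: "real \<Rightarrow> real" where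
  "c_alpha \<alpha> = Gamma (\<alpha> + 1) * sqrt pi / Gamma (\<alpha> + 3/2)"

definition psi :: "real \<Rightarrow> real \<Rightarrow> real" where
  "psi \<alpha> z = (if z < -1 then 0 else if z > 1 then 1 else
     (LBINT s=ereal (-1)..ereal z. (1 - s\<^sup>2) powr \<alpha>) / c_alpha \<alpha>)"

definition zx :: "real \<Rightarrow> real \<Rightarrow> real \<Rightarrow> real" where
  "zx lam x y = (lam + (y - x) / (2 * lam)) / sqrt (2 * \<bar>x\<bar>)"

definition zy :: "real \<Rightarrow> real \<Rightarrow> real \<Rightarrow> real" where
  "zy lam x y = (lam + (x - y) / (2 * lam)) / sqrt (2 * \<bar>y\<bar>)"

definition H_lim :: "real \<Rightarrow> real \<Rightarrow> real \<Rightarrow> real \<Rightarrow> real" where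
  "H_lim \<alpha> lam x y = exp (- (\<bar>x\<bar> powr (\<alpha> + 1/2)) * psi \<alpha> (zx lam x y)
                          - (\<bar>y\<bar> powr (\<alpha> + 1/2)) * psi \<alpha> (zy lam x y))"

definition J1 :: "real \<Rightarrow> real \<Rightarrow> real" where
  "J1 \<alpha> z = (LBINT s=ereal (-1)..ereal z.
     (1 - s\<^sup>2) powr (\<alpha> - 1) * s\<^sup>2 * (\<alpha> + 1 - 3/2 * \<alpha> * s\<^sup>2 - s\<^sup>2))"

definition J2 :: "real \<Rightarrow> real \<Rightarrow> real \<Rightarrow> real" where
  "J2 \<alpha> \<tau> z = (LBINT s=ereal (-1)..ereal z. (1 - s\<^sup>2) powr \<alpha> * qt \<tau> (1 - s\<^sup>2))"

definition I1 :: "real \<Rightarrow> real" where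
  "I1 \<alpha> = J1 \<alpha> 1"

definition I2 :: "real \<Rightarrow> real \<Rightarrow> real" where
  "I2 \<alpha> \<tau> = (LBINT s=ereal (-1)..ereal 1. rt \<tau> \<alpha> (1 - s\<^sup>2))"

(* Q_n(x,y), with an = a_n, cn = c_n, An = A(a_n^{-1}) *)
definition Qn :: "real \<Rightarrow> real \<Rightarrow> real \<Rightarrow> real \<Rightarrow> real \<Rightarrow> real \<Rightarrow> real \<Rightarrow> real \<Rightarrow> real \<Rightarrow> real" where
  "Qn \<alpha> \<tau> lam \<gamma> an cn An x y =
    (let ca = c_alpha \<alpha>; zX = zx lam x y; zY = zy lam x y in
     \<bar>x\<bar> powr (\<alpha> + 1/2) *
       (- an * \<bar>x\<bar> / ca * J1 \<alpha> zX
        - An * \<bar>x\<bar> powr (- \<tau>) / ca * J2 \<alpha> \<tau> zX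
        + psi \<alpha> zX * (- An * qt \<tau> \<bar>x\<bar> + an / ca * I1 \<alpha> + An / ca * I2 \<alpha> \<tau>)
        - (1 - zX\<^sup>2) powr \<alpha> / (ca * sqrt (2 * \<bar>x\<bar>)) *
            (cn * \<gamma> * (1 - (y - x) / (2 * lam\<^sup>2))
             - an / 2 * (lam * (y - x) + x * (y - x) / lam + 3 * (y - x)\<^sup>2 / (4 * lam)
                         + (y - x) ^ 3 / (8 * lam ^ 3))))
   + \<bar>y\<bar> powr (\<alpha> + 1/2) *
       (- an * \<bar>y\<bar> / ca * J1 \<alpha> zY
        - An * \<bar>y\<bar> powr (- \<tau>) / ca * J2 \<alpha> \<tau> zY
        + psi \<alpha> zY * (- An * qt \<tau> \<bar>y\<bar> + an / ca * I1 \<alpha> + An / ca * I2 \<alpha> \<tau>)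
        - (1 - zY\<^sup>2) powr \<alpha> / (ca * sqrt (2 * \<bar>y\<bar>)) *
            (cn * \<gamma> * (1 - (x - y) / (2 * lam\<^sup>2))
             + an / 2 * (lam * (y - x) + x * (y - x) / lam + (y - x)\<^sup>2 / (4 * lam)
                         + (y - x) ^ 3 / (8 * lam ^ 3)))))"

end

theory Submission
  imports Defs
begin

text \<open>
  In polar coordinates the probability that one of the two components exceeds its threshold
  splits, along the ray through the corner of the two thresholds, into two sectors, each of which is
  up to a reflection a set of the form \<open>{S\<^sub>1 > 1 - w, S\<^sub>2 \<le> q S\<^sub>1}\<close>. Substituting the
  angle \<open>\<theta>\<close> with \<open>(1 - w) / cos \<theta> = 1 - w (1 - s\<^sup>2)\<close> turns the sector probability into an integral of
  \<open>1 - F (1 - w (1 - s\<^sup>2))\<close> against a smooth Jacobian, so second-order regular variation applies to the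
  integrand exactly. Passing to the limit under the integral needs a uniform bound on the
  second-order remainder, which follows from measurability alone by a Steinhaus-type argument.
  Since \<open>S\<^sub>1\<close> has no atoms, \<open>1/n\<close> is itself such an integral, so \<open>n\<close> times the exceedance probability is
  a ratio of two expansions; the theorem follows from \<open>(1 - p)\<^sup>n = exp (n ln (1 - p))\<close>.
\<close>

section \<open>Uniform bounds from second-order regular variation\<close>

text \<open>In the angle itself the integrand is \<open>1 - F (u / cos \<theta>)\<close>, whose
  argument would have to be expanded inside \<open>F\<close>; second-order regular variation at a
  perturbed argument demands uniformity in the perturbation too. After the substitution the quotient
  of \<open>1 - F (1 - a n * \<xi> * (1 - s^2))\<close> by \<open>1 - F (1 - a n)\<close> is
  literally one of those in the definition of regular variation, and all perturbation sits in an
  explicit Jacobian with first-order term \<open>- 5/4 * w * s^2\<close>. The sequence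
  \<open>a n\<close> never has to be expanded: \<open>1 - F (1 - a n)\<close> cancels between the
  sector probability and \<open>1/n\<close>. The terms with \<open>I1\<close> and \<open>I2\<close>
  in \<open>Qn\<close> come from that denominator. The expansion does not produce the weight in
  \<open>J1\<close> directly. It appears after an integration by parts whose boundary term is
  compensated by part of the displacement of the sector's endpoint. The auxiliary function
  \<open>A\<close> is not assumed measurable, so measure arguments cannot be applied to it. They are
  applied to unit increments of a function built from \<open>F\<close>, which are asymptotically
  proportional to \<open>A\<close> times that function.\<close>

text \<open>Two subsets of \<open>{0..3}\<close> of measure above \<open>3/2\<close> must meet. If
  the bound failed along \<open>u m\<close>, \<open>w m\<close>, the set of good shifts from
  \<open>u m\<close> and the translated set of good shifts from \<open>u m + w m\<close> would share
  a point, and going through it bounds the offending increment. The growth condition on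
  \<open>b\<close> compares the scales at the two base points.\<close>

lemma measurable_increments_locally_bounded:
  fixes l b :: "real \<Rightarrow> real"
  assumes meas[measurable]: "l \<in> borel_measurable borel"
    and b_pos: "\<And>u. u \<ge> ub \<Longrightarrow> b u > 0"
    and b_bd: "\<And>u w. u \<ge> ub \<Longrightarrow> 0 \<le> w \<Longrightarrow> w \<le> 1 \<Longrightarrow> b (u + w) \<le> C * b u"
    and ptw: "\<And>v. 0 \<le> v \<Longrightarrow> v \<le> 2 \<Longrightarrow> \<exists>K. \<forall>\<^sub>F u in at_top. \<bar>l (u + v) - l u\<bar> \<le> K * b u"
  shows "\<exists>K u1. \<forall>u\<ge>u1. \<forall>w. 0 \<le> w \<longrightarrow> w \<le> 1 \<longrightarrow> \<bar>l (u + w) - l u\<bar> \<le> K * b u"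
proof (rule ccontr)
  assume neg: "\<not> ?thesis"
  have "\<exists>u w. u \<ge> max ub (real m) \<and> 0 \<le> w \<and> w \<le> 1 \<and> \<bar>l (u + w) - l u\<bar> > real m * b u" for m :: nat
    using neg by (meson linorder_not_le)
  then obtain u w where uw: "\<And>m::nat. u m \<ge> max ub (real m)" "\<And>m. 0 \<le> w m" "\<And>m. w m \<le> 1"
      "\<And>m. \<bar>l (u m + w m) - l (u m)\<bar> > real m * b (u m)"
    by metis
  \<comment> \<open>For any base points tending to infinity the pointwise bounds exhaust
    \<open>{0..2}\<close> as the constant grows, so continuity of measure gives one constant that
    works on a set of measure above \<open>3/2\<close>. An arbitrary sequence \<open>p\<close> is
    allowed because both \<open>u m\<close> and \<open>u m + w m\<close> are needed.\<close>
  have big: "\<exists>n0. \<forall>n\<ge>n0. emeasure lborel {v\<in>{0..2}. \<forall>m\<ge>n. \<bar>l (p m + v) - l (p m)\<bar> \<le> real n * b (p m)} > ennreal (3/2)"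
    if p: "\<And>m. p m \<ge> max ub (real m)" for p :: "nat \<Rightarrow> real"
  proof -
    define V where "V n = {v\<in>{0..2}. \<forall>m\<ge>n. \<bar>l (p m + v) - l (p m)\<bar> \<le> real n * b (p m)}" for n
    have Vm: "V n \<in> sets lborel" for n
      unfolding V_def by measurable
    have bp: "b (p m) > 0" for m using b_pos p[of m] by simp
    have incV: "incseq V"
      unfolding incseq_def V_def
    proof (safe, goal_cases)
      case (1 i j v m)
      then have "\<bar>l (p m + v) - l (p m)\<bar> \<le> real i * b (p m)" by auto
      also have "\<dots> \<le> real j * b (p m)" using 1 bp[of m] by (intro mult_right_mono) auto
      finally show ?case .
    qed
    have "(\<Union>n. V n) = {0..2}"
    proof (intro equalityI subsetI)
      fix v :: real assume v: "v \<in> {0..2}"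
      then obtain K where K: "\<forall>\<^sub>F u in at_top. \<bar>l (u + v) - l u\<bar> \<le> K * b u" using ptw[of v] by auto
      then obtain U where U: "\<And>u. u \<ge> U \<Longrightarrow> \<bar>l (u + v) - l u\<bar> \<le> K * b u"
        by (auto simp: eventually_at_top_linorder)
      obtain n where n: "real n \<ge> max U K" using real_arch_simple by blast
      have "v \<in> V n"
        unfolding V_def
      proof (safe)
        show "v \<in> {0..2}" by fact
      next
        fix m assume "m \<ge> n"
        then have "p m \<ge> U" using p[of m] n by (smt (verit) of_nat_mono max_def)
        then have "\<bar>l (p m + v) - l (p m)\<bar> \<le> K * b (p m)" by (rule U)
        also have "\<dots> \<le> real n * b (p m)" using n bp[of m] by (intro mult_right_mono) auto
        finally show "\<bar>l (p m + v) - l (p m)\<bar> \<le> real n * b (p m)" .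
      qed
      then show "v \<in> (\<Union>n. V n)" by auto
    qed (auto simp: V_def)
    moreover have "(\<lambda>n. emeasure lborel (V n)) \<longlonglongrightarrow> emeasure lborel (\<Union>n. V n)"
      using Vm incV by (intro Lim_emeasure_incseq) auto
    ultimately have "(\<lambda>n. emeasure lborel (V n)) \<longlonglongrightarrow> ennreal 2" by simp
    moreover have "ennreal (3/2) < ennreal 2" by (simp add: ennreal_less_iff)
    ultimately have "\<forall>\<^sub>F n in sequentially. ennreal (3/2) < emeasure lborel (V n)"
      by (rule order_tendstoD(1))
    then show ?thesis unfolding V_def by (auto simp: eventually_sequentially)
  qed
  have u': "u m \<ge> max ub (real m)" for m using uw by auto
  have uw': "u m + w m \<ge> max ub (real m)" for m using uw(1,2)[of m] by auto
  obtain n1 where n1: "\<forall>n\<ge>n1. emeasure lborel {v\<in>{0..2}. \<forall>m\<ge>n. \<bar>l (u m + v) - l (u m)\<bar> \<le> real n * b (u m)} > ennreal (3/2)"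
    using big[OF u'] by blast
  obtain n2 where n2: "\<forall>n\<ge>n2. emeasure lborel {v\<in>{0..2}. \<forall>m\<ge>n. \<bar>l (u m + w m + v) - l (u m + w m)\<bar> \<le> real n * b (u m + w m)} > ennreal (3/2)"
    using big[of "\<lambda>m. u m + w m", OF uw'] by blast
  define n where "n = max n1 n2"
  define V where "V = {v\<in>{0..2}. \<forall>m\<ge>n. \<bar>l (u m + v) - l (u m)\<bar> \<le> real n * b (u m)}"
  define W where "W = {v\<in>{0..2}. \<forall>m\<ge>n. \<bar>l (u m + w m + v) - l (u m + w m)\<bar> \<le> real n * b (u m + w m)}"
  have VW: "emeasure lborel V > ennreal (3/2)" "emeasure lborel W > ennreal (3/2)"
    unfolding V_def W_def using n1[rule_format, of n] n2[rule_format, of n] by (simp_all add: n_def)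
  have [measurable]: "V \<in> sets borel" "W \<in> sets borel"
    unfolding V_def W_def by measurable
  obtain m :: nat where m: "real m \<ge> max (real n) (real n * (1 + \<bar>C\<bar>))" using real_arch_simple by blast
  then have mn: "m \<ge> n" by simp
  \<comment> \<open>Shifts from \<open>u m + w m\<close>, re-expressed as shifts from
    \<open>u m\<close>. Since \<open>0 \<le> w m \<le> 1\<close>, the translate of a subset of
    \<open>{0..2}\<close> stays in \<open>{0..3}\<close>.\<close>
  define W' where "W' = (\<lambda>x. x - w m) -` W"
  have [measurable]: "W' \<in> sets borel"
    unfolding W'_def by (rule measurable_sets_borel[of _ borel]) auto
  have eW': "emeasure lborel W' = emeasure lborel W"
  proof -
    have "emeasure (distr lborel borel ((+) (- w m))) W = emeasure lborel ((+) (- w m) -` W \<inter> space lborel)"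
      by (intro emeasure_distr) auto
    moreover have "(+) (- w m) -` W \<inter> space lborel = W'" by (auto simp: W'_def)
    ultimately show ?thesis by (simp add: lborel_distr_plus)
  qed
  have "V \<inter> W' \<noteq> {}"
  proof
    assume "V \<inter> W' = {}"
    then have "emeasure lborel V + emeasure lborel W' = emeasure lborel (V \<union> W')"
      by (intro plus_emeasure) auto
    also have "\<dots> \<le> emeasure lborel {0..3::real}"
    proof (rule emeasure_mono)
      show "V \<union> W' \<subseteq> {0..3}"
      proof
        fix r assume "r \<in> V \<union> W'"
        then have "r \<in> {0..2} \<or> r - w m \<in> {0..2}" by (auto simp: V_def W'_def W_def)
        then show "r \<in> {0..3}" using uw(2,3)[of m] by auto
      qed
    qed simp
    also have "\<dots> = ennreal (3/2) + ennreal (3/2)" by (simp flip: ennreal_plus)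
    also have "\<dots> < emeasure lborel V + emeasure lborel W'" using VW eW'
      by (simp add: add_strict_mono)
    finally show False by simp
  qed
  then obtain v where v: "v \<in> V" "v \<in> W'" by auto
  have "\<bar>l (u m + w m) - l (u m)\<bar> \<le> \<bar>l (u m + v) - l (u m)\<bar> + \<bar>l (u m + w m + (v - w m)) - l (u m + w m)\<bar>"
    by (simp add: algebra_simps)
  also have "\<dots> \<le> real n * b (u m) + real n * b (u m + w m)"
    using v mn unfolding V_def W'_def W_def by (intro add_mono) auto
  also have "\<dots> \<le> real n * b (u m) + real n * (\<bar>C\<bar> * b (u m))"
  proof -
    have "b (u m + w m) \<le> C * b (u m)" using uw(1-3)[of m] by (intro b_bd) auto
    also have "\<dots> \<le> \<bar>C\<bar> * b (u m)" using b_pos[of "u m"] uw(1)[of m] by (intro mult_right_mono) auto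
    finally show ?thesis by (intro add_mono mult_left_mono) auto
  qed
  also have "\<dots> = (real n * (1 + \<bar>C\<bar>)) * b (u m)" by (simp add: algebra_simps)
  also have "\<dots> \<le> real m * b (u m)" using m b_pos[of "u m"] uw(1)[of m] by (intro mult_right_mono) auto
  finally show False using uw(4)[of m] by simp
qed


section \<open>Extended regular variation in logarithmic scale\<close>

text \<open>The cocycle identity of the limit function; the factor \<open>exp (\<tau> * v)\<close>
  in it becomes the limit of \<open>a (u + v) / a u\<close>.\<close>

lemma bc_exp_add: "bc \<tau> (exp (v + w)) = bc \<tau> (exp v) + exp (\<tau> * v) * bc \<tau> (exp w)"
proof (cases "\<tau> = 0")
  case False
  have "exp (v + w) powr \<tau> = exp (\<tau> * v) * exp (\<tau> * w)"
    by (simp add: powr_def distrib_left flip: exp_add)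
  with False show ?thesis by (simp add: bc_def powr_def divide_simps) (simp add: algebra_simps)
qed (simp add: bc_def exp_add ln_mult)

lemma bc_exp_one_nonzero: "bc \<tau> (exp 1) \<noteq> 0"
  by (auto simp: bc_def powr_def)

text \<open>The unit increment of \<open>k\<close> at \<open>u + v\<close> can be normalised by
  \<open>a u\<close> or by \<open>a (u + v)\<close>. Both limits are known and the second,
  \<open>bc \<tau> (exp 1)\<close>, is nonzero, so their quotient determines the limit of
  \<open>a (u + v) / a u\<close>.\<close>

lemma auxiliary_function_regularly_varying:
  fixes k a :: "real \<Rightarrow> real"
  assumes lim: "\<And>v. ((\<lambda>u. (k (u + v) - k u) / a u) \<longlongrightarrow> bc \<tau> (exp v)) at_top"
    and nz: "\<forall>\<^sub>F u in at_top. a u \<noteq> 0"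
  shows "((\<lambda>u. a (u + v) / a u) \<longlongrightarrow> exp (\<tau> * v)) at_top"
proof -
  define B where "B = bc \<tau> (exp 1)"
  have B: "B \<noteq> 0" unfolding B_def by (rule bc_exp_one_nonzero)
  have shift: "filterlim (\<lambda>u. u + v) at_top at_top" by (rule filterlim_tendsto_add_at_top[OF tendsto_const filterlim_ident, THEN filterlim_cong[OF refl refl, THEN iffD1, rotated]]) (simp add: add.commute)
  have den: "((\<lambda>u. (k (u + v + 1) - k (u + v)) / a (u + v)) \<longlongrightarrow> B) at_top"
    using filterlim_compose[OF lim[of 1] shift] by (simp add: B_def)
  have num: "((\<lambda>u. (k (u + (v + 1)) - k u) / a u - (k (u + v) - k u) / a u) \<longlongrightarrow> exp (\<tau> * v) * B) at_top"
    using tendsto_diff[OF lim[of "v + 1"] lim[of v]] by (simp add: B_def bc_exp_add)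
  have "((\<lambda>u. ((k (u + (v + 1)) - k u) / a u - (k (u + v) - k u) / a u) / ((k (u + v + 1) - k (u + v)) / a (u + v)))
     \<longlongrightarrow> exp (\<tau> * v) * B / B) at_top"
    by (rule tendsto_divide[OF num den B])
  then have "((\<lambda>u. ((k (u + (v + 1)) - k u) / a u - (k (u + v) - k u) / a u) / ((k (u + v + 1) - k (u + v)) / a (u + v)))
     \<longlongrightarrow> exp (\<tau> * v)) at_top" using B by simp
  moreover have "\<forall>\<^sub>F u in at_top. ((k (u + (v + 1)) - k u) / a u - (k (u + v) - k u) / a u) / ((k (u + v + 1) - k (u + v)) / a (u + v)) = a (u + v) / a u"
  proof -
    have "\<forall>\<^sub>F u in at_top. (k (u + v + 1) - k (u + v)) / a (u + v) \<noteq> 0"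
      using tendsto_imp_eventually_ne[OF den B] .
    with nz show ?thesis
    proof eventually_elim
      case (elim u)
      then have "k (u + v + 1) - k (u + v) \<noteq> 0" "a (u + v) \<noteq> 0" by auto
      with elim show ?case by (simp add: divide_simps) (simp add: algebra_simps)
    qed
  qed
  ultimately show ?thesis by (rule Lim_transform_eventually)
qed

text \<open>Increments over at most one unit are bounded by a multiple of \<open>a\<close>,
  uniformly in the length. Since \<open>a (u + 1) / a u\<close> tends to
  \<open>exp \<tau> \<le> 1 < exp \<epsilon>\<close>, chaining unit steps yields a geometric sum of
  ratio \<open>exp \<epsilon>\<close>.\<close>

lemma extended_regular_variation_bound:
  fixes k a :: "real \<Rightarrow> real"
  assumes meas[measurable]: "k \<in> borel_measurable borel"
    and lim: "\<And>v. ((\<lambda>u. (k (u + v) - k u) / a u) \<longlongrightarrow> bc \<tau> (exp v)) at_top"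
    and nz: "\<forall>\<^sub>F u in at_top. a u \<noteq> 0"
    and \<tau>: "\<tau> \<le> 0" and \<epsilon>: "\<epsilon> > 0"
  shows "\<exists>C u0. \<forall>u\<ge>u0. \<forall>v\<ge>0. \<bar>k (u + v) - k u\<bar> \<le> C * \<bar>a u\<bar> * exp (\<epsilon> * v)"
proof -
  note rv = auxiliary_function_regularly_varying[OF lim nz]
  define B where "B = bc \<tau> (exp 1)"
  have B: "B \<noteq> 0" unfolding B_def by (rule bc_exp_one_nonzero)
  have shift: "filterlim (\<lambda>u. u + v) at_top at_top" for v :: real
    by (rule filterlim_tendsto_add_at_top[OF tendsto_const filterlim_ident, THEN filterlim_cong[OF refl refl, THEN iffD1, rotated]]) (simp add: add.commute)
  \<comment> \<open>A measurable substitute for \<open>a\<close>, to which it is asymptotically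
    proportional with factor \<open>B\<close>.\<close>
  define d where "d u = k (u + 1) - k u" for u
  define l where "l u = ln \<bar>d u\<bar>" for u
  have [measurable]: "l \<in> borel_measurable borel" unfolding l_def d_def by measurable
  have da: "((\<lambda>u. d u / a u) \<longlongrightarrow> B) at_top" unfolding d_def B_def by (rule lim)
  have d_nz: "\<forall>\<^sub>F u in at_top. d u \<noteq> 0"
    using tendsto_imp_eventually_ne[OF da B] by eventually_elim auto
  have dd: "((\<lambda>u. d (u + v) / d u) \<longlongrightarrow> exp (\<tau> * v)) at_top" for v
  proof -
    have "((\<lambda>u. d (u + v) / a (u + v) * (a (u + v) / a u) / (d u / a u)) \<longlongrightarrow> B * exp (\<tau> * v) / B) at_top"
      by (intro tendsto_intros rv da B filterlim_compose[OF da shift])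
    then have "((\<lambda>u. d (u + v) / a (u + v) * (a (u + v) / a u) / (d u / a u)) \<longlongrightarrow> exp (\<tau> * v)) at_top" using B by simp
    moreover have "\<forall>\<^sub>F u in at_top. d (u + v) / a (u + v) * (a (u + v) / a u) / (d u / a u) = d (u + v) / d u"
      using nz eventually_compose_filterlim[OF nz shift[of v]] by eventually_elim simp
    ultimately show ?thesis by (rule Lim_transform_eventually)
  qed
  \<comment> \<open>Applying the measure argument to \<open>ln\<close> of the substitute, with
    constant scale \<open>1\<close>, controls its multiplicative oscillation over unit
    intervals.\<close>
  have "\<exists>K u1. \<forall>u\<ge>u1. \<forall>w. 0 \<le> w \<longrightarrow> w \<le> 1 \<longrightarrow> \<bar>l (u + w) - l u\<bar> \<le> K * (\<lambda>_. 1) u"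
  proof (rule measurable_increments_locally_bounded[where C = 1 and ub = 0])
    fix v :: real
    have "((\<lambda>u. ln \<bar>d (u + v) / d u\<bar>) \<longlongrightarrow> ln \<bar>exp (\<tau> * v)\<bar>) at_top"
      by (intro tendsto_intros dd) auto
    then have "\<forall>\<^sub>F u in at_top. dist (ln \<bar>d (u + v) / d u\<bar>) (\<tau> * v) < 1"
      by (auto simp: tendsto_iff)
    with d_nz eventually_compose_filterlim[OF d_nz shift[of v]]
    have "\<forall>\<^sub>F u in at_top. \<bar>l (u + v) - l u\<bar> \<le> (\<bar>\<tau> * v\<bar> + 1) * 1"
    proof eventually_elim
      case (elim u)
      then have "ln \<bar>d (u + v) / d u\<bar> = l (u + v) - l u" unfolding l_def
        by (simp add: abs_divide ln_div)
      with elim(3) show ?case by (auto simp: dist_real_def)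
    qed
    then show "\<exists>K. \<forall>\<^sub>F u in at_top. \<bar>l (u + v) - l u\<bar> \<le> K * 1" by blast
  qed auto
  then obtain K u1 where K: "\<And>u w. u \<ge> u1 \<Longrightarrow> 0 \<le> w \<Longrightarrow> w \<le> 1 \<Longrightarrow> \<bar>l (u + w) - l u\<bar> \<le> K" by auto
  have "\<forall>\<^sub>F u in at_top. d u \<noteq> 0 \<and> a u \<noteq> 0 \<and> \<bar>d u / a u - B\<bar> < \<bar>B\<bar> / 2 \<and> \<bar>a (u + 1) / a u\<bar> \<le> exp \<epsilon> \<and> u \<ge> u1"
  proof (intro eventually_conj d_nz nz eventually_ge_at_top)
    show "\<forall>\<^sub>F u in at_top. \<bar>d u / a u - B\<bar> < \<bar>B\<bar> / 2"
      using tendstoD[OF da, of "\<bar>B\<bar> / 2"] B by (simp add: dist_real_def)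
    have "((\<lambda>u. \<bar>a (u + 1) / a u\<bar>) \<longlongrightarrow> \<bar>exp (\<tau> * 1)\<bar>) at_top" by (intro tendsto_intros rv)
    moreover have "\<bar>exp (\<tau> * 1)\<bar> < exp \<epsilon>" using \<tau> \<epsilon> by simp
    ultimately show "\<forall>\<^sub>F u in at_top. \<bar>a (u + 1) / a u\<bar> \<le> exp \<epsilon>"
      by (metis (mono_tags, lifting) eventually_mono less_imp_le order_tendstoD(2))
  qed
  then obtain u2 where u2: "\<And>u. u \<ge> u2 \<Longrightarrow> d u \<noteq> 0" "\<And>u. u \<ge> u2 \<Longrightarrow> a u \<noteq> 0"
    "\<And>u. u \<ge> u2 \<Longrightarrow> \<bar>d u / a u - B\<bar> < \<bar>B\<bar> / 2" "\<And>u. u \<ge> u2 \<Longrightarrow> \<bar>a (u + 1) / a u\<bar> \<le> exp \<epsilon>" "\<And>u. u \<ge> u2 \<Longrightarrow> u \<ge> u1"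
    unfolding eventually_at_top_linorder by metis
  have dbd: "\<bar>B\<bar> / 2 * \<bar>a u\<bar> \<le> \<bar>d u\<bar>" "\<bar>d u\<bar> \<le> 2 * \<bar>B\<bar> * \<bar>a u\<bar>" if "u \<ge> u2" for u
  proof -
    have "\<bar>B\<bar> / 2 \<le> \<bar>d u / a u\<bar>" "\<bar>d u / a u\<bar> \<le> 2 * \<bar>B\<bar>" using u2(3)[OF that] by linarith+
    then show "\<bar>B\<bar> / 2 * \<bar>a u\<bar> \<le> \<bar>d u\<bar>" "\<bar>d u\<bar> \<le> 2 * \<bar>B\<bar> * \<bar>a u\<bar>"
      using u2(2)[OF that] by (simp_all add: abs_divide field_simps)
  qed
  \<comment> \<open>The factor \<open>4\<close> is the ratio of the bounds
    \<open>2 * \<bar>B\<bar>\<close> and \<open>\<bar>B\<bar> / 2\<close> between \<open>d\<close>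
    and \<open>a\<close>. This growth bound is what allows the measure argument to be repeated with
    \<open>\<bar>a\<bar>\<close> as scale.\<close>
  have a_bd: "\<bar>a (u + w)\<bar> \<le> (4 * exp K) * \<bar>a u\<bar>" if u: "u \<ge> u2" and w: "0 \<le> w" "w \<le> 1" for u w
  proof -
    have uw: "u + w \<ge> u2" using u w by simp
    have "l (u + w) \<le> l u + K" using K[OF u2(5)[OF u] w] by linarith
    then have "exp (l (u + w)) \<le> exp (l u + K)" by simp
    then have "\<bar>d (u + w)\<bar> \<le> exp K * \<bar>d u\<bar>"
      using u2(1)[OF u] u2(1)[OF uw] by (simp add: l_def exp_add mult.commute)
    also have "\<dots> \<le> exp K * (2 * \<bar>B\<bar> * \<bar>a u\<bar>)" by (intro mult_left_mono dbd u) auto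
    finally have "\<bar>B\<bar> / 2 * \<bar>a (u + w)\<bar> \<le> exp K * (2 * \<bar>B\<bar> * \<bar>a u\<bar>)" using dbd(1)[OF uw] by linarith
    then have "\<bar>B\<bar> * \<bar>a (u + w)\<bar> \<le> \<bar>B\<bar> * ((4 * exp K) * \<bar>a u\<bar>)" by (simp add: algebra_simps)
    then show ?thesis using B by (subst (asm) mult_le_cancel_left_pos) auto
  qed
  have "\<exists>K u1. \<forall>u\<ge>u1. \<forall>w. 0 \<le> w \<longrightarrow> w \<le> 1 \<longrightarrow> \<bar>k (u + w) - k u\<bar> \<le> K * \<bar>a u\<bar>"
  proof (rule measurable_increments_locally_bounded[where C = "4 * exp K" and ub = u2])
    fix v :: real
    have "((\<lambda>u. \<bar>(k (u + v) - k u) / a u\<bar>) \<longlongrightarrow> \<bar>bc \<tau> (exp v)\<bar>) at_top"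
      by (intro tendsto_intros lim)
    then have "\<forall>\<^sub>F u in at_top. \<bar>(k (u + v) - k u) / a u\<bar> < \<bar>bc \<tau> (exp v)\<bar> + 1"
      by (rule order_tendstoD) simp
    with nz have "\<forall>\<^sub>F u in at_top. \<bar>k (u + v) - k u\<bar> \<le> (\<bar>bc \<tau> (exp v)\<bar> + 1) * \<bar>a u\<bar>"
      by eventually_elim (simp add: abs_divide field_simps)
    then show "\<exists>K. \<forall>\<^sub>F u in at_top. \<bar>k (u + v) - k u\<bar> \<le> K * \<bar>a u\<bar>" by blast
  qed (use u2 a_bd in auto)
  then obtain L u3 where L: "\<And>u w. u \<ge> u3 \<Longrightarrow> 0 \<le> w \<Longrightarrow> w \<le> 1 \<Longrightarrow> \<bar>k (u + w) - k u\<bar> \<le> L * \<bar>a u\<bar>" by blast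
  define u4 where "u4 = max u2 u3"
  have aj: "\<bar>a (u + real j)\<bar> \<le> exp (\<epsilon> * real j) * \<bar>a u\<bar>" if u: "u \<ge> u4" for u j
  proof (induction j)
    case (Suc j)
    have uj: "u + real j \<ge> u2" using u by (simp add: u4_def)
    have "\<bar>a (u + real j + 1)\<bar> \<le> exp \<epsilon> * \<bar>a (u + real j)\<bar>"
      using u2(4)[OF uj] u2(2)[OF uj] by (simp add: abs_divide field_simps)
    also have "\<dots> \<le> exp \<epsilon> * (exp (\<epsilon> * real j) * \<bar>a u\<bar>)" using Suc by (intro mult_left_mono) auto
    finally show ?case by (simp add: distrib_left exp_add algebra_simps)
  qed simp
  have L0: "L \<ge> 0"
  proof -
    have "0 \<le> L * \<bar>a u4\<bar>" using L[of u4 0] by (simp add: u4_def)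
    then show ?thesis using u2(2)[of u4] by (simp add: u4_def zero_le_mult_iff)
  qed
  define q where "q = exp \<epsilon>"
  have q: "q > 1" using \<epsilon> by (simp add: q_def)
  have qj: "exp (\<epsilon> * real j) = q ^ j" for j by (simp add: q_def exp_of_nat_mult[symmetric] mult.commute)
  have kj: "\<bar>k (u + real j) - k u\<bar> \<le> L * \<bar>a u\<bar> * (\<Sum>i<j. q ^ i)" if u: "u \<ge> u4" for u j
  proof (induction j)
    case (Suc j)
    have "\<bar>k (u + real j + 1) - k (u + real j)\<bar> \<le> L * \<bar>a (u + real j)\<bar>"
      using u by (intro L) (auto simp: u4_def)
    also have "\<dots> \<le> L * (q ^ j * \<bar>a u\<bar>)" using aj[OF u, of j] L0 unfolding qj by (intro mult_left_mono) auto
    finally show ?case using Suc by (simp add: algebra_simps)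
  qed simp
  show ?thesis
  proof (intro exI allI impI)
    fix u v :: real assume u: "u \<ge> u4" and v: "v \<ge> 0"
    \<comment> \<open>Whole unit steps followed by one fractional step of length below
      \<open>1\<close>.\<close>
    define j where "j = nat \<lfloor>v\<rfloor>"
    have j: "real j \<le> v" "v < real j + 1" using v by (auto simp: j_def)
    have qv: "q ^ j \<le> exp (\<epsilon> * v)" using j \<epsilon> by (simp flip: qj)
    have "\<bar>k (u + v) - k (u + real j)\<bar> \<le> L * \<bar>a (u + real j)\<bar>"
      using L[of "u + real j" "v - real j"] u j by (auto simp: u4_def)
    also have "\<dots> \<le> L * (q ^ j * \<bar>a u\<bar>)" using aj[OF u, of j] L0 unfolding qj by (intro mult_left_mono) auto
    finally have 1: "\<bar>k (u + v) - k (u + real j)\<bar> \<le> L * (q ^ j * \<bar>a u\<bar>)" .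
    have "(\<Sum>i<j. q ^ i) \<le> q ^ j / (q - 1)"
      using q by (subst geometric_sum) (auto simp: field_simps)
    then have "\<bar>k (u + real j) - k u\<bar> \<le> L * \<bar>a u\<bar> * (q ^ j / (q - 1))"
      using kj[OF u, of j] L0 by (meson abs_ge_zero mult_left_mono mult_nonneg_nonneg order_trans)
    with 1 have "\<bar>k (u + v) - k u\<bar> \<le> L * (q ^ j * \<bar>a u\<bar>) + L * \<bar>a u\<bar> * (q ^ j / (q - 1))" by linarith
    also have "\<dots> = (L * (1 + 1 / (q - 1)) * \<bar>a u\<bar>) * q ^ j" by (simp add: algebra_simps)
    also have "\<dots> \<le> (L * (1 + 1 / (q - 1)) * \<bar>a u\<bar>) * exp (\<epsilon> * v)"
      using q L0 qv by (intro mult_left_mono mult_nonneg_nonneg) auto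
    finally show "\<bar>k (u + v) - k u\<bar> \<le> (L * (1 + 1 / (q - 1))) * \<bar>a u\<bar> * exp (\<epsilon> * v)" .
  qed
qed


section \<open>Multiplicative form: first-order limit, positivity and a uniform second-order
  bound\<close>

lemma second_order_RV_imp_RV:
  assumes "second_order_RV f \<alpha> \<tau> A" "s > 0"
  shows "((\<lambda>t. f (t * s) / f t) \<longlongrightarrow> s powr (- \<alpha>)) at_top"
proof -
  have A0: "(A \<longlongrightarrow> 0) at_top" and nz: "\<forall>\<^sub>F t in at_top. A t \<noteq> 0"
    and L: "((\<lambda>t. (f (t * s) / f t - s powr (- \<alpha>)) / A t) \<longlongrightarrow> s powr (- \<alpha>) * bc \<tau> s) at_top"
    using assms by (auto simp: second_order_RV_def elim: eventually_mono)
  have "((\<lambda>t. (f (t * s) / f t - s powr (- \<alpha>)) / A t * A t + s powr (- \<alpha>)) \<longlongrightarrow> s powr (- \<alpha>) * bc \<tau> s * 0 + s powr (- \<alpha>)) at_top"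
    by (intro tendsto_intros L A0)
  then have "((\<lambda>t. (f (t * s) / f t - s powr (- \<alpha>)) / A t * A t + s powr (- \<alpha>)) \<longlongrightarrow> s powr (- \<alpha>)) at_top" by simp
  then show ?thesis
    by (rule Lim_transform_eventually) (use nz in \<open>auto elim!: eventually_mono\<close>)
qed

text \<open>With \<open>f t = 1 - F (1 - 1 / t)\<close> the two conclusions say that
  \<open>F\<close> stays below \<open>1\<close> to the left of \<open>1\<close> and that
  \<open>F 1 = 1\<close>.\<close>

lemma second_order_RV_tendsto_0:
  assumes RV: "second_order_RV f \<alpha> \<tau> A" and "\<alpha> > 0" and nonneg: "\<And>t. f t \<ge> 0"
    and mono: "\<And>s t. 0 < s \<Longrightarrow> s \<le> t \<Longrightarrow> f t \<le> f s"
  shows "\<And>t. t > 0 \<Longrightarrow> f t > 0" and "(\<lambda>n. f (2 ^ n)) \<longlonglongrightarrow> 0"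
proof -
  have lim: "((\<lambda>t. f (t * 2) / f t) \<longlongrightarrow> 2 powr (- \<alpha>)) at_top"
    using second_order_RV_imp_RV[OF RV, of 2] by simp
  have "\<forall>\<^sub>F t in at_top. f (t * 2) / f t > 0"
    by (rule order_tendstoD(1)[OF lim]) simp
  \<comment> \<open>Division by \<open>0\<close> yields \<open>0\<close>, so a positive quotient
    excludes \<open>f t = 0\<close>; monotonicity then carries positivity down to every positive
    argument.\<close>
  then have nz: "\<forall>\<^sub>F t in at_top. f t > 0"
    by (rule eventually_mono) (use nonneg in \<open>metis div_by_0 less_irrefl order_le_less\<close>)
  show pos: "f t > 0" if "t > 0" for t
  proof -
    have "\<forall>\<^sub>F s in at_top. f s > 0 \<and> s \<ge> t" using nz eventually_ge_at_top by (rule eventually_conj)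
    then obtain s where "f s > 0" "s \<ge> t" using eventually_happens'[OF trivial_limit_at_top_linorder] by blast
    then show ?thesis using mono[OF that] by fastforce
  qed
  have "decseq (\<lambda>n. f (2 ^ n))"
    by (auto simp: decseq_def intro!: mono power_increasing)
  then obtain L where L: "(\<lambda>n. f (2 ^ n)) \<longlonglongrightarrow> L" "\<And>n. L \<le> f (2 ^ n)"
    using decseq_convergent[of _ 0] nonneg by metis
  have L0: "L \<ge> 0" by (rule LIMSEQ_le_const[OF L(1)]) (use nonneg in auto)
  \<comment> \<open>A nonzero limit would make the ratio along powers of \<open>2\<close> tend to
    \<open>1\<close>, against \<open>2 powr (- \<alpha>) < 1\<close>.\<close>
  have "L = 0"
  proof (rule ccontr)
    assume "L \<noteq> 0"
    have "filterlim (\<lambda>n. 2 ^ n :: real) at_top sequentially"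
      by (rule filterlim_at_infinity_imp_filterlim_at_top[OF filterlim_realpow_sequentially_gt1]) auto
    then have "(\<lambda>n. f (2 ^ n * 2) / f (2 ^ n)) \<longlonglongrightarrow> 2 powr (- \<alpha>)"
      by (rule filterlim_compose[OF lim])
    moreover have "(\<lambda>n. f (2 ^ Suc n) / f (2 ^ n)) \<longlonglongrightarrow> L / L"
      using \<open>L \<noteq> 0\<close> L(1) LIMSEQ_Suc[OF L(1)] by (intro tendsto_divide)
    ultimately have "2 powr (- \<alpha>) = L / L" unfolding power_Suc2 by (rule LIMSEQ_unique)
    moreover have "2 powr (- \<alpha>) < 2 powr 0" using \<open>\<alpha> > 0\<close> by (intro powr_less_mono) auto
    ultimately show False using \<open>L \<noteq> 0\<close> by simp
  qed
  with L show "(\<lambda>n. f (2 ^ n)) \<longlonglongrightarrow> 0" by simp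
qed

text \<open>A Potter-type bound for the second-order remainder. For
  \<open>\<epsilon> < \<alpha>\<close> it decays as \<open>s\<close> grows; this supplies the
  dominating function at the ends of the angular interval, where the argument of \<open>f\<close>
  blows up.\<close>

lemma second_order_RV_bound:
  assumes RV: "second_order_RV f \<alpha> \<tau> A" and [measurable]: "f \<in> borel_measurable borel"
    and pos: "\<And>t. t > 0 \<Longrightarrow> f t > 0" and \<tau>: "\<tau> \<le> 0" and \<epsilon>: "\<epsilon> > 0" and s0: "s0 > 0"
  shows "\<exists>C. \<forall>\<^sub>F t in at_top. \<forall>s\<ge>s0. \<bar>f (t * s) / f t - s powr (- \<alpha>)\<bar> \<le> C * \<bar>A t\<bar> * s powr (\<epsilon> - \<alpha>)"
proof -
  have A0: "(A \<longlongrightarrow> 0) at_top" and Anz: "\<forall>\<^sub>F t in at_top. A t \<noteq> 0"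
    and L: "\<And>s. s > 0 \<Longrightarrow> ((\<lambda>t. (f (t * s) / f t - s powr (- \<alpha>)) / A t) \<longlongrightarrow> s powr (- \<alpha>) * bc \<tau> s) at_top"
    using RV by (auto simp: second_order_RV_def elim: eventually_mono)
  \<comment> \<open>Removing the power \<open>s powr (- \<alpha>)\<close> and passing to logarithms
    leaves an additive increment with limit exactly \<open>bc \<tau> (exp v)\<close>.\<close>
  define k where "k u = exp (\<alpha> * u) * f (exp u)" for u
  define a where "a u = A (exp u) * k u" for u
  have [measurable]: "k \<in> borel_measurable borel" unfolding k_def by measurable
  have kpos: "k u > 0" for u by (simp add: k_def pos)
  have nz: "\<forall>\<^sub>F u in at_top. a u \<noteq> 0"
    using eventually_compose_filterlim[OF Anz exp_at_top] by eventually_elim (use kpos in \<open>simp add: a_def less_imp_neq[symmetric]\<close>)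
  have keq: "(k (u + v) - k u) / a u = exp (\<alpha> * v) * ((f (exp u * exp v) / f (exp u) - exp v powr (- \<alpha>)) / A (exp u))" for u v
  proof -
    have "f (exp u) > 0" by (simp add: pos)
    then show ?thesis
      by (cases "A (exp u) = 0") (simp_all add: a_def k_def distrib_left exp_add powr_def exp_minus divide_simps, simp add: algebra_simps)
  qed
  have lim: "((\<lambda>u. (k (u + v) - k u) / a u) \<longlongrightarrow> bc \<tau> (exp v)) at_top" for v
  proof -
    have "((\<lambda>u. exp (\<alpha> * v) * ((f (exp u * exp v) / f (exp u) - exp v powr (- \<alpha>)) / A (exp u)))
       \<longlongrightarrow> exp (\<alpha> * v) * (exp v powr (- \<alpha>) * bc \<tau> (exp v))) at_top"
      by (intro tendsto_intros filterlim_compose[OF L exp_at_top]) simp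
    moreover have "exp (\<alpha> * v) * (exp v powr (- \<alpha>) * bc \<tau> (exp v)) = bc \<tau> (exp v)"
      by (simp add: powr_def exp_minus)
    ultimately show ?thesis by (simp add: keq)
  qed
  obtain C ub where C: "\<And>u v. u \<ge> ub \<Longrightarrow> v \<ge> 0 \<Longrightarrow> \<bar>k (u + v) - k u\<bar> \<le> C * \<bar>a u\<bar> * exp (\<epsilon> * v)"
    using extended_regular_variation_bound[OF _ lim nz \<tau> \<epsilon>] by auto
  \<comment> \<open>The additive bound starts at nonnegative increments, while \<open>ln s0\<close>
    may be negative. The base point is therefore moved to \<open>u + w\<close>, at the cost of the
    bounded quotients of \<open>a (u + w)\<close> and of \<open>k (u + w) - k u\<close> by
    \<open>a u\<close>.\<close>
  define w where "w = ln s0"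
  have rv: "((\<lambda>u. a (u + w) / a u) \<longlongrightarrow> exp (\<tau> * w)) at_top"
    by (rule auxiliary_function_regularly_varying[OF lim nz])
  define K1 where "K1 = \<bar>exp (\<tau> * w)\<bar> + 1"
  have E1: "\<forall>\<^sub>F u in at_top. \<bar>a (u + w) / a u\<bar> < K1"
    by (rule order_tendstoD(2)[OF tendsto_rabs[OF rv]]) (simp add: K1_def)
  define K2 where "K2 = \<bar>bc \<tau> (exp w)\<bar> + 1"
  have E2: "\<forall>\<^sub>F u in at_top. \<bar>(k (u + w) - k u) / a u\<bar> < K2"
    by (rule order_tendstoD(2)[OF tendsto_rabs[OF lim]]) (simp add: K2_def)
  define K where "K = (\<bar>C\<bar> * K1 + K2) * exp (- \<epsilon> * w)"
  have "\<forall>\<^sub>F u in at_top. \<forall>v\<ge>w. \<bar>k (u + v) - k u\<bar> \<le> K * \<bar>a u\<bar> * exp (\<epsilon> * v)"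
    using E1 E2 nz eventually_ge_at_top[of "ub - w"]
  proof eventually_elim
    case (elim u)
    have e1: "\<bar>a (u + w)\<bar> \<le> K1 * \<bar>a u\<bar>" and e2: "\<bar>k (u + w) - k u\<bar> \<le> K2 * \<bar>a u\<bar>"
      using elim by (auto simp: abs_divide field_simps)
    show ?case
    proof (intro allI impI)
      fix v assume v: "v \<ge> w"
      have "\<bar>k (u + w + (v - w)) - k (u + w)\<bar> \<le> C * \<bar>a (u + w)\<bar> * exp (\<epsilon> * (v - w))"
        using elim v by (intro C) auto
      also have "\<dots> \<le> \<bar>C\<bar> * (K1 * \<bar>a u\<bar>) * exp (\<epsilon> * (v - w))"
        by (intro mult_right_mono mult_mono e1) auto
      finally have 1: "\<bar>k (u + v) - k (u + w)\<bar> \<le> \<bar>C\<bar> * (K1 * \<bar>a u\<bar>) * exp (\<epsilon> * (v - w))" by simp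
      have "\<bar>k (u + w) - k u\<bar> \<le> K2 * \<bar>a u\<bar> * exp (\<epsilon> * (v - w))"
        using v \<epsilon> mult_left_mono[of 1 "exp (\<epsilon> * (v - w))" "K2 * \<bar>a u\<bar>"] by (intro order_trans[OF e2]) (auto simp: K2_def)
      with 1 have "\<bar>k (u + v) - k u\<bar> \<le> (\<bar>C\<bar> * K1 + K2) * \<bar>a u\<bar> * exp (\<epsilon> * (v - w))"
        by (simp add: algebra_simps)
      also have "\<dots> = K * \<bar>a u\<bar> * exp (\<epsilon> * v)"
        by (simp add: K_def right_diff_distrib exp_diff exp_minus field_simps)
      finally show "\<bar>k (u + v) - k u\<bar> \<le> K * \<bar>a u\<bar> * exp (\<epsilon> * v)" .
    qed
  qed
  from eventually_compose_filterlim[OF this ln_at_top] eventually_gt_at_top[of 0]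
    eventually_compose_filterlim[OF nz ln_at_top]
  have "\<forall>\<^sub>F t in at_top. \<forall>s\<ge>s0. \<bar>f (t * s) / f t - s powr (- \<alpha>)\<bar> \<le> K * \<bar>A t\<bar> * s powr (\<epsilon> - \<alpha>)"
  proof eventually_elim
    case (elim t)
    show ?case
    proof (intro allI impI)
      fix s assume s: "s \<ge> s0"
      then have s': "s > 0" using s0 by simp
      have "\<bar>k (ln t + ln s) - k (ln t)\<bar> \<le> K * \<bar>a (ln t)\<bar> * exp (\<epsilon> * ln s)"
        using elim(1) s s' s0 by (auto simp: w_def)
      then have "\<bar>(k (ln t + ln s) - k (ln t)) / a (ln t)\<bar> \<le> K * exp (\<epsilon> * ln s)"
        using elim(3) by (simp add: abs_divide field_simps)
      then have "\<bar>s powr \<alpha> * ((f (t * s) / f t - s powr (- \<alpha>)) / A t)\<bar> \<le> K * s powr \<epsilon>"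
        using s' elim(2) unfolding keq by (simp add: powr_def)
      moreover have "A t \<noteq> 0" using elim(2,3) by (simp add: a_def)
      ultimately have "s powr \<alpha> * \<bar>f (t * s) / f t - s powr (- \<alpha>)\<bar> \<le> K * s powr \<epsilon> * \<bar>A t\<bar>"
        by (simp only: abs_mult abs_divide) (simp add: pos_divide_le_eq)
      then show "\<bar>f (t * s) / f t - s powr (- \<alpha>)\<bar> \<le> K * \<bar>A t\<bar> * s powr (\<epsilon> - \<alpha>)"
        using s' by (simp add: powr_diff field_simps)
    qed
  qed
  then show ?thesis by blast
qed

section \<open>Polar coordinates and sector probabilities\<close>

text \<open>The angle is uniform on \<open>[0, 2 pi)\<close>, whereas the sectors lie around angle
  \<open>0\<close>; this moves the window of integration.\<close>

lemma nn_integral_periodic_shift: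
  fixes g :: "real \<Rightarrow> ennreal"
  assumes [measurable]: "g \<in> borel_measurable borel" and per: "\<And>\<theta>. g (\<theta> + p) = g \<theta>"
    and p: "p > 0" and c: "- p \<le> c" "c \<le> p"
  shows "(\<integral>\<^sup>+\<theta>. g \<theta> * indicator {c..<c + p} \<theta> \<partial>lborel) = (\<integral>\<^sup>+\<theta>. g \<theta> * indicator {0..<p} \<theta> \<partial>lborel)"
proof -
  have shift: "(\<integral>\<^sup>+\<theta>. g \<theta> * indicator {a + p..<b + p} \<theta> \<partial>lborel) = (\<integral>\<^sup>+\<theta>. g \<theta> * indicator {a..<b} \<theta> \<partial>lborel)" for a b
    by (subst nn_integral_real_affine[where c = 1 and t = p])
       (auto simp: per add.commute[of p] indicator_def intro!: nn_integral_cong)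
  have pos: "(\<integral>\<^sup>+\<theta>. g \<theta> * indicator {d..<d + p} \<theta> \<partial>lborel) = (\<integral>\<^sup>+\<theta>. g \<theta> * indicator {0..<p} \<theta> \<partial>lborel)"
    if d: "0 \<le> d" "d \<le> p" for d
  proof -
    have "(\<integral>\<^sup>+\<theta>. g \<theta> * indicator {d..<d + p} \<theta> \<partial>lborel) =
       (\<integral>\<^sup>+\<theta>. g \<theta> * indicator {d..<p} \<theta> + g \<theta> * indicator {0 + p..<d + p} \<theta> \<partial>lborel)"
      using d p by (auto intro!: nn_integral_cong simp: indicator_def)
    also have "\<dots> = (\<integral>\<^sup>+\<theta>. g \<theta> * indicator {d..<p} \<theta> \<partial>lborel) + (\<integral>\<^sup>+\<theta>. g \<theta> * indicator {0..<d} \<theta> \<partial>lborel)"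
      by (subst nn_integral_add) (auto simp: shift[of 0, symmetric])
    also have "\<dots> = (\<integral>\<^sup>+\<theta>. g \<theta> * indicator {d..<p} \<theta> + g \<theta> * indicator {0..<d} \<theta> \<partial>lborel)"
      by (subst nn_integral_add) auto
    also have "\<dots> = (\<integral>\<^sup>+\<theta>. g \<theta> * indicator {0..<p} \<theta> \<partial>lborel)"
      using d p by (auto intro!: nn_integral_cong simp: indicator_def)
    finally show ?thesis .
  qed
  show ?thesis
  proof (cases "c \<ge> 0")
    case False
    have "(\<integral>\<^sup>+\<theta>. g \<theta> * indicator {c..<c + p} \<theta> \<partial>lborel) = (\<integral>\<^sup>+\<theta>. g \<theta> * indicator {c + p..<c + p + p} \<theta> \<partial>lborel)"
      by (rule shift[symmetric])
    also have "\<dots> = (\<integral>\<^sup>+\<theta>. g \<theta> * indicator {0..<p} \<theta> \<partial>lborel)"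
      using c False by (intro pos) auto
    finally show ?thesis .
  qed (use pos c in auto)
qed

section \<open>The spherical vector in polar coordinates\<close>

locale spherical = prob_space M for M :: "'a measure" +
  fixes R \<Theta> :: "'a \<Rightarrow> real"
  assumes R_meas[measurable]: "R \<in> borel_measurable M" and \<Theta>_meas[measurable]: "\<Theta> \<in> borel_measurable M"
    and indep: "indep_var borel R borel \<Theta>"
    and unif: "distr M lborel \<Theta> = uniform_measure lborel {0..<2*pi}"
    and R_pos: "AE \<omega> in M. R \<omega> > 0"
begin

definition "D = distr M borel R"

lemma sets_D[simp, measurable_cong]: "sets D = sets borel" and space_D[simp]: "space D = UNIV"
  by (auto simp: D_def)

lemma prob_space_D: "prob_space D"
  unfolding D_def by (rule prob_space_distr) simp

lemma D_nonpos: "emeasure D {..0} = 0"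
proof -
  have "AE r in D. r > 0" unfolding D_def by (subst AE_distr_iff) (use R_pos in auto)
  then have "emeasure D {r \<in> space D. \<not> r > 0} = 0" by (subst AE_iff_measurable[symmetric, of _ D "\<lambda>r. r > 0"]) auto
  moreover have "{r \<in> space D. \<not> r > 0} = {..0}" by auto
  ultimately show ?thesis by simp
qed

lemma emeasure_R_\<Theta>:
  assumes [measurable]: "Measurable.pred (borel \<Otimes>\<^sub>M borel) (\<lambda>p. P (fst p) (snd p))"
  shows "emeasure M {\<omega> \<in> space M. P (R \<omega>) (\<Theta> \<omega>)} =
    (\<integral>\<^sup>+\<theta>. emeasure D {r. P r \<theta>} * indicator {0..<2*pi} \<theta> \<partial>lborel) / ennreal (2 * pi)"
    "(\<lambda>\<theta>. emeasure D {r. P r \<theta>}) \<in> borel_measurable borel"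
proof -
  interpret D: prob_space D by (rule prob_space_D)
  define T where "T = distr M borel \<Theta>"
  interpret T: prob_space T unfolding T_def by (rule prob_space_distr) simp
  interpret DT: pair_sigma_finite D T ..
  have sT[measurable_cong]: "sets T = sets borel" by (simp add: T_def)
  have T: "T = uniform_measure lborel {0..<2*pi}"
    unfolding unif[symmetric] T_def by (rule distr_cong) auto
  define E where "E = {p. P (fst p) (snd p)}"
  have E: "E \<in> sets (borel \<Otimes>\<^sub>M borel)"
    unfolding E_def using assms by (auto simp: pred_def space_pair_measure)
  have E': "E \<in> sets (D \<Otimes>\<^sub>M T)" using E by (simp add: sets_pair_measure_cong[OF sets_D sT])
  have "emeasure M {\<omega> \<in> space M. P (R \<omega>) (\<Theta> \<omega>)} = emeasure (distr M (borel \<Otimes>\<^sub>M borel) (\<lambda>\<omega>. (R \<omega>, \<Theta> \<omega>))) E"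
    using E by (subst emeasure_distr) (auto simp: E_def intro!: arg_cong2[where f = emeasure])
  also have "distr M (borel \<Otimes>\<^sub>M borel) (\<lambda>\<omega>. (R \<omega>, \<Theta> \<omega>)) = D \<Otimes>\<^sub>M T"
    using indep unfolding indep_var_distribution_eq D_def T_def by auto
  also have "emeasure (D \<Otimes>\<^sub>M T) E = (\<integral>\<^sup>+\<theta>. emeasure D ((\<lambda>r. (r, \<theta>)) -` E) \<partial>T)"
    by (rule DT.emeasure_pair_measure_alt2[OF E'])
  also have "(\<lambda>\<theta>. emeasure D ((\<lambda>r. (r, \<theta>)) -` E)) = (\<lambda>\<theta>. emeasure D {r. P r \<theta>})"
    by (auto simp: E_def intro!: ext arg_cong2[where f = emeasure])
  finally have 1: "emeasure M {\<omega> \<in> space M. P (R \<omega>) (\<Theta> \<omega>)} = (\<integral>\<^sup>+\<theta>. emeasure D {r. P r \<theta>} \<partial>T)" .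
  have "(\<lambda>\<theta>. emeasure D ((\<lambda>r. (r, \<theta>)) -` E)) \<in> borel_measurable T"
    by (rule DT.measurable_emeasure_Pair2[OF E'])
  then show meas: "(\<lambda>\<theta>. emeasure D {r. P r \<theta>}) \<in> borel_measurable borel"
    by (simp add: E_def vimage_def cong: measurable_cong_sets[OF sT refl])
  show "emeasure M {\<omega> \<in> space M. P (R \<omega>) (\<Theta> \<omega>)} =
    (\<integral>\<^sup>+\<theta>. emeasure D {r. P r \<theta>} * indicator {0..<2*pi} \<theta> \<partial>lborel) / ennreal (2 * pi)"
    unfolding 1 T using meas by (subst nn_integral_uniform_measure) auto
qed

lemma emeasure_polar:
  assumes E: "E \<in> sets (borel :: (real \<times> real) measure)" and c: "- 2 * pi \<le> c" "c \<le> 2 * pi"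
  shows "emeasure M {\<omega> \<in> space M. (R \<omega> * cos (\<Theta> \<omega>), R \<omega> * sin (\<Theta> \<omega>)) \<in> E} =
    (\<integral>\<^sup>+\<theta>. emeasure D {r. (r * cos \<theta>, r * sin \<theta>) \<in> E} * indicator {c..<c + 2*pi} \<theta> \<partial>lborel) / ennreal (2 * pi)"
    (is "?L = _")
    "(\<lambda>\<theta>. emeasure D {r. (r * cos \<theta>, r * sin \<theta>) \<in> E}) \<in> borel_measurable borel"
proof -
  have P: "Measurable.pred (borel \<Otimes>\<^sub>M borel) (\<lambda>p. (fst p * cos (snd p), fst p * sin (snd p)) \<in> E)"
  proof -
    have [measurable]: "E \<in> sets (borel \<Otimes>\<^sub>M borel)" unfolding borel_prod by (rule assms(1))
    show ?thesis by measurable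
  qed
  note 1 = emeasure_R_\<Theta>[OF P]
  show m: "(\<lambda>\<theta>. emeasure D {r. (r * cos \<theta>, r * sin \<theta>) \<in> E}) \<in> borel_measurable borel" by (rule 1)
  show "?L = (\<integral>\<^sup>+\<theta>. emeasure D {r. (r * cos \<theta>, r * sin \<theta>) \<in> E} * indicator {c..<c + 2*pi} \<theta> \<partial>lborel) / ennreal (2 * pi)"
    unfolding 1(1) using c
    by (subst nn_integral_periodic_shift[OF m, where p = "2 * pi"]) auto
qed

text \<open>Reflection across the line at angle \<open>\<phi> / 2\<close> preserves the law. With
  \<open>cos \<phi> = \<rho>\<close> it carries the second component of the pair to the place of the
  first, so one sector formula serves both.\<close>

lemma emeasure_reflect:
  assumes E: "E \<in> sets (borel :: (real \<times> real) measure)" and \<phi>: "0 \<le> \<phi>" "\<phi> \<le> 2 * pi"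
  shows "emeasure M {\<omega> \<in> space M. (R \<omega> * cos (\<phi> - \<Theta> \<omega>), R \<omega> * sin (\<phi> - \<Theta> \<omega>)) \<in> E} =
    emeasure M {\<omega> \<in> space M. (R \<omega> * cos (\<Theta> \<omega>), R \<omega> * sin (\<Theta> \<omega>)) \<in> E}"
proof -
  have P: "Measurable.pred (borel \<Otimes>\<^sub>M borel) (\<lambda>p. (fst p * cos (\<phi> - snd p), fst p * sin (\<phi> - snd p)) \<in> E)"
  proof -
    have [measurable]: "E \<in> sets (borel \<Otimes>\<^sub>M borel)" unfolding borel_prod by (rule assms(1))
    show ?thesis by measurable
  qed
  define g where "g \<theta> = emeasure D {r. (r * cos \<theta>, r * sin \<theta>) \<in> E}" for \<theta>
  have g[measurable]: "g \<in> borel_measurable borel"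
    unfolding g_def by (rule emeasure_polar(2)[OF E, of 0]) auto
  have "(\<integral>\<^sup>+\<theta>. g (\<phi> - \<theta>) * indicator {0..<2*pi} \<theta> \<partial>lborel) = (\<integral>\<^sup>+\<theta>. g \<theta> * indicator {\<phi> - 2 * pi<..\<phi>} \<theta> \<partial>lborel)"
    by (subst nn_integral_real_affine[where c = "-1" and t = \<phi>, of "\<lambda>\<theta>. g \<theta> * indicator {\<phi> - 2 * pi<..\<phi>} \<theta>"])
       (auto intro!: nn_integral_cong simp: indicator_def)
  \<comment> \<open>The reflection reverses the half-open interval; only its two endpoints
    change.\<close>
  also have "\<dots> = (\<integral>\<^sup>+\<theta>. g \<theta> * indicator {\<phi> - 2 * pi..<\<phi> - 2 * pi + 2 * pi} \<theta> \<partial>lborel)"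
    by (intro nn_integral_cong_AE AE_mp[OF AE_lborel_singleton[of \<phi>] AE_mp[OF AE_lborel_singleton[of "\<phi> - 2 * pi"] AE_I2]])
       (auto simp: indicator_def)
  finally have eq: "(\<integral>\<^sup>+\<theta>. g (\<phi> - \<theta>) * indicator {0..<2*pi} \<theta> \<partial>lborel) =
    (\<integral>\<^sup>+\<theta>. g \<theta> * indicator {\<phi> - 2 * pi..<\<phi> - 2 * pi + 2 * pi} \<theta> \<partial>lborel)" .
  have "emeasure M {\<omega> \<in> space M. (R \<omega> * cos (\<Theta> \<omega>), R \<omega> * sin (\<Theta> \<omega>)) \<in> E} =
     (\<integral>\<^sup>+\<theta>. g \<theta> * indicator {\<phi> - 2 * pi..<\<phi> - 2 * pi + 2 * pi} \<theta> \<partial>lborel) / ennreal (2 * pi)"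
    unfolding g_def by (rule emeasure_polar(1)[OF E]) (use \<phi> in auto)
  moreover have "emeasure M {\<omega> \<in> space M. (R \<omega> * cos (\<phi> - \<Theta> \<omega>), R \<omega> * sin (\<phi> - \<Theta> \<omega>)) \<in> E} =
     (\<integral>\<^sup>+\<theta>. g (\<phi> - \<theta>) * indicator {0..<2*pi} \<theta> \<partial>lborel) / ennreal (2 * pi)"
    unfolding g_def by (rule emeasure_R_\<Theta>(1)[OF P, unfolded fst_conv snd_conv])
  ultimately show ?thesis by (simp only: eq)
qed


text \<open>For a fixed positive radius at most two angles per turn give a prescribed first
  coordinate, so conditioning on the radius removes all atoms, even if the radius itself has
  some.\<close>

lemma prob_S1_eq_0: "prob {\<omega> \<in> space M. R \<omega> * cos (\<Theta> \<omega>) = t} = 0"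
proof -
  have P: "Measurable.pred (borel \<Otimes>\<^sub>M borel) (\<lambda>p. fst p * cos (snd p) = t)"
    by measurable
  interpret D: prob_space D by (rule prob_space_D)
  define T where "T = distr M borel \<Theta>"
  interpret T: prob_space T unfolding T_def by (rule prob_space_distr) simp
  have sT[measurable_cong]: "sets T = sets borel" by (simp add: T_def)
  have T: "T = uniform_measure lborel {0..<2*pi}"
    unfolding unif[symmetric] T_def by (rule distr_cong) auto
  define E where "E = {p. fst p * cos (snd p) = t}"
  have E: "E \<in> sets (borel \<Otimes>\<^sub>M borel)"
    unfolding E_def using P by (auto simp: pred_def space_pair_measure)
  have E': "E \<in> sets (D \<Otimes>\<^sub>M T)" using E by (simp add: sets_pair_measure_cong[OF sets_D sT])
  have fin: "finite {\<theta>. 0 \<le> \<theta> \<and> \<theta> < 2 * pi \<and> cos \<theta> = c}" for c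
  proof (rule finite_subset)
    show "{\<theta>. 0 \<le> \<theta> \<and> \<theta> < 2 * pi \<and> cos \<theta> = c} \<subseteq> {arccos c, 2 * pi - arccos c}"
    proof
      fix \<theta> assume "\<theta> \<in> {\<theta>. 0 \<le> \<theta> \<and> \<theta> < 2 * pi \<and> cos \<theta> = c}"
      then have \<theta>: "0 \<le> \<theta>" "\<theta> < 2 * pi" and c: "c = cos \<theta>" by auto
      show "\<theta> \<in> {arccos c, 2 * pi - arccos c}"
      proof (cases "\<theta> \<le> pi")
        case False
        have "arccos (cos (2 * pi - \<theta>)) = 2 * pi - \<theta>" using False \<theta> by (intro arccos_cos) auto
        then have "\<theta> = 2 * pi - arccos c" by (simp add: c cos_diff)
        then show ?thesis by blast
      qed (use \<theta> c in \<open>simp add: arccos_cos\<close>)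
    qed
  qed simp
  have zero: "emeasure T (Pair r -` E) = 0" if "r > 0" for r
  proof -
    have "{0..<2*pi} \<inter> Pair r -` E = {\<theta>. 0 \<le> \<theta> \<and> \<theta> < 2 * pi \<and> cos \<theta> = t / r}"
      using that by (auto simp: E_def nonzero_eq_divide_eq mult.commute)
    then have "emeasure lborel ({0..<2*pi} \<inter> Pair r -` E) = 0"
      using emeasure_lborel_countable[OF countable_finite[OF fin[of "t / r"]]] by (simp only:)
    moreover have "Pair r -` E \<in> sets borel" using sets_Pair1[OF E] by simp
    ultimately show ?thesis unfolding T by (subst emeasure_uniform_measure) auto
  qed
  have "emeasure M {\<omega> \<in> space M. R \<omega> * cos (\<Theta> \<omega>) = t} = emeasure (distr M (borel \<Otimes>\<^sub>M borel) (\<lambda>\<omega>. (R \<omega>, \<Theta> \<omega>))) E"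
    using E by (subst emeasure_distr) (auto simp: E_def intro!: arg_cong2[where f = emeasure])
  also have "distr M (borel \<Otimes>\<^sub>M borel) (\<lambda>\<omega>. (R \<omega>, \<Theta> \<omega>)) = D \<Otimes>\<^sub>M T"
    using indep unfolding indep_var_distribution_eq D_def T_def by auto
  also have "emeasure (D \<Otimes>\<^sub>M T) E = (\<integral>\<^sup>+r. emeasure T (Pair r -` E) \<partial>D)"
    by (rule T.emeasure_pair_measure_alt[OF E'])
  also have "\<dots> = (\<integral>\<^sup>+r. 0 \<partial>D)"
  proof (rule nn_integral_cong_AE)
    have "AE r in D. r > 0" unfolding D_def by (subst AE_distr_iff) (use R_pos in auto)
    then show "AE r in D. emeasure T (Pair r -` E) = 0" using zero by auto
  qed
  finally show ?thesis by (simp add: measure_def)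
qed

end

section \<open>Sectors in the substituted angular variable\<close>

text \<open>\<open>slope w s\<close> is the tangent of the angle \<open>\<vartheta>\<close> with \<open>(1 - w) / cos \<vartheta> = 1 - w (1 - s\<^sup>2)\<close>, whose sign is that of \<open>s\<close>;
  \<open>kap w * jac w s\<close> is the derivative of \<open>\<vartheta>\<close> in \<open>s\<close>.\<close>

definition kap :: "real \<Rightarrow> real" where "kap w = sqrt (2 * w / (1 - w))"

definition slope :: "real \<Rightarrow> real \<Rightarrow> real" where
  "slope w s = kap w * s * sqrt (1 + (kap w)\<^sup>2 * s\<^sup>2 / 4)"

definition jac :: "real \<Rightarrow> real \<Rightarrow> real" where
  "jac w s = 1 / ((1 + (kap w)\<^sup>2 * s\<^sup>2 / 2) * sqrt (1 + (kap w)\<^sup>2 * s\<^sup>2 / 4))"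

text \<open>The inner root in \<open>slope\<close> is chosen so that the squared secant is a perfect
  square. The cosine is then rational in \<open>s\<close>, and with \<open>kap w\<close> squared
  equal to \<open>2 * w / (1 - w)\<close> it equals
  \<open>(1 - w) / (1 - w * (1 - s^2))\<close>.\<close>

lemma slope_sq: "1 + (slope w s)\<^sup>2 = (1 + (kap w)\<^sup>2 * s\<^sup>2 / 2)\<^sup>2"
proof -
  have "(slope w s)\<^sup>2 = (kap w)\<^sup>2 * s\<^sup>2 * (1 + (kap w)\<^sup>2 * s\<^sup>2 / 4)"
    unfolding slope_def by (simp add: power_mult_distrib add_nonneg_nonneg)
  then show ?thesis by (simp add: power2_eq_square algebra_simps)
qed

lemma cos_arctan_slope: "cos (arctan (slope w s)) = 1 / (1 + (kap w)\<^sup>2 * s\<^sup>2 / 2)"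
proof -
  have "sqrt (1 + (slope w s)\<^sup>2) = 1 + (kap w)\<^sup>2 * s\<^sup>2 / 2"
    unfolding slope_sq by (rule real_sqrt_unique) auto
  then show ?thesis by (simp add: cos_arctan)
qed

lemma slope_has_derivative:
  "((\<lambda>s. arctan (slope w s)) has_real_derivative kap w * jac w s) (at s)"
proof -
  define k where "k = kap w"
  define q where "q = sqrt (1 + k\<^sup>2 * s\<^sup>2 / 4)"
  have pos: "1 + k\<^sup>2 * s\<^sup>2 / 4 > 0" by (simp add: add_pos_nonneg)
  have q: "q > 0" "q\<^sup>2 = 1 + k\<^sup>2 * s\<^sup>2 / 4" using pos by (auto simp: q_def)
  have "(slope w has_real_derivative (k * q + k * s * (k\<^sup>2 * s / 2 / (2 * q)))) (at s)"
    unfolding slope_def[abs_def] k_def[symmetric] q_def using pos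
    by (auto intro!: derivative_eq_intros simp: field_simps)
  moreover have "k * q + k * s * (k\<^sup>2 * s / 2 / (2 * q)) = k * (1 + k\<^sup>2 * s\<^sup>2 / 2) / q"
  proof -
    have "k * q + k * s * (k\<^sup>2 * s / 2 / (2 * q)) = k * (q\<^sup>2 + k\<^sup>2 * s\<^sup>2 / 4) / q"
      using q(1) by (simp add: field_simps power2_eq_square)
    then show ?thesis by (simp add: q(2))
  qed
  ultimately have "((\<lambda>s. arctan (slope w s)) has_real_derivative
      inverse (1 + (slope w s)\<^sup>2) * (k * (1 + k\<^sup>2 * s\<^sup>2 / 2) / q)) (at s)"
    by (auto intro!: derivative_eq_intros)
  moreover have "inverse (1 + (slope w s)\<^sup>2) * (k * (1 + k\<^sup>2 * s\<^sup>2 / 2) / q) = kap w * jac w s"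
  proof -
    have "1 + k\<^sup>2 * s\<^sup>2 / 2 > 0" by (simp add: add_pos_nonneg)
    then show ?thesis unfolding slope_sq jac_def k_def[symmetric] q_def[symmetric]
      using q(1) by (simp add: divide_simps power2_eq_square)
  qed
  ultimately show ?thesis by simp
qed

lemma jac_pos: "jac w s > 0"
  unfolding jac_def by (intro divide_pos_pos mult_pos_pos) (auto simp: add_pos_nonneg)

lemma jac_le_1: "jac w s \<le> 1"
proof -
  have "1 * 1 \<le> (1 + (kap w)\<^sup>2 * s\<^sup>2 / 2) * sqrt (1 + (kap w)\<^sup>2 * s\<^sup>2 / 4)"
    by (intro mult_mono) auto
  then show ?thesis unfolding jac_def by simp
qed

lemma continuous_on_jac: "continuous_on S (jac w)"
proof -
  have "(1 + (kap w)\<^sup>2 * s\<^sup>2 / 2) * sqrt (1 + (kap w)\<^sup>2 * s\<^sup>2 / 4) \<noteq> 0" for s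
    using jac_pos[of w s] unfolding jac_def by force
  then show ?thesis unfolding jac_def[abs_def] by (intro continuous_intros) auto
qed

lemma borel_measurable_jac[measurable]: "jac w \<in> borel_measurable borel"
  using continuous_on_jac borel_measurable_continuous_onI by blast

text \<open>The probability of the sector where the first coordinate exceeds \<open>1 - w\<close>
  and the second is at most \<open>slope w z\<close> times the first, written in the substituted
  variable; \<open>z = 1\<close> gives the whole upper tail of the first coordinate.\<close>

definition sect :: "(real \<Rightarrow> real) \<Rightarrow> real \<Rightarrow> real \<Rightarrow> real" where
  "sect F w z = kap w / (2 * pi) * (LBINT s:{-1..z}. (1 - F (1 - w * (1 - s\<^sup>2))) * jac w s)"

context spherical begin

text \<open>\<open>T\<close> may contain the bounding slope or not, because the two sectors of the
  exceedance event meet along a ray that only one of them may own. For \<open>z = 1\<close> anything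
  above the slope is allowed: there the threshold is out of reach of radii at most
  \<open>1\<close>.\<close>

lemma prob_sector:
  assumes F_def: "F = cdf D" and F1: "F 1 = 1" and w: "0 < w" "w < 1" and z: "-1 \<le> z" "z \<le> 1"
    and T[measurable]: "T \<in> sets borel" and T1: "{..<slope w z} \<subseteq> T" and T2: "T \<subseteq> {..slope w z} \<or> z = 1"
  shows "prob {\<omega> \<in> space M. R \<omega> * cos (\<Theta> \<omega>) > 1 - w \<and> (R \<omega> * sin (\<Theta> \<omega>)) / (R \<omega> * cos (\<Theta> \<omega>)) \<in> T} = sect F w z"
proof -
  interpret D: prob_space D by (rule prob_space_D)
  interpret D: real_distribution D by standard auto
  define u where "u = 1 - w"
  have u: "0 < u" "u < 1" using w by (auto simp: u_def)
  have k2: "(kap w)\<^sup>2 = 2 * w / u" using w by (simp add: kap_def u_def)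
  have kpos: "kap w > 0" using w by (simp add: kap_def)
  have F_mono: "mono F" unfolding F_def by (simp add: D.cdf_nondecreasing mono_def)
  have [measurable]: "F \<in> borel_measurable borel" by (rule borel_measurable_mono[OF F_mono])
  have F_le1: "F t \<le> 1" for t unfolding F_def by (rule D.cdf_bounded_prob)
  have F_one: "F t = 1" if "t \<ge> 1" for t using monoD[OF F_mono that] F1 F_le1[of t] by simp
  define E where "E = {p :: real \<times> real. fst p > u \<and> snd p / fst p \<in> T}"
  have E[measurable]: "E \<in> sets borel"
  proof -
    have "E = {p \<in> space (borel \<Otimes>\<^sub>M borel). fst p > u \<and> snd p / fst p \<in> T}" by (auto simp: E_def space_pair_measure)
    also have "\<dots> \<in> sets (borel \<Otimes>\<^sub>M borel)" by measurable
    finally show ?thesis unfolding borel_prod .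
  qed
  define \<theta> where "\<theta> s = arctan (slope w s)" for s
  have cos\<theta>: "cos (\<theta> s) = u / (1 - w * (1 - s\<^sup>2))" for s
  proof -
    have "1 + (kap w)\<^sup>2 * s\<^sup>2 / 2 = (1 - w * (1 - s\<^sup>2)) / u" using u unfolding k2 by (simp add: field_simps u_def)
    then show ?thesis unfolding \<theta>_def cos_arctan_slope by simp
  qed
  have \<theta>1: "cos (\<theta> 1) = u" "\<theta> (-1) = - \<theta> 1" "0 < \<theta> 1" "\<theta> 1 < pi / 2"
    using cos\<theta>[of 1] arctan_ubound kpos by (auto simp: \<theta>_def slope_def arctan_minus add_pos_nonneg)
  have \<theta>z: "- \<theta> 1 \<le> \<theta> z" "\<theta> z \<le> \<theta> 1" "\<theta> z < pi / 2"
  proof -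
    have mono: "\<theta> s \<le> \<theta> t" if "s \<le> t" for s t
    proof (rule DERIV_nonneg_imp_nondecreasing[OF that])
      show "\<exists>y. (\<theta> has_real_derivative y) (at x) \<and> 0 \<le> y" for x
        using slope_has_derivative[of w x] kpos jac_pos[of w x] unfolding \<theta>_def[abs_def]
        by (intro exI[of _ "kap w * jac w x"]) auto
    qed
    show "- \<theta> 1 \<le> \<theta> z" "\<theta> z \<le> \<theta> 1" using mono[of "-1" z] mono[of z 1] z \<theta>1 by auto
    then show "\<theta> z < pi / 2" using \<theta>1 by simp
  qed
  have tanT: "tan \<theta>' \<in> T \<longleftrightarrow> \<theta>' < \<theta> z" if "- pi / 2 < \<theta>'" "\<theta>' < pi / 2" "\<theta>' \<noteq> \<theta> z" "z \<noteq> 1 \<or> \<theta>' < \<theta> 1" for \<theta>'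
  proof -
    have "arctan (tan \<theta>') = \<theta>'" using that(1,2) by (intro arctan_tan) auto
    then have lt: "\<theta>' < \<theta> z \<longleftrightarrow> tan \<theta>' < slope w z" and ne: "tan \<theta>' \<noteq> slope w z"
      using that(3) arctan_less_iff[of "tan \<theta>'" "slope w z"] unfolding \<theta>_def by auto
    show ?thesis
    proof
      assume "\<theta>' < \<theta> z" then show "tan \<theta>' \<in> T" using lt T1 by auto
    next
      assume "tan \<theta>' \<in> T"
      then show "\<theta>' < \<theta> z" using lt ne T2 that(4) by (cases "z = 1") auto
    qed
  qed
  \<comment> \<open>Off the bounding ray, which is a single angle, the radial probability is the
    tail of \<open>F\<close> at the distance to the threshold line. It vanishes outside the
    sector.\<close>
  have g: "emeasure D {r. (r * cos \<theta>', r * sin \<theta>') \<in> E} * indicator {-pi..<-pi + 2*pi} \<theta>' =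
      ennreal (1 - F (u / cos \<theta>')) * indicator {\<theta> (-1)..\<theta> z} \<theta>'"
    if ne: "\<theta>' \<noteq> \<theta> z" for \<theta>'
  proof (cases "- pi / 2 < \<theta>' \<and> \<theta>' < pi / 2")
    case True
    then have c: "cos \<theta>' > 0" by (intro cos_gt_zero_pi) auto
    have ind: "indicator {-pi..<-pi + 2*pi} \<theta>' = (1 :: ennreal)" using True by (auto simp: indicator_def)
    have eq: "{r. (r * cos \<theta>', r * sin \<theta>') \<in> E} = (if tan \<theta>' \<in> T then {u / cos \<theta>'<..} else {})"
    proof -
      have "(r * cos \<theta>', r * sin \<theta>') \<in> E \<longleftrightarrow> r > u / cos \<theta>' \<and> tan \<theta>' \<in> T" for r
      proof -
        have "r > u / cos \<theta>' \<Longrightarrow> r * sin \<theta>' / (r * cos \<theta>') = tan \<theta>'"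
        proof -
          assume "r > u / cos \<theta>'"
          moreover have "u / cos \<theta>' > 0" using u c by simp
          ultimately have "r \<noteq> 0" by auto
          then show ?thesis by (simp add: tan_def)
        qed
        moreover have "r > u / cos \<theta>' \<longleftrightarrow> r * cos \<theta>' > u" using c by (simp add: pos_divide_less_eq)
        ultimately show ?thesis unfolding E_def by auto
      qed
      then show ?thesis by (cases "tan \<theta>' \<in> T") (simp_all add: greaterThan_def)
    qed
    have em: "emeasure D {t<..} = ennreal (1 - F t)" for t
    proof -
      have "{t<..} = space D - {..t}" by auto
      then have "measure D {t<..} = 1 - measure D {..t}"
        using D.prob_compl[of "{..t}"] by simp
      then show ?thesis by (simp add: D.emeasure_eq_measure F_def cdf_def)
    qed
    show ?thesis
    proof (cases "\<bar>\<theta>'\<bar> < \<theta> 1")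
      case True
      then have "tan \<theta>' \<in> T \<longleftrightarrow> \<theta>' < \<theta> z" using \<theta>1 ne by (intro tanT) auto
      moreover have "\<theta>' \<in> {\<theta> (-1)..\<theta> z} \<longleftrightarrow> \<theta>' < \<theta> z" using True \<theta>1 ne by auto
      ultimately show ?thesis unfolding eq ind by (cases "\<theta>' < \<theta> z") (simp_all add: em)
    next
      case False
      \<comment> \<open>At angles beyond \<open>\<theta> 1\<close> the threshold line is at distance
        at least \<open>1\<close> from the origin, where the tail of \<open>F\<close>
        vanishes.\<close>
      have "cos \<theta>' \<le> cos (\<theta> 1)"
      proof -
        have "cos \<bar>\<theta>'\<bar> \<le> cos (\<theta> 1)" using False True \<theta>1 by (intro cos_monotone_0_pi_le) auto
        then show ?thesis by (simp only: cos_abs_real)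
      qed
      then have "u / cos \<theta>' \<ge> 1" using c \<theta>1(1) by simp
      then have "F (u / cos \<theta>') = 1" by (rule F_one)
      then show ?thesis unfolding eq ind by (simp add: em)
    qed
  next
    case False
    have notin: "\<theta>' \<notin> {\<theta> (-1)..\<theta> z}" using False \<theta>1 \<theta>z by auto
    show ?thesis
    proof (cases "\<theta>' \<in> {-pi..<pi}")
      case True
      have c: "cos \<theta>' \<le> 0"
      proof -
        have "cos \<bar>\<theta>'\<bar> \<le> cos (pi / 2)" using False True by (intro cos_monotone_0_pi_le) auto
        then show ?thesis by (simp only: cos_abs_real cos_pi_half)
      qed
      \<comment> \<open>In the left half-plane a positive first coordinate forces a nonpositive
        radius, which is a null event.\<close>
      have "{r. (r * cos \<theta>', r * sin \<theta>') \<in> E} \<subseteq> {..0}"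
      proof
        fix r assume "r \<in> {r. (r * cos \<theta>', r * sin \<theta>') \<in> E}"
        then have "r * cos \<theta>' > 0" using u by (simp add: E_def)
        then show "r \<in> {..0}" using c by (auto simp: zero_less_mult_iff)
      qed
      then have "emeasure D {r. (r * cos \<theta>', r * sin \<theta>') \<in> E} = 0"
        by (intro emeasure_eq_0[OF _ D_nonpos]) auto
      then show ?thesis using notin by simp
    qed (use notin in auto)
  qed
  have ev: "{\<omega> \<in> space M. R \<omega> * cos (\<Theta> \<omega>) > 1 - w \<and> (R \<omega> * sin (\<Theta> \<omega>)) / (R \<omega> * cos (\<Theta> \<omega>)) \<in> T} =
     {\<omega> \<in> space M. (R \<omega> * cos (\<Theta> \<omega>), R \<omega> * sin (\<Theta> \<omega>)) \<in> E}" (is "?S = _") by (auto simp: E_def u_def)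
  have "emeasure M ?S = (\<integral>\<^sup>+\<theta>'. emeasure D {r. (r * cos \<theta>', r * sin \<theta>') \<in> E} * indicator {-pi..<-pi + 2*pi} \<theta>' \<partial>lborel) / ennreal (2 * pi)"
    unfolding ev by (rule emeasure_polar(1)[OF E]) auto
  also have "(\<integral>\<^sup>+\<theta>'. emeasure D {r. (r * cos \<theta>', r * sin \<theta>') \<in> E} * indicator {-pi..<-pi + 2*pi} \<theta>' \<partial>lborel) =
     (\<integral>\<^sup>+\<theta>'. ennreal ((1 - F (u / cos \<theta>')) * indicator {\<theta> (-1)..\<theta> z} \<theta>') \<partial>lborel)"
    by (intro nn_integral_cong_AE AE_mp[OF AE_lborel_singleton[of "\<theta> z"] AE_I2] impI)
       (subst g, assumption, simp add: indicator_def)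
  also have "\<dots> = (\<integral>\<^sup>+s. ennreal ((1 - F (u / cos (\<theta> s))) * (kap w * jac w s) * indicator {-1..z} s) \<partial>lborel)"
  proof (rule nn_integral_substitution)
    show "set_borel_measurable borel {\<theta> (-1)..\<theta> z} (\<lambda>x. 1 - F (u / cos x))"
      unfolding set_borel_measurable_def by measurable
    show "(\<theta> has_real_derivative kap w * jac w x) (at x)" for x
      unfolding \<theta>_def[abs_def] by (rule slope_has_derivative)
    show "continuous_on {-1..z} (\<lambda>s. kap w * jac w s)" by (intro continuous_intros continuous_on_jac)
    show "0 \<le> kap w * jac w x" for x using kpos jac_pos[of w x] by simp
  qed fact
  also have "\<dots> = (\<integral>\<^sup>+s. ennreal (kap w * (indicator {-1..z} s *\<^sub>R ((1 - F (1 - w * (1 - s\<^sup>2))) * jac w s))) \<partial>lborel)"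
  proof (intro nn_integral_cong arg_cong[where f = ennreal])
    fix s :: real
    have "u / cos (\<theta> s) = 1 - w * (1 - s\<^sup>2)" using u by (simp add: cos\<theta>)
    then show "(1 - F (u / cos (\<theta> s))) * (kap w * jac w s) * indicator {-1..z} s = 
      kap w * (indicator {-1..z} s *\<^sub>R ((1 - F (1 - w * (1 - s\<^sup>2))) * jac w s))" by simp
  qed
  also have "\<dots> = ennreal (\<integral>s. kap w * (indicator {-1..z} s *\<^sub>R ((1 - F (1 - w * (1 - s\<^sup>2))) * jac w s)) \<partial>lborel)"
  proof (rule nn_integral_eq_integral)
    have "integrable lborel (\<lambda>s. indicator {-1..z} s *\<^sub>R ((1 - F (1 - w * (1 - s\<^sup>2))) * jac w s))"
    proof (rule integrableI_bounded_set_indicator[where B = 1])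
      have "F t \<ge> 0" for t unfolding F_def by (rule D.cdf_nonneg)
      then show "AE x in lborel. x \<in> {-1..z} \<longrightarrow> norm ((1 - F (1 - w * (1 - x\<^sup>2))) * jac w x) \<le> 1"
        using F_le1 jac_le_1 jac_pos[THEN less_imp_le] by (auto simp: abs_mult intro!: mult_le_one)
      show "emeasure lborel {-1..z} < \<infinity>" using z by simp
    qed auto
    then show "integrable lborel (\<lambda>s. kap w * (indicator {-1..z} s *\<^sub>R ((1 - F (1 - w * (1 - s\<^sup>2))) * jac w s)))" by simp
    show "AE s in lborel. 0 \<le> kap w * (indicator {-1..z} s *\<^sub>R ((1 - F (1 - w * (1 - s\<^sup>2))) * jac w s))"
      using F_le1 kpos jac_pos[THEN less_imp_le] by (intro AE_I2 mult_nonneg_nonneg) (auto simp: indicator_def)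
  qed
  also have "(\<integral>s. kap w * (indicator {-1..z} s *\<^sub>R ((1 - F (1 - w * (1 - s\<^sup>2))) * jac w s)) \<partial>lborel) =
      kap w * (LBINT s:{-1..z}. (1 - F (1 - w * (1 - s\<^sup>2))) * jac w s)"
    unfolding set_lebesgue_integral_def by simp
  finally have em: "emeasure M ?S = ennreal (kap w * (LBINT s:{-1..z}. (1 - F (1 - w * (1 - s\<^sup>2))) * jac w s)) / ennreal (2 * pi)" .
  have nn: "(LBINT s:{-1..z}. (1 - F (1 - w * (1 - s\<^sup>2))) * jac w s) \<ge> 0"
    unfolding set_lebesgue_integral_def
    using F_le1 jac_pos[THEN less_imp_le] by (intro Bochner_Integration.integral_nonneg) (auto simp: indicator_def)
  have "ennreal (prob ?S) = ennreal (kap w / (2 * pi) * (LBINT s:{-1..z}. (1 - F (1 - w * (1 - s\<^sup>2))) * jac w s))"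
    unfolding emeasure_eq_measure[symmetric] em using nn kpos by (subst divide_ennreal) auto
  then show ?thesis unfolding sect_def using nn kpos by (subst (asm) ennreal_inj) auto
qed


lemma prob_S1_gt:
  assumes "F = cdf D" "F 1 = 1" "0 < w" "w < 1"
  shows "prob {\<omega> \<in> space M. R \<omega> * cos (\<Theta> \<omega>) > 1 - w} = sect F w 1"
  using prob_sector[of F w 1 UNIV] assms by simp

text \<open>Both prescribed slopes describe the ray through the corner
  \<open>(1 - w1, 1 - w2)\<close>: on it the second orthogonal coordinate divided by the first is
  \<open>((1 - w2) / (1 - w1) - \<rho>) / sqrt (1 - \<rho>^2)\<close>, and exchanging the thresholds
  gives the reflected slope.\<close>

lemma prob_both_le:
  assumes F: "F = cdf D" "F 1 = 1" and w: "0 < w1" "w1 < 1" "0 < w2" "w2 < 1" and \<rho>: "0 < \<rho>" "\<rho> < 1"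
    and z1: "-1 \<le> z1" "z1 \<le> 1" "slope w1 z1 = ((1 - w2) / (1 - w1) - \<rho>) / sqrt (1 - \<rho>\<^sup>2)"
    and z2: "-1 \<le> z2" "z2 \<le> 1" "slope w2 z2 = ((1 - w1) / (1 - w2) - \<rho>) / sqrt (1 - \<rho>\<^sup>2)"
  shows "prob {\<omega> \<in> space M. R \<omega> * cos (\<Theta> \<omega>) \<le> 1 - w1 \<and>
      \<rho> * (R \<omega> * cos (\<Theta> \<omega>)) + sqrt (1 - \<rho>\<^sup>2) * (R \<omega> * sin (\<Theta> \<omega>)) \<le> 1 - w2} = 1 - (sect F w1 z1 + sect F w2 z2)"
proof -
  define u v where "u = 1 - w1" and "v = 1 - w2"
  have uv: "u > 0" "v > 0" using w by (auto simp: u_def v_def)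
  define \<sigma> where "\<sigma> = sqrt (1 - \<rho>\<^sup>2)"
  have \<rho>2: "\<rho>\<^sup>2 < 1" using \<rho> by (simp add: abs_square_less_1)
  have \<sigma>: "\<sigma> > 0" "\<sigma>\<^sup>2 = 1 - \<rho>\<^sup>2" using \<rho>2 by (auto simp: \<sigma>_def)
  define \<phi> where "\<phi> = arccos \<rho>"
  have \<phi>: "cos \<phi> = \<rho>" "sin \<phi> = \<sigma>" "0 \<le> \<phi>" "\<phi> \<le> 2 * pi"
    using \<rho> arccos_ubound[of \<rho>] by (auto simp: \<phi>_def \<sigma>_def sin_arccos arccos_lbound intro: order_trans)
  define S1 S2 where "S1 \<omega> = R \<omega> * cos (\<Theta> \<omega>)" and "S2 \<omega> = R \<omega> * sin (\<Theta> \<omega>)" for \<omega>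
  define H Z where "H \<omega> = R \<omega> * cos (\<phi> - \<Theta> \<omega>)" and "Z \<omega> = R \<omega> * sin (\<phi> - \<Theta> \<omega>)" for \<omega>
  have [measurable]: "S1 \<in> borel_measurable M" "S2 \<in> borel_measurable M" "H \<in> borel_measurable M" "Z \<in> borel_measurable M"
    unfolding S1_def S2_def H_def Z_def by measurable
  have H: "H \<omega> = \<rho> * S1 \<omega> + \<sigma> * S2 \<omega>" and Z: "Z \<omega> = \<sigma> * S1 \<omega> - \<rho> * S2 \<omega>" for \<omega>
    unfolding H_def Z_def S1_def S2_def cos_diff sin_diff \<phi> by (simp_all add: algebra_simps)
  \<comment> \<open>The reflection is an involution, so the first coordinate depends on
    \<open>H\<close>, \<open>Z\<close> exactly as \<open>H\<close> depends on \<open>S1\<close>,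
    \<open>S2\<close>. The same slope computation then applies to \<open>A2\<close>.\<close>
  have S1: "S1 \<omega> = \<rho> * H \<omega> + \<sigma> * Z \<omega>" for \<omega>
  proof -
    have "\<rho> * H \<omega> + \<sigma> * Z \<omega> = (\<rho>\<^sup>2 + \<sigma>\<^sup>2) * S1 \<omega>" unfolding H Z by (simp add: algebra_simps power2_eq_square)
    then show ?thesis by (simp add: \<sigma>(2))
  qed
  define q1 q2 where "q1 = slope w1 z1" and "q2 = slope w2 z2"
  have q: "q1 = (v / u - \<rho>) / \<sigma>" "q2 = (u / v - \<rho>) / \<sigma>" unfolding q1_def q2_def z1(3) z2(3) u_def v_def \<sigma>_def by auto
  have ratio: "s / r \<le> (b / a - \<rho>) / \<sigma> \<longleftrightarrow> (\<rho> * r + \<sigma> * s) * a \<le> r * b"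
    "s / r < (b / a - \<rho>) / \<sigma> \<longleftrightarrow> (\<rho> * r + \<sigma> * s) * a < r * b" if "r > 0" "a > 0" for r s a b
    using that \<sigma>(1) by (simp_all add: divide_simps) (simp_all add: algebra_simps)
  \<comment> \<open>The corner ray is included in \<open>A1\<close> and excluded from
    \<open>A2\<close>, which makes the two events disjoint.\<close>
  define A1 where "A1 = {\<omega> \<in> space M. S1 \<omega> > u \<and> S2 \<omega> / S1 \<omega> \<in> {..q1}}"
  define A2 where "A2 = {\<omega> \<in> space M. H \<omega> > v \<and> Z \<omega> / H \<omega> \<in> {..<q2}}"
  have [measurable]: "A1 \<in> events" "A2 \<in> events" unfolding A1_def A2_def by measurable
  have A1: "A1 = {\<omega> \<in> space M. S1 \<omega> > u \<and> H \<omega> * u \<le> S1 \<omega> * v}"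
    unfolding A1_def q H using ratio(1) uv by auto
  have A2: "A2 = {\<omega> \<in> space M. H \<omega> > v \<and> S1 \<omega> * v < H \<omega> * u}"
    unfolding A2_def q using ratio(2) uv by (auto simp: S1)
  have "prob A1 = sect F w1 z1"
    unfolding A1_def S1_def S2_def u_def
    by (rule prob_sector) (use F w z1 in \<open>auto simp: q1_def\<close>)
  moreover have "prob A2 = sect F w2 z2"
  proof -
    define E where "E = {p :: real \<times> real. fst p > v \<and> snd p / fst p \<in> {..<q2}}"
    have E: "E \<in> sets borel"
    proof -
      have "E = {p \<in> space (borel \<Otimes>\<^sub>M borel). fst p > v \<and> snd p / fst p \<in> {..<q2}}" by (auto simp: E_def space_pair_measure)
      also have "\<dots> \<in> sets (borel \<Otimes>\<^sub>M borel)" by measurable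
      finally show ?thesis unfolding borel_prod .
    qed
    have "emeasure M A2 = emeasure M {\<omega> \<in> space M. (H \<omega>, Z \<omega>) \<in> E}" by (simp add: A2_def E_def)
    also have "\<dots> = emeasure M {\<omega> \<in> space M. (S1 \<omega>, S2 \<omega>) \<in> E}"
      unfolding H_def Z_def S1_def S2_def by (rule emeasure_reflect[OF E \<phi>(3,4)])
    finally have "prob A2 = prob {\<omega> \<in> space M. (S1 \<omega>, S2 \<omega>) \<in> E}" by (simp add: measure_def)
    also have "\<dots> = prob {\<omega> \<in> space M. S1 \<omega> > 1 - w2 \<and> S2 \<omega> / S1 \<omega> \<in> {..<q2}}" by (simp add: E_def v_def)
    also have "\<dots> = sect F w2 z2"
      unfolding S1_def S2_def
      by (rule prob_sector) (use F w z2 in \<open>auto simp: q2_def\<close>)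
    finally show ?thesis .
  qed
  moreover have "prob (A1 \<union> A2) = prob A1 + prob A2"
    by (rule finite_measure_Union) (auto simp: A1 A2)
  moreover have "{\<omega> \<in> space M. S1 \<omega> \<le> u \<and> H \<omega> \<le> v} = space M - (A1 \<union> A2)"
  proof -
    \<comment> \<open>If only one threshold is exceeded, that alone decides the side of the corner
      ray; if both are, the point falls on exactly one side.\<close>
    have "(S1 \<omega> > u \<and> H \<omega> * u \<le> S1 \<omega> * v) \<or> (H \<omega> > v \<and> S1 \<omega> * v < H \<omega> * u) \<longleftrightarrow> S1 \<omega> > u \<or> H \<omega> > v" for \<omega>
    proof (intro iffI; elim disjE)
      assume "S1 \<omega> > u"
      then have "u * v < S1 \<omega> * v" using uv by simp
      then have "H \<omega> * u > S1 \<omega> * v \<Longrightarrow> H \<omega> * u > v * u" by (simp add: mult.commute)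
      then show "(S1 \<omega> > u \<and> H \<omega> * u \<le> S1 \<omega> * v) \<or> (H \<omega> > v \<and> S1 \<omega> * v < H \<omega> * u)"
        using uv \<open>S1 \<omega> > u\<close> by (cases "H \<omega> * u \<le> S1 \<omega> * v") auto
    next
      assume "H \<omega> > v"
      then have "u * v < H \<omega> * u" using uv by (simp add: mult.commute)
      then have "H \<omega> * u \<le> S1 \<omega> * v \<Longrightarrow> u * v < S1 \<omega> * v" by simp
      then show "(S1 \<omega> > u \<and> H \<omega> * u \<le> S1 \<omega> * v) \<or> (H \<omega> > v \<and> S1 \<omega> * v < H \<omega> * u)"
        using uv \<open>H \<omega> > v\<close> by (cases "H \<omega> * u \<le> S1 \<omega> * v") auto
    qed auto
    then show ?thesis unfolding A1 A2 by (auto simp: not_less[symmetric])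
  qed
  ultimately have "prob {\<omega> \<in> space M. S1 \<omega> \<le> u \<and> H \<omega> \<le> v} = 1 - (sect F w1 z1 + sect F w2 z2)"
    by (simp add: prob_compl)
  then show ?thesis unfolding H S1_def S2_def u_def v_def \<sigma>_def .
qed

text \<open>The integrand is strictly positive on the open interval, so its integral cannot
  vanish.\<close>

lemma sect_pos:
  assumes F_def: "F = cdf D" and F_lt: "\<And>t. t < 1 \<Longrightarrow> F t < 1" and w: "0 < w" "w < 1"
  shows "sect F w 1 > 0"
proof -
  interpret D: prob_space D by (rule prob_space_D)
  interpret D: real_distribution D by standard auto
  have F_mono: "mono F" unfolding F_def by (simp add: D.cdf_nondecreasing mono_def)
  have [measurable]: "F \<in> borel_measurable borel" by (rule borel_measurable_mono[OF F_mono])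
  have F_le1: "F t \<le> 1" for t unfolding F_def by (rule D.cdf_bounded_prob)
  have F_ge0: "F t \<ge> 0" for t unfolding F_def by (rule D.cdf_nonneg)
  define h where "h s = indicator {-1..1} s *\<^sub>R ((1 - F (1 - w * (1 - s\<^sup>2))) * jac w s)" for s :: real
  have h0: "h s \<ge> 0" for s using F_le1 jac_pos[THEN less_imp_le] by (auto simp: h_def indicator_def)
  have int: "integrable lborel h" unfolding h_def
  proof (rule integrableI_bounded_set_indicator[where B = 1])
    show "AE x in lborel. x \<in> {-1..1} \<longrightarrow> norm ((1 - F (1 - w * (1 - x\<^sup>2))) * jac w x) \<le> 1"
      using F_le1 F_ge0 jac_le_1 jac_pos[THEN less_imp_le] by (auto simp: abs_mult intro!: mult_le_one)
  qed auto
  have "integral\<^sup>L lborel h \<noteq> 0"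
  proof
    assume "integral\<^sup>L lborel h = 0"
    then have "AE s in lborel. h s = 0" using integral_nonneg_eq_0_iff_AE[OF int] h0 by auto
    moreover have hpos: "h s > 0" if "s \<in> {-1<..<1}" for s
    proof -
      have "s\<^sup>2 < 1" using that abs_square_less_1[of s] by auto
      then have "F (1 - w * (1 - s\<^sup>2)) < 1" using w by (intro F_lt) auto
      then show ?thesis using that jac_pos[of w s] by (simp add: h_def)
    qed
    ultimately have "AE s in lborel. s \<notin> {-1<..<1::real}" by (elim eventually_mono) (use hpos in force)
    then have "emeasure lborel {-1<..<1::real} = 0"
      by (subst AE_iff_measurable[symmetric, of _ lborel "\<lambda>s. s \<notin> {-1<..<1::real}"]) auto
    then show False by simp
  qed
  then have "integral\<^sup>L lborel h > 0" using h0 by (simp add: order_less_le Bochner_Integration.integral_nonneg)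
  moreover have "kap w > 0" using w by (simp add: kap_def)
  ultimately show ?thesis unfolding sect_def set_lebesgue_integral_def h_def[symmetric] by simp
qed

end

section \<open>Quantiles of the first component\<close>

text \<open>Right continuity would give only \<open>\<ge>\<close>; the left limit at the infimum
  gives \<open>\<le>\<close>.\<close>

lemma cdf_gen_inv:
  assumes "real_distribution D" and cont: "\<And>t. isCont (cdf D) t" and p: "0 < p" "p < 1"
  shows "cdf D (gen_inv (cdf D) p) = p"
proof -
  interpret real_distribution D by fact
  define S where "S = {t. p \<le> cdf D t}"
  have S_ne: "S \<noteq> {}"
  proof -
    have "\<forall>\<^sub>F t in at_top. p < cdf D t" using order_tendstoD(1)[OF cdf_lim_at_top_prob] p by auto
    then show ?thesis using eventually_happens'[OF trivial_limit_at_top_linorder] unfolding S_def by (metis (mono_tags, lifting) Collect_empty_eq less_imp_le)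
  qed
  have S_bdd: "bdd_below S"
  proof -
    have "\<forall>\<^sub>F t in at_bot. cdf D t < p" using order_tendstoD(2)[OF cdf_lim_at_bot] p by auto
    then obtain t where "cdf D t < p" using eventually_happens'[OF trivial_limit_at_bot_linorder] by blast
    then have "t \<le> s" if "s \<in> S" for s using that cdf_nondecreasing[of s t] unfolding S_def by (cases "t \<le> s") auto
    then show ?thesis by (auto simp: bdd_below_def)
  qed
  have S_closed: "closed S" unfolding S_def
    using cont by (intro closed_Collect_le continuous_at_imp_continuous_on continuous_intros) auto
  have 1: "Inf S \<in> S" by (rule closed_contains_Inf[OF S_ne S_bdd S_closed])
  have "cdf D (Inf S) \<le> p"
  proof (rule tendsto_upperbound)
    show "(cdf D \<longlongrightarrow> cdf D (Inf S)) (at_left (Inf S))"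
      using cont[of "Inf S"] by (auto simp: isCont_def intro: tendsto_within_subset)
    show "\<forall>\<^sub>F t in at_left (Inf S). cdf D t \<le> p"
      unfolding eventually_at_left_field
    proof (intro exI[of _ "Inf S - 1"] conjI allI impI)
      fix t assume "t < Inf S"
      then have "t \<notin> S" using cInf_lower[OF _ S_bdd] by fastforce
      then show "cdf D t \<le> p" by (simp add: S_def)
    qed simp
  qed simp
  with 1 show ?thesis unfolding gen_inv_def S_def[symmetric] by (simp add: S_def)
qed

context spherical begin

text \<open>Absence of atoms makes \<open>1 / n\<close> equal to a sector probability, not merely
  asymptotic to it, so no error enters when multiplying by \<open>n\<close> is replaced by dividing
  by \<open>sect F (a n) 1\<close>.\<close>

lemma quantile_S1:
  assumes F: "F = cdf D" "F 1 = 1" and F_lt: "\<And>t. t < 1 \<Longrightarrow> F t < 1"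
    and a: "a = (\<lambda>n. 1 - gen_inv (cdf (distr M borel (\<lambda>\<omega>. R \<omega> * cos (\<Theta> \<omega>)))) (1 - 1 / real n))"
  shows "a \<longlonglongrightarrow> 0" and "\<forall>\<^sub>F n in sequentially. 0 < a n \<and> a n < 1 \<and> sect F (a n) 1 = 1 / real n"
proof -
  define S where "S = distr M borel (\<lambda>\<omega>. R \<omega> * cos (\<Theta> \<omega>))"
  interpret S: real_distribution S unfolding S_def by (rule real_distribution_distr) simp
  define G where "G = cdf S"
  have G_alt: "G t = prob {\<omega> \<in> space M. R \<omega> * cos (\<Theta> \<omega>) \<le> t}" for t
    unfolding G_def S_def cdf_def by (subst measure_distr) (auto intro!: arg_cong[where f = prob])
  have G_mono: "s \<le> t \<Longrightarrow> G s \<le> G t" for s t unfolding G_def by (rule S.cdf_nondecreasing)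
  have cont: "isCont G t" for t
  proof -
    have "measure S {t} = prob {\<omega> \<in> space M. R \<omega> * cos (\<Theta> \<omega>) = t}"
      unfolding S_def by (subst measure_distr) (auto intro!: arg_cong[where f = prob])
    then show ?thesis unfolding G_def using prob_S1_eq_0 by (simp add: S.isCont_cdf)
  qed
  have G_gt: "1 - G t = prob {\<omega> \<in> space M. R \<omega> * cos (\<Theta> \<omega>) > t}" for t
  proof -
    have "{\<omega> \<in> space M. R \<omega> * cos (\<Theta> \<omega>) > t} = space M - {\<omega> \<in> space M. R \<omega> * cos (\<Theta> \<omega>) \<le> t}" by auto
    then show ?thesis unfolding G_alt by (simp add: prob_compl)
  qed
  have G_sect: "1 - G (1 - w) = sect F w 1" if "0 < w" "w < 1" for w
    unfolding G_gt by (rule prob_S1_gt[OF F that])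
  have G_lt: "G t < 1" if "t < 1" for t
  proof -
    \<comment> \<open>Replacing \<open>t\<close> by at least \<open>1/2\<close> keeps the width of
      the tail in \<open>(0, 1)\<close>, where the sector formula holds.\<close>
    have "1 - G (1 - (1 - max t (1/2))) > 0"
      using that by (subst G_sect) (auto intro!: sect_pos[OF F(1) F_lt])
    then show ?thesis using G_mono[of t "max t (1/2)"] by simp
  qed
  \<comment> \<open>Needed for \<open>a n > 0\<close>: a quantile at level \<open>1 - 1 / n\<close>
    below \<open>1\<close> must lie strictly below the point \<open>1\<close>.\<close>
  have G1: "G 1 = 1"
  proof -
    have "prob {\<omega> \<in> space M. R \<omega> \<le> 1} = F 1"
      unfolding F(1) D_def cdf_def by (subst measure_distr) (auto intro!: arg_cong[where f = prob])
    then have "AE \<omega> in M. R \<omega> \<le> 1" using F(2) prob_Collect_eq_1[of "\<lambda>\<omega>. R \<omega> \<le> 1"] by simp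
    with R_pos have "AE \<omega> in M. R \<omega> * cos (\<Theta> \<omega>) \<le> 1"
    proof eventually_elim
      case (elim \<omega>)
      have "R \<omega> * cos (\<Theta> \<omega>) \<le> R \<omega> * 1" using elim by (intro mult_left_mono) auto
      then show ?case using elim by linarith
    qed
    then show ?thesis unfolding G_alt by (subst prob_Collect_eq_1) auto
  qed
  define q where "q n = gen_inv G (1 - 1 / real n)" for n
  have aq: "a n = 1 - q n" for n unfolding a q_def G_def S_def ..
  have Gq: "G (q n) = 1 - 1 / real n" if "n \<ge> 2" for n
    unfolding q_def G_def using that cont[unfolded G_def] by (intro cdf_gen_inv S.real_distribution_axioms) auto
  have q1: "q n < 1" if "n \<ge> 2" for n
    using Gq[OF that] G1 G_mono[of 1 "q n"] that by (cases "q n < 1") auto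
  have q_gt: "\<forall>\<^sub>F n in sequentially. q n > 1 - \<epsilon>" if "\<epsilon> > 0" for \<epsilon>
  proof -
    have "(\<lambda>n. 1 - 1 / real n) \<longlonglongrightarrow> 1 - 0" by (intro tendsto_intros lim_1_over_n)
    then have "\<forall>\<^sub>F n in sequentially. G (1 - \<epsilon>) < 1 - 1 / real n"
      by (rule order_tendstoD) (use G_lt[of "1 - \<epsilon>"] that in auto)
    then show ?thesis using eventually_ge_at_top[of 2]
    proof eventually_elim
      case (elim n)
      then show ?case using Gq[of n] G_mono[of "q n" "1 - \<epsilon>"] by (cases "q n > 1 - \<epsilon>") auto
    qed
  qed
  show "a \<longlonglongrightarrow> 0"
  proof (rule tendstoI)
    fix \<epsilon> :: real assume "\<epsilon> > 0"
    from q_gt[OF this] eventually_ge_at_top[of 2]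
    show "\<forall>\<^sub>F n in sequentially. dist (a n) 0 < \<epsilon>"
      by eventually_elim (use q1 in \<open>force simp: aq dist_real_def\<close>)
  qed
  from q_gt[of 1, simplified] eventually_ge_at_top[of 2]
  show "\<forall>\<^sub>F n in sequentially. 0 < a n \<and> a n < 1 \<and> sect F (a n) 1 = 1 / real n"
  proof eventually_elim
    case (elim n)
    have "0 < a n" "a n < 1" using elim q1[of n] by (auto simp: aq)
    then show ?case using Gq[of n] elim G_sect[of "a n"] by (simp add: aq)
  qed
qed

end

section \<open>The limiting integrals\<close>

text \<open>The unnormalised \<open>psi\<close> on \<open>[-1, 1]\<close>.\<close>

definition Psi0 :: "real \<Rightarrow> real \<Rightarrow> real" where
  "Psi0 \<alpha> z = (LBINT s:{-1..z}. (1 - s\<^sup>2) powr \<alpha>)"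

text \<open>The companion integral, produced by the first-order term of the Jacobian.\<close>

definition Psi2 :: "real \<Rightarrow> real \<Rightarrow> real" where
  "Psi2 \<alpha> z = (LBINT s:{-1..z}. (1 - s\<^sup>2) powr \<alpha> * s\<^sup>2)"

lemma set_integrable_lborel_bounded:
  fixes f :: "real \<Rightarrow> real"
  assumes "f \<in> borel_measurable borel" and "\<And>s. s \<in> {a..b} \<Longrightarrow> \<bar>f s\<bar> \<le> B"
  shows "set_integrable lborel {a..b} f"
  unfolding set_integrable_def
  by (rule integrableI_bounded_set_indicator[where B = B]) (use assms in \<open>auto simp: emeasure_lborel_Icc_eq\<close>)

lemma sq_le_1: "-1 \<le> s \<Longrightarrow> s \<le> 1 \<Longrightarrow> s\<^sup>2 \<le> (1::real)"
  using abs_square_le_1[of s] by auto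

lemma powr_one_minus_sq_le_1: "\<alpha> \<ge> 0 \<Longrightarrow> -1 \<le> s \<Longrightarrow> s \<le> 1 \<Longrightarrow> (1 - s\<^sup>2) powr \<alpha> \<le> (1::real)"
  using sq_le_1[of s] by (intro powr_le1) auto

lemma set_integrable_powr_one_minus_sq:
  fixes \<alpha> :: real
  assumes "\<alpha> \<ge> 0" "z \<le> 1"
  shows "set_integrable lborel {-1..z} (\<lambda>s. (1 - s\<^sup>2) powr \<alpha>)"
    and "set_integrable lborel {-1..z} (\<lambda>s. (1 - s\<^sup>2) powr \<alpha> * s\<^sup>2)"
proof -
  show "set_integrable lborel {-1..z} (\<lambda>s. (1 - s\<^sup>2) powr \<alpha>)"
    by (rule set_integrable_lborel_bounded[where B = 1]) (use assms powr_one_minus_sq_le_1 in auto)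
  show "set_integrable lborel {-1..z} (\<lambda>s. (1 - s\<^sup>2) powr \<alpha> * s\<^sup>2)"
    by (rule set_integrable_lborel_bounded[where B = 1])
      (use assms powr_one_minus_sq_le_1 sq_le_1 in \<open>auto simp: abs_mult intro!: mult_le_one\<close>)
qed

text \<open>Regular variation is applied with factor \<open>1 / (\<xi> * (1 - s^2))\<close>; this
  turns its limit \<open>bc\<close> at a reciprocal into the kernel of \<open>Qn\<close>.\<close>

lemma qt_eq_bc: "u > 0 \<Longrightarrow> qt \<tau> u = bc \<tau> (1 / u)"
  by (auto simp: qt_def bc_def ln_div powr_minus powr_divide divide_simps)

text \<open>Separates the threshold \<open>\<xi>\<close> from the angular factor
  \<open>1 - s^2\<close>, which splits the \<open>A\<close> contribution into a multiple of
  \<open>psi\<close> and a multiple of \<open>J2\<close>.\<close>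

lemma qt_mult: "u > 0 \<Longrightarrow> v > 0 \<Longrightarrow> qt \<tau> (u * v) = qt \<tau> u + u powr (- \<tau>) * qt \<tau> v"
  by (auto simp: qt_def ln_mult powr_mult field_simps)

text \<open>At \<open>\<tau> = 0\<close> the logarithm diverges at \<open>0\<close> but is absorbed
  by the power \<open>v powr \<alpha>\<close>; for \<open>\<tau> < 0\<close> the kernel is bounded
  by itself.\<close>

lemma powr_qt_bounded:
  assumes "\<alpha> > 0" "\<tau> \<le> 0"
  shows "\<exists>B. \<forall>v. 0 \<le> v \<longrightarrow> v \<le> 1 \<longrightarrow> \<bar>v powr \<alpha> * qt \<tau> v\<bar> \<le> B"
proof (cases "\<tau> = 0")
  case True
  have "\<bar>v powr \<alpha> * qt \<tau> v\<bar> \<le> 1 / \<alpha>" if v: "0 \<le> v" "v \<le> 1" for v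
  proof (cases "v = 0")
    case False
    then have v0: "v > 0" using v by simp
    have "ln (1 / v) \<le> (1 / v) powr \<alpha> / \<alpha>" using v v0 assms by (intro ln_powr_bound) auto
    then have "v powr \<alpha> * ln (1 / v) \<le> v powr \<alpha> * ((1 / v) powr \<alpha> / \<alpha>)" by (intro mult_left_mono) auto
    also have "\<dots> = 1 / \<alpha>" using v0 by (simp add: powr_divide)
    finally show ?thesis using v v0 True by (simp add: qt_def abs_mult ln_div)
  qed (use assms in auto)
  then show ?thesis by blast
next
  case False
  have "\<bar>v powr \<alpha> * qt \<tau> v\<bar> \<le> 1 / \<bar>\<tau>\<bar>" if v: "0 \<le> v" "v \<le> 1" for v
  proof -
    have "0 \<le> v powr (- \<tau>)" "v powr (- \<tau>) \<le> 1" using v assms by (auto intro!: powr_le1)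
    then have "\<bar>v powr (- \<tau>) - 1\<bar> \<le> 1" by simp
    then have "\<bar>qt \<tau> v\<bar> \<le> 1 / \<bar>\<tau>\<bar>" using False by (simp add: qt_def abs_divide divide_right_mono)
    moreover have "v powr \<alpha> \<le> 1" using v assms by (auto intro!: powr_le1)
    ultimately have "v powr \<alpha> * \<bar>qt \<tau> v\<bar> \<le> 1 * (1 / \<bar>\<tau>\<bar>)" by (intro mult_mono) auto
    then show ?thesis by (simp add: abs_mult)
  qed
  then show ?thesis by blast
qed

lemma borel_measurable_qt[measurable]: "qt \<tau> \<in> borel_measurable borel"
  unfolding qt_def[abs_def] by (cases "\<tau> = 0") auto

lemma set_integrable_powr_qt:
  assumes "\<alpha> > 0" "\<tau> \<le> 0" "z \<le> 1"
  shows "set_integrable lborel {-1..z} (\<lambda>s. (1 - s\<^sup>2) powr \<alpha> * qt \<tau> (1 - s\<^sup>2))"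
proof -
  obtain B where B: "\<And>v. 0 \<le> v \<Longrightarrow> v \<le> 1 \<Longrightarrow> \<bar>v powr \<alpha> * qt \<tau> v\<bar> \<le> B"
    using powr_qt_bounded[OF assms(1,2)] by blast
  show ?thesis
    by (rule set_integrable_lborel_bounded[where B = B]) (use assms sq_le_1 in \<open>auto intro!: B\<close>)
qed

lemma J2_eq: "-1 \<le> z \<Longrightarrow> J2 \<alpha> \<tau> z = (LBINT s:{-1..z}. (1 - s\<^sup>2) powr \<alpha> * qt \<tau> (1 - s\<^sup>2))"
  unfolding J2_def by (rule interval_integral_Icc) simp

lemma I2_eq: "I2 \<alpha> \<tau> = J2 \<alpha> \<tau> 1"
proof -
  have "rt \<tau> \<alpha> w = w powr \<alpha> * qt \<tau> w" if "w > 0" for w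
    using that by (auto simp: rt_def qt_def powr_diff powr_minus field_simps)
  moreover have "1 - s\<^sup>2 > 0" if "-1 < s" "s < 1" for s :: real
    using that abs_square_less_1[of s] by auto
  ultimately show ?thesis unfolding I2_def J2_def
    by (intro interval_lebesgue_integral_cong) (auto simp: einterval_iff)
qed

section \<open>The normalising constant and the singular integral \<open>J1\<close>\<close>

text \<open>The affine change of variable from \<open>[0, 1]\<close> gives
  \<open>2 * 4 powr \<alpha>\<close> times a Beta integral with equal parameters. Legendre's
  duplication formula turns this into the closed form of \<open>c_alpha\<close>.\<close>

lemma Psi0_at_1: 
  assumes "\<alpha> > 0" shows "Psi0 \<alpha> 1 = c_alpha \<alpha>"
proof -
  have "Psi0 \<alpha> 1 = (\<integral>s. indicator {-1..1} s * (1 - s\<^sup>2) powr \<alpha> \<partial>lborel)"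
    unfolding Psi0_def set_lebesgue_integral_def by simp
  also have "\<dots> = 2 * (\<integral>t. indicator {-1..1} (-1 + 2 * t) * (1 - (-1 + 2 * t)\<^sup>2) powr \<alpha> \<partial>lborel)"
    by (subst lborel_integral_real_affine[where t = "-1" and c = 2]) auto
  also have "(\<lambda>t. indicator {-1..1} (-1 + 2 * t) * (1 - (-1 + 2 * t)\<^sup>2) powr \<alpha>) =
      (\<lambda>t. 4 powr \<alpha> * (indicator {0..1} t *\<^sub>R (t powr \<alpha> * (1 - t) powr \<alpha>)))"
  proof
    fix t :: real
    have "1 - (-1 + 2 * t)\<^sup>2 = 4 * (t * (1 - t))" by (simp add: power2_eq_square algebra_simps)
    then show "indicator {-1..1} (-1 + 2 * t) * (1 - (-1 + 2 * t)\<^sup>2) powr \<alpha> =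
      4 powr \<alpha> * (indicator {0..1} t *\<^sub>R (t powr \<alpha> * (1 - t) powr \<alpha>))"
      by (auto simp: indicator_def powr_mult)
  qed
  also have "(\<integral>t. 4 powr \<alpha> * (indicator {0..1} t *\<^sub>R (t powr \<alpha> * (1 - t) powr \<alpha>)) \<partial>lborel) =
      4 powr \<alpha> * (LBINT t:{0..1}. t powr \<alpha> * (1 - t) powr \<alpha>)"
    unfolding set_lebesgue_integral_def by simp
  also have "(LBINT t:{0..1}. t powr \<alpha> * (1 - t) powr \<alpha>) = integral {0..1} (\<lambda>t. t powr \<alpha> * (1 - t) powr \<alpha>)"
    by (intro set_borel_integral_eq_integral set_integrable_lborel_bounded[where B = 1])
       (use assms in \<open>auto simp: abs_mult intro!: mult_le_one powr_le1\<close>)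
  also have "\<dots> = Beta (\<alpha> + 1) (\<alpha> + 1)"
    using has_integral_Beta_real[of "\<alpha> + 1" "\<alpha> + 1"] assms by (auto intro: integral_unique)
  finally have 1: "Psi0 \<alpha> 1 = 2 * (4 powr \<alpha> * Beta (\<alpha> + 1) (\<alpha> + 1))" .
  have "Gamma (complex_of_real (\<alpha> + 1)) * Gamma (complex_of_real (\<alpha> + 1) + 1/2) =
      exp ((1 - 2 * complex_of_real (\<alpha> + 1)) * of_real (ln 2)) * of_real (sqrt pi) * Gamma (2 * complex_of_real (\<alpha> + 1))"
  proof (rule Gamma_legendre_duplication)
    show "complex_of_real (\<alpha> + 1) \<notin> \<int>\<^sub>\<le>\<^sub>0" "complex_of_real (\<alpha> + 1) + 1/2 \<notin> \<int>\<^sub>\<le>\<^sub>0"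
      using assms by (auto simp: complex_eq_iff elim!: nonpos_Ints_cases)
  qed
  also have "complex_of_real (\<alpha> + 1) + 1/2 = complex_of_real (\<alpha> + 3/2)" by simp
  also have "exp ((1 - 2 * complex_of_real (\<alpha> + 1)) * of_real (ln 2)) = complex_of_real (exp ((1 - 2 * (\<alpha> + 1)) * ln 2))"
    by (simp add: exp_of_real[symmetric])
  also have "2 * complex_of_real (\<alpha> + 1) = complex_of_real (2 * \<alpha> + 2)" by simp
  finally have "complex_of_real (Gamma (\<alpha> + 1) * Gamma (\<alpha> + 3/2)) = complex_of_real (exp ((1 - 2 * (\<alpha> + 1)) * ln 2) * sqrt pi * Gamma (2 * \<alpha> + 2))"
    by (simp only: Gamma_complex_of_real of_real_mult)
  then have dup: "Gamma (\<alpha> + 1) * Gamma (\<alpha> + 3/2) = exp ((1 - 2 * (\<alpha> + 1)) * ln 2) * sqrt pi * Gamma (2 * \<alpha> + 2)"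
    by (simp only: of_real_eq_iff)
  have e: "exp ((1 - 2 * (\<alpha> + 1)) * ln 2) = 1 / (2 * 4 powr \<alpha>)"
  proof -
    have "(4::real) powr \<alpha> = exp (2 * \<alpha> * ln 2)"
      using ln_realpow[of 2 2] by (simp add: powr_def algebra_simps)
    then show ?thesis by (simp add: algebra_simps exp_diff exp_minus exp_add)
  qed
  have pos: "Gamma (\<alpha> + 1) > 0" "Gamma (\<alpha> + 3/2) > 0" "Gamma (2 * \<alpha> + 2) > 0" using assms by (auto intro!: Gamma_real_pos)
  have "2 * 4 powr \<alpha> * Gamma (\<alpha> + 1) * Gamma (\<alpha> + 3/2) = sqrt pi * Gamma (2 * \<alpha> + 2)"
    using dup unfolding e by (simp add: field_simps)
  then have "2 * 4 powr \<alpha> * Gamma (\<alpha> + 1) / Gamma (2 * \<alpha> + 2) = sqrt pi / Gamma (\<alpha> + 3/2)"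
    using pos by (simp add: field_simps)
  then show ?thesis unfolding 1 c_alpha_def Beta_def using pos
    by (simp add: field_simps)
qed

lemma psi_eq: "-1 \<le> z \<Longrightarrow> z \<le> 1 \<Longrightarrow> psi \<alpha> z = Psi0 \<alpha> z / c_alpha \<alpha>"
  unfolding psi_def Psi0_def by (simp add: interval_integral_Icc del: minus_ereal_def uminus_ereal.simps)

lemma c_alpha_pos: "\<alpha> > 0 \<Longrightarrow> c_alpha \<alpha> > 0"
  unfolding c_alpha_def by (auto intro!: divide_pos_pos mult_pos_pos Gamma_real_pos)

text \<open>This derivative is the weight \<open>(1 - z^2) powr \<alpha>\<close> with which a
  displacement of the endpoint enters \<open>Qn\<close>.\<close>

lemma Psi0_has_derivative:
  assumes "\<alpha> > 0" "-1 < z" "z < 1"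
  shows "(Psi0 \<alpha> has_real_derivative (1 - z\<^sup>2) powr \<alpha>) (at z)"
proof -
  have "continuous_on {-1..1} (\<lambda>s::real. (1 - s\<^sup>2) powr \<alpha>)"
    using assms sq_le_1 by (intro continuous_on_powr' continuous_intros) auto
  then have "((\<lambda>u. LBINT s=ereal (-1)..ereal u. (1 - s\<^sup>2) powr \<alpha>) has_vector_derivative (1 - z\<^sup>2) powr \<alpha>) (at z within {-1..1})"
    using assms interval_integral_FTC2[of "-1" "-1" 1 "\<lambda>s. (1 - s\<^sup>2) powr \<alpha>" z] by simp
  then have "((\<lambda>u. LBINT s=ereal (-1)..ereal u. (1 - s\<^sup>2) powr \<alpha>) has_real_derivative (1 - z\<^sup>2) powr \<alpha>) (at z)"
    unfolding has_real_derivative_iff_has_vector_derivative using assms by (subst (asm) at_within_Icc_at) auto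
  moreover have "\<forall>\<^sub>F u in nhds z. (LBINT s=ereal (-1)..ereal u. (1 - s\<^sup>2) powr \<alpha>) = Psi0 \<alpha> u"
  proof -
    have "\<forall>\<^sub>F u in nhds z. u \<in> {-1<..<1}" using assms by (intro eventually_nhds_in_open) auto
    then show ?thesis by eventually_elim (simp add: Psi0_def interval_integral_Icc)
  qed
  ultimately show ?thesis by (subst (asm) DERIV_cong_ev[OF refl _ refl])
qed

text \<open>For \<open>\<alpha> < 1\<close> the integrand can blow up at both ends. One factor
  \<open>s\<close> of the square completes the derivative of \<open>(1 - s^2) powr \<alpha>\<close>,
  which has constant sign on each side of \<open>0\<close>; integrability there follows from its
  bounded primitive, and the remaining factors are bounded.\<close>

lemma set_integrable_J1:
  fixes \<alpha> :: real
  assumes "\<alpha> > 0"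
  shows "set_integrable lborel {-1<..<1} (\<lambda>s. (1 - s\<^sup>2) powr (\<alpha> - 1) * s\<^sup>2 * (\<alpha> + 1 - 3/2 * \<alpha> * s\<^sup>2 - s\<^sup>2))"
proof -
  have pos: "1 - s\<^sup>2 > 0" if "-1 < s" "s < 1" for s :: real
    using that abs_square_less_1[of s] by auto
  have der: "((\<lambda>s. (1 - s\<^sup>2) powr \<alpha> / (2 * \<alpha>)) has_real_derivative - s * (1 - s\<^sup>2) powr (\<alpha> - 1)) (at s)" if "-1 < s" "s < 1" for s
    using pos[OF that] assms by (auto intro!: derivative_eq_intros simp: powr_diff field_simps)
  have lim: "((\<lambda>s. (1 - s\<^sup>2) powr \<alpha> / (2 * \<alpha>)) \<longlongrightarrow> (1 - b\<^sup>2) powr \<alpha> / (2 * \<alpha>)) (at b within {-1..1})" if "b \<in> {-1..1}" for b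
  proof -
    have "continuous_on {-1..1} (\<lambda>s::real. (1 - s\<^sup>2) powr \<alpha> / (2 * \<alpha>))"
      using assms sq_le_1 by (intro continuous_on_powr' continuous_intros) auto
    then show ?thesis using that by (auto simp: continuous_on_def)
  qed
  have cont: "isCont (\<lambda>s. s * (1 - s\<^sup>2) powr (\<alpha> - 1)) s" if "-1 < s" "s < 1" for s
    using pos[OF that] by (intro continuous_intros) auto
  have L: "set_integrable lborel {-1<..<0} (\<lambda>s. - s * (1 - s\<^sup>2) powr (\<alpha> - 1))"
  proof -
    have "set_integrable lborel (einterval (ereal (-1)) (ereal 0)) (\<lambda>s. - s * (1 - s\<^sup>2) powr (\<alpha> - 1))"
    proof (rule interval_integral_FTC_nonneg[where F = "\<lambda>s. (1 - s\<^sup>2) powr \<alpha> / (2 * \<alpha>)"])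
      show "(((\<lambda>s. (1 - s\<^sup>2) powr \<alpha> / (2 * \<alpha>)) \<circ> real_of_ereal) \<longlongrightarrow> (1 - (-1)\<^sup>2) powr \<alpha> / (2 * \<alpha>)) (at_right (ereal (-1)))"
        unfolding ereal_tendsto_simps
        using lim[of "-1"] at_within_Icc_at_right[of "-1" "1::real"] by simp
      show "(((\<lambda>s. (1 - s\<^sup>2) powr \<alpha> / (2 * \<alpha>)) \<circ> real_of_ereal) \<longlongrightarrow> (1 - 0\<^sup>2) powr \<alpha> / (2 * \<alpha>)) (at_left (ereal 0))"
        unfolding ereal_tendsto_simps using der[of 0, THEN DERIV_isCont] by (auto simp: isCont_def intro: tendsto_within_subset)
      show "isCont (\<lambda>s. - s * (1 - s\<^sup>2) powr (\<alpha> - 1)) s" if "ereal (-1) < ereal s" "ereal s < ereal 0" for s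
        using that cont[of s] by (auto intro: continuous_minus)
    qed (use der in \<open>auto simp: mult_nonpos_nonneg\<close>)
    then show ?thesis by (simp add: einterval_eq)
  qed
  have U: "set_integrable lborel {0<..<1} (\<lambda>s. s * (1 - s\<^sup>2) powr (\<alpha> - 1))"
  proof -
    have "set_integrable lborel (einterval (ereal 0) (ereal 1)) (\<lambda>s. s * (1 - s\<^sup>2) powr (\<alpha> - 1))"
    proof (rule interval_integral_FTC_nonneg[where F = "\<lambda>s. - ((1 - s\<^sup>2) powr \<alpha> / (2 * \<alpha>))"])
      show "(((\<lambda>s. - ((1 - s\<^sup>2) powr \<alpha> / (2 * \<alpha>))) \<circ> real_of_ereal) \<longlongrightarrow> - ((1 - 1\<^sup>2) powr \<alpha> / (2 * \<alpha>))) (at_left (ereal 1))"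
        unfolding ereal_tendsto_simps
        using tendsto_minus[OF lim[of "1"]] at_within_Icc_at_left[of "-1" "1::real"] by simp
      show "(((\<lambda>s. - ((1 - s\<^sup>2) powr \<alpha> / (2 * \<alpha>))) \<circ> real_of_ereal) \<longlongrightarrow> - ((1 - 0\<^sup>2) powr \<alpha> / (2 * \<alpha>))) (at_right (ereal 0))"
        unfolding ereal_tendsto_simps using der[of 0, THEN DERIV_isCont] by (auto simp: isCont_def intro!: tendsto_minus intro: tendsto_within_subset)
      show "isCont (\<lambda>s. s * (1 - s\<^sup>2) powr (\<alpha> - 1)) s" if "ereal 0 < ereal s" "ereal s < ereal 1" for s
        using that cont[of s] by auto
      show "((\<lambda>s. - ((1 - s\<^sup>2) powr \<alpha> / (2 * \<alpha>))) has_real_derivative s * (1 - s\<^sup>2) powr (\<alpha> - 1)) (at s)"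
        if "ereal 0 < ereal s" "ereal s < ereal 1" for s
        using DERIV_minus[OF der[of s]] that by simp
    qed auto
    then show ?thesis by (simp add: einterval_eq)
  qed
  define g where "g s = (1 - s\<^sup>2) powr (\<alpha> - 1) * s\<^sup>2 * (\<alpha> + 1 - 3/2 * \<alpha> * s\<^sup>2 - s\<^sup>2)" for s
  define C where "C = \<alpha> + 1 + 3/2 * \<alpha> + 1"
  have g_bd: "\<bar>g s\<bar> \<le> \<bar>C * (s * (1 - s\<^sup>2) powr (\<alpha> - 1))\<bar>" if "-1 < s" "s < 1" for s
  proof -
    have s2: "s\<^sup>2 \<le> 1" "0 \<le> s\<^sup>2" "\<bar>s\<bar> \<le> 1" using that sq_le_1[of s] by auto
    have "\<alpha> * s\<^sup>2 \<le> \<alpha> * 1" "0 \<le> \<alpha> * s\<^sup>2" using s2 assms by (auto intro: mult_left_mono)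
    then have "\<bar>\<alpha> + 1 - 3/2 * \<alpha> * s\<^sup>2 - s\<^sup>2\<bar> \<le> C"
      using s2 assms unfolding C_def mult.assoc[of _ \<alpha> "s\<^sup>2"] by linarith
    moreover have "s\<^sup>2 = \<bar>s\<bar> * \<bar>s\<bar>" by (simp add: power2_eq_square flip: abs_mult)
    moreover have "\<bar>s\<bar> * \<bar>s\<bar> \<le> \<bar>s\<bar> * 1" using s2 by (intro mult_left_mono) auto
    ultimately have "s\<^sup>2 * \<bar>\<alpha> + 1 - 3/2 * \<alpha> * s\<^sup>2 - s\<^sup>2\<bar> \<le> \<bar>s\<bar> * C" by (intro mult_mono) auto
    then have "(1 - s\<^sup>2) powr (\<alpha> - 1) * (s\<^sup>2 * \<bar>\<alpha> + 1 - 3/2 * \<alpha> * s\<^sup>2 - s\<^sup>2\<bar>) \<le> (1 - s\<^sup>2) powr (\<alpha> - 1) * (\<bar>s\<bar> * C)"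
      by (intro mult_left_mono) auto
    moreover have "C \<ge> 0" using assms by (simp add: C_def)
    ultimately show ?thesis by (simp add: g_def abs_mult mult.assoc mult.commute mult.left_commute)
  qed
  have [measurable]: "g \<in> borel_measurable borel" unfolding g_def by measurable
  have "set_integrable lborel {-1<..<0} g"
    by (rule set_integrable_bound[OF set_integrable_mult_right[OF L, of C]])
       (use g_bd in \<open>auto simp: set_borel_measurable_def\<close>)
  moreover have "set_integrable lborel {0<..<1} g"
    by (rule set_integrable_bound[OF set_integrable_mult_right[OF U, of C]])
       (use g_bd in \<open>auto simp: set_borel_measurable_def\<close>)
  moreover have "set_integrable lborel {0::real..0} g"
    by (rule set_integrable_lborel_bounded[where B = "\<bar>g 0\<bar>"]) auto
  ultimately have "set_integrable lborel ({-1<..<0} \<union> {0<..<1} \<union> {0..0}) g"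
    by (intro set_integrable_Un) auto
  moreover have "{-1<..<0} \<union> {0<..<1} \<union> {0..0} = {-1<..<1::real}" by auto
  ultimately show ?thesis by (simp only: g_def[abs_def])
qed

text \<open>Integration by parts removes the endpoint singularity of the integrand of \<open>J1\<close>.\<close>

lemma J1_eq:
  assumes \<alpha>: "\<alpha> > 0" and z: "-1 < z" "z \<le> 1"
  shows "J1 \<alpha> z = Psi0 \<alpha> z / 2 - 5/4 * Psi2 \<alpha> z - (1 - z\<^sup>2) powr \<alpha> * z * (1/2 - 3/4 * z\<^sup>2)"
proof -
  define g where "g s = (1 - s\<^sup>2) powr (\<alpha> - 1) * s\<^sup>2 * (\<alpha> + 1 - 3/2 * \<alpha> * s\<^sup>2 - s\<^sup>2)" for s
  \<comment> \<open>The factor \<open>1/2 - 5/4 * s^2\<close> is the coefficient of \<open>w\<close>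
    in \<open>kap w * jac w s / sqrt (2 * w)\<close>, so this is the integrand the tail expansion
    really yields.\<close>
  define h where "h s = (1 - s\<^sup>2) powr \<alpha> * (1/2 - 5/4 * s\<^sup>2)" for s :: real
  \<comment> \<open>The primitive of the difference of the two integrands. It vanishes at both ends
    of the interval because \<open>\<alpha> > 0\<close>.\<close>
  define P where "P s = - ((1 - s\<^sup>2) powr \<alpha> * s * (1/2 - 3/4 * s\<^sup>2))" for s :: real
  have pos: "1 - s\<^sup>2 > 0" if "-1 < s" "s < 1" for s :: real
    using that abs_square_less_1[of s] by auto
  have gi: "set_integrable lborel {-1<..<z} g"
    using z by (intro set_integrable_subset[OF set_integrable_J1[OF \<alpha>, folded g_def]]) auto
  have hi': "set_integrable lborel {-1..z} (\<lambda>s. 1/2 * (1 - s\<^sup>2) powr \<alpha> - 5/4 * ((1 - s\<^sup>2) powr \<alpha> * s\<^sup>2))"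
    using set_integrable_powr_one_minus_sq[of \<alpha> z] \<alpha> z by (intro set_integral_diff set_integrable_mult_right) auto
  have h_alt: "h = (\<lambda>s. 1/2 * (1 - s\<^sup>2) powr \<alpha> - 5/4 * ((1 - s\<^sup>2) powr \<alpha> * s\<^sup>2))"
    by (auto simp: h_def algebra_simps)
  have hi: "set_integrable lborel {-1<..<z} h"
    by (rule set_integrable_subset[OF hi'[folded h_alt]]) auto
  have "(LBINT s=ereal (-1)..ereal z. g s - h s) = P z - P (-1)"
  proof (rule interval_integral_FTC_integrable)
    fix s assume "ereal (-1) < ereal s" "ereal s < ereal z"
    then have s: "-1 < s" "s < 1" using z by auto
    have p: "(1 - s\<^sup>2) powr \<alpha> = (1 - s\<^sup>2) powr (\<alpha> - 1) * (1 - s\<^sup>2)" using pos[OF s] by (simp add: powr_diff)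
    have d: "((\<lambda>s. (1 - s\<^sup>2) powr \<alpha>) has_real_derivative \<alpha> * (1 - s\<^sup>2) powr (\<alpha> - 1) * (- 2 * s)) (at s)"
      using pos[OF s] \<alpha> by (auto intro!: derivative_eq_intros simp: powr_diff field_simps)
    have "(P has_real_derivative g s - h s) (at s)"
    proof -
      have "(P has_real_derivative - ((1 - s\<^sup>2) powr \<alpha> * s * (- 3/2 * s) +
          (\<alpha> * (1 - s\<^sup>2) powr (\<alpha> - 1) * (- 2 * s) * s + (1 - s\<^sup>2) powr \<alpha>) * (1/2 - 3/4 * s\<^sup>2))) (at s)"
        unfolding P_def
        by (intro DERIV_minus DERIV_mult' d derivative_eq_intros(1)) (use pos[OF s] in \<open>auto intro!: derivative_eq_intros d\<close>)
      then show ?thesis by (rule DERIV_cong) (simp only: g_def h_def p, simp add: algebra_simps power2_eq_square)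
    qed
    then show "(P has_vector_derivative g s - h s) (at s)" by (simp add: has_real_derivative_iff_has_vector_derivative)
    show "isCont (\<lambda>s. g s - h s) s" unfolding g_def h_def using pos[OF s] by (intro continuous_intros) auto
  next
    have cont: "continuous_on {-1..z} P" unfolding P_def
      using \<alpha> sq_le_1 z by (intro continuous_on_powr' continuous_intros) auto
    show "((P \<circ> real_of_ereal) \<longlongrightarrow> P (-1)) (at_right (ereal (-1)))"
      unfolding ereal_tendsto_simps using cont z at_within_Icc_at_right[of "-1" z] by (auto simp: continuous_on_def dest!: bspec[where x = "-1"])
    show "((P \<circ> real_of_ereal) \<longlongrightarrow> P z) (at_left (ereal z))"
      unfolding ereal_tendsto_simps using cont z at_within_Icc_at_left[of "-1" z] by (auto simp: continuous_on_def dest!: bspec[where x = z])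
    show "set_integrable lborel (einterval (ereal (-1)) (ereal z)) (\<lambda>s. g s - h s)"
      using set_integral_diff(1)[OF gi hi] by (simp add: einterval_eq)
  qed (use z in auto)
  moreover have "P (-1) = 0" by (simp add: P_def)
  moreover have "(LBINT s=ereal (-1)..ereal z. g s - h s) = (LBINT s=ereal (-1)..ereal z. g s) - (LBINT s=ereal (-1)..ereal z. h s)"
    using gi hi z by (intro interval_lebesgue_integral_diff) (auto simp: interval_lebesgue_integrable_def einterval_eq)
  moreover have "(LBINT s=ereal (-1)..ereal z. h s) = Psi0 \<alpha> z / 2 - 5/4 * Psi2 \<alpha> z"
  proof -
    have "(LBINT s=ereal (-1)..ereal z. h s) = (LBINT s:{-1..z}. 1/2 * (1 - s\<^sup>2) powr \<alpha> - 5/4 * ((1 - s\<^sup>2) powr \<alpha> * s\<^sup>2))"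
      unfolding h_alt using z by (intro interval_integral_Icc) auto
    also have "\<dots> = (LBINT s:{-1..z}. 1/2 * (1 - s\<^sup>2) powr \<alpha>) - (LBINT s:{-1..z}. 5/4 * ((1 - s\<^sup>2) powr \<alpha> * s\<^sup>2))"
      using set_integrable_powr_one_minus_sq[of \<alpha> z] \<alpha> z by (intro set_integral_diff set_integrable_mult_right) auto
    finally show ?thesis by (simp add: Psi0_def Psi2_def)
  qed
  ultimately show ?thesis unfolding J1_def g_def[symmetric] by (simp add: P_def)
qed

section \<open>Expansion of the tail integral\<close>

lemma kap_sq: "0 < w \<Longrightarrow> w < 1 \<Longrightarrow> (kap w)\<^sup>2 = 2 * w / (1 - w)"
  by (simp add: kap_def)

text \<open>A crude uniform bound of the right order in \<open>w\<close>, for domination only; when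
  the right-hand side is at least \<open>1\<close> it follows from
  \<open>0 < jac \<le> 1\<close>.\<close>

lemma jac_diff_le: "\<bar>jac w s - 1\<bar> \<le> (kap w)\<^sup>2 * s\<^sup>2"
proof -
  define q where "q = (kap w)\<^sup>2 * s\<^sup>2"
  define d where "d = (1 + q / 2) * sqrt (1 + q / 4)"
  have q: "q \<ge> 0" by (simp add: q_def)
  have j: "jac w s = 1 / d" by (simp add: jac_def d_def q_def)
  have jb: "0 < jac w s" "jac w s \<le> 1" using jac_pos jac_le_1 by auto
  show ?thesis
  proof (cases "q \<ge> 1")
    case True
    then show ?thesis using jb by (simp add: q_def[symmetric])
  next
    case False
    have d1: "d \<ge> 1" using jb j by (simp add: divide_le_eq split: if_splits)
    have "sqrt (1 + q / 4) \<le> 1 + q / 4" using q by (intro real_le_lsqrt) (auto simp: power2_eq_square algebra_simps)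
    then have "d \<le> (1 + q / 2) * (1 + q / 4)" unfolding d_def using q by (intro mult_left_mono) auto
    also have "\<dots> \<le> 1 + q" using False q mult_left_mono[of q 1 q] by (simp add: algebra_simps)
    finally have "d - 1 \<le> q" by simp
    moreover have "1 - 1 / d \<le> d - 1"
    proof -
      have "0 \<le> (d - 1) * (d - 1)" by simp
      then show ?thesis using d1 by (simp add: field_simps)
    qed
    ultimately show ?thesis using jb by (simp add: j q_def[symmetric])
  qed
qed

text \<open>As a function of \<open>q = kap^2 * s^2\<close> the Jacobian has slope
  \<open>- 5/8\<close> at \<open>0\<close>, coming from \<open>1/2\<close> in the rational factor
  and \<open>1/8\<close> in the root. Since \<open>q / w\<close> tends to \<open>2 * s^2\<close>,
  the constant doubles to \<open>5/4\<close>.\<close>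

lemma jac_first_order:
  assumes w: "w \<longlonglongrightarrow> 0" and pos: "\<forall>\<^sub>F n in sequentially. 0 < w n"
  shows "(\<lambda>n. (jac (w n) s - 1) / w n) \<longlonglongrightarrow> - (5/4) * s\<^sup>2"
proof (cases "s = 0")
  case True
  then show ?thesis by (simp add: jac_def)
next
  case False
  define j where "j q = 1 / ((1 + q / 2) * sqrt (1 + q / 4))" for q :: real
  have "(j has_real_derivative - 5/8) (at 0)"
    unfolding j_def by (auto intro!: derivative_eq_intros)
  then have lim: "((\<lambda>q. (j q - 1) / q) \<longlongrightarrow> - 5/8) (at 0)"
    by (simp add: has_field_derivative_iff j_def)
  have w1: "\<forall>\<^sub>F n in sequentially. w n < 1" by (rule order_tendstoD(2)[OF w]) simp
  define q where "q n = 2 * w n / (1 - w n) * s\<^sup>2" for n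
  have "(\<lambda>n. 2 * w n / (1 - w n) * s\<^sup>2) \<longlonglongrightarrow> 2 * 0 / (1 - 0) * s\<^sup>2"
    by (intro tendsto_intros w) auto
  then have q0: "q \<longlonglongrightarrow> 0" by (simp add: q_def[abs_def])
  have qne: "\<forall>\<^sub>F n in sequentially. q n \<noteq> 0"
    using pos w1 by eventually_elim (use False in \<open>auto simp: q_def\<close>)
  have "filterlim q (at 0) sequentially" using q0 qne by (simp add: filterlim_at)
  then have 1: "(\<lambda>n. (j (q n) - 1) / q n) \<longlonglongrightarrow> - 5/8" by (rule filterlim_compose[OF lim])
  have "(\<lambda>n. (j (q n) - 1) / q n * (2 / (1 - w n) * s\<^sup>2)) \<longlonglongrightarrow> - 5/8 * (2 / (1 - 0) * s\<^sup>2)"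
    by (intro tendsto_intros 1 w) auto
  then have "(\<lambda>n. (j (q n) - 1) / q n * (2 / (1 - w n) * s\<^sup>2)) \<longlonglongrightarrow> - (5/4) * s\<^sup>2" by simp
  moreover have "\<forall>\<^sub>F n in sequentially. (j (q n) - 1) / q n * (2 / (1 - w n) * s\<^sup>2) = (jac (w n) s - 1) / w n"
    using pos w1 qne
  proof eventually_elim
    case (elim n)
    have "jac (w n) s = j (q n)" using elim by (simp add: jac_def j_def q_def kap_sq)
    moreover have "2 / (1 - w n) * s\<^sup>2 / q n = 1 / w n" using elim False by (simp add: q_def)
    ultimately show ?case by (metis times_divide_eq_right times_divide_eq_left mult.right_neutral)
  qed
  ultimately show ?thesis by (rule Lim_transform_eventually)
qed

text \<open>The indicator of the moving interval converges except at \<open>z0\<close>. Bounds and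
  limits are required only inside the open interval because \<open>1 / (1 - s^2)\<close> has no
  meaning at \<open>-1\<close> and \<open>1\<close>.\<close>

lemma dominated_convergence_moving_endpoint:
  fixes g :: "nat \<Rightarrow> real \<Rightarrow> real"
  assumes z: "z \<longlonglongrightarrow> z0" "\<forall>\<^sub>F n in sequentially. z n \<le> 1"
    and meas[measurable]: "\<And>n. g n \<in> borel_measurable borel" "g0 \<in> borel_measurable borel"
    and bd: "\<forall>\<^sub>F n in sequentially. \<forall>s\<in>{-1<..<1}. \<bar>g n s\<bar> \<le> K"
    and lim: "\<And>s. -1 < s \<Longrightarrow> s < 1 \<Longrightarrow> (\<lambda>n. g n s) \<longlonglongrightarrow> g0 s"
  shows "(\<lambda>n. LBINT s:{-1..z n}. g n s) \<longlonglongrightarrow> (LBINT s:{-1..z0}. g0 s)"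
proof -
  obtain N where N: "\<And>n. n \<ge> N \<Longrightarrow> z n \<le> 1" "\<And>n s. n \<ge> N \<Longrightarrow> -1 < s \<Longrightarrow> s < 1 \<Longrightarrow> \<bar>g n s\<bar> \<le> K"
    using eventually_conj[OF z(2) bd] unfolding eventually_sequentially by (metis greaterThanLessThan_iff)
  have z0: "z0 \<le> 1" by (rule tendsto_upperbound[OF z]) simp
  \<comment> \<open>The index is shifted by \<open>N\<close> because the dominated convergence rule
    asks for the bounds at every index, not just eventually.\<close>
  have "(\<lambda>n. \<integral>s. indicator {-1..z (n + N)} s *\<^sub>R g (n + N) s \<partial>lborel) \<longlonglongrightarrow> (\<integral>s. indicator {-1..z0} s *\<^sub>R g0 s \<partial>lborel)"
  proof (rule integral_dominated_convergence[where w = "\<lambda>s. indicator {-1..1} s *\<^sub>R K"])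
    show "integrable lborel (\<lambda>s::real. indicat_real {-1..1} s *\<^sub>R K)"
      by (rule integrableI_bounded_set_indicator[where B = "\<bar>K\<bar>"]) auto
    show "AE s in lborel. norm (indicator {-1..z (n + N)} s *\<^sub>R g (n + N) s) \<le> indicator {-1..1} s *\<^sub>R K" for n
    proof (intro AE_mp[OF AE_lborel_singleton[of 1] AE_mp[OF AE_lborel_singleton[of "-1"] AE_I2]] impI)
      fix s :: real assume "s \<noteq> 1" "s \<noteq> -1"
      then show "norm (indicator {-1..z (n + N)} s *\<^sub>R g (n + N) s) \<le> indicator {-1..1} s *\<^sub>R K"
        \<comment> \<open>The instance at \<open>0\<close> yields \<open>0 \<le> K\<close>, needed
          where the indicator on the left vanishes but that on the right does not.\<close>
        using N(1)[of "n + N"] N(2)[of "n + N" s] N(2)[of "n + N" 0] by (auto simp: indicator_def)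
    qed
    show "AE s in lborel. (\<lambda>n. indicator {-1..z (n + N)} s *\<^sub>R g (n + N) s) \<longlonglongrightarrow> indicator {-1..z0} s *\<^sub>R g0 s"
    proof (intro AE_mp[OF AE_lborel_singleton[of 1] AE_mp[OF AE_lborel_singleton[of "-1"] AE_mp[OF AE_lborel_singleton[of z0] AE_I2]]] impI)
      fix s :: real assume ne: "s \<noteq> 1" "s \<noteq> -1" "s \<noteq> z0"
      consider "s < -1 \<or> s > 1" | "-1 < s" "s < 1" "s < z0" | "-1 < s" "s < 1" "s > z0" using ne by linarith
      then show "(\<lambda>n. indicator {-1..z (n + N)} s *\<^sub>R g (n + N) s) \<longlonglongrightarrow> indicator {-1..z0} s *\<^sub>R g0 s"
      proof cases
        case 1
        then have "indicat_real {-1..z (n + N)} s = 0" "indicat_real {-1..z0} s = 0" for n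
          using N(1)[of "n + N"] z0 by (auto simp: indicator_def)
        then show ?thesis by simp
      next
        case 2
        have "\<forall>\<^sub>F n in sequentially. s < z (n + N)"
          by (rule order_tendstoD(1)[OF LIMSEQ_ignore_initial_segment[OF z(1)] 2(3)])
        then have "\<forall>\<^sub>F n in sequentially. g (n + N) s = indicator {-1..z (n + N)} s *\<^sub>R g (n + N) s"
          by eventually_elim (use 2 in auto)
        moreover have "(\<lambda>n. g (n + N) s) \<longlonglongrightarrow> g0 s" by (rule LIMSEQ_ignore_initial_segment[OF lim[OF 2(1,2)]])
        ultimately show ?thesis using 2 by (auto intro: Lim_transform_eventually)
      next
        case 3
        have "\<forall>\<^sub>F n in sequentially. z (n + N) < s"
          by (rule order_tendstoD(2)[OF LIMSEQ_ignore_initial_segment[OF z(1)] 3(3)])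
        then have "\<forall>\<^sub>F n in sequentially. 0 = indicator {-1..z (n + N)} s *\<^sub>R g (n + N) s"
          by eventually_elim auto
        then show ?thesis using 3 by (auto intro: Lim_transform_eventually[OF tendsto_const])
      qed
    qed
  qed measurable
  then show ?thesis unfolding set_lebesgue_integral_def by (rule LIMSEQ_offset)
qed

text \<open>With \<open>\<rho>\<close> the tail ratio and \<open>h\<close> its limit, the integrand
  is \<open>h + (\<rho> - h) + \<rho> * (jac - 1)\<close>. The second part is of order
  \<open>A\<close>, the third of order \<open>a\<close>; \<open>X\<close> and \<open>Y\<close> are
  their integrals after normalisation. The leading term keeps the moving endpoint
  \<open>z n\<close>, whose own expansion is a separate matter.\<close>

lemma tail_integral_expansion:
  assumes F: "mono F" "\<And>t. 0 \<le> F t" "\<And>t. F t \<le> 1" "F 1 = 1" "\<And>t. t < 1 \<Longrightarrow> F t < 1"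
    and RV: "second_order_RV (\<lambda>t. 1 - F (1 - 1 / t)) \<alpha> \<tau> A" and \<alpha>: "\<alpha> > 0" and \<tau>: "\<tau> \<le> 0"
    and a: "a \<longlonglongrightarrow> 0" "\<forall>\<^sub>F n in sequentially. 0 < a n" and \<xi>: "\<xi> > 0"
    and z: "z \<longlonglongrightarrow> z0" "\<forall>\<^sub>F n in sequentially. z n \<le> 1" and z0: "-1 \<le> z0"
  shows "\<exists>X Y. X \<longlonglongrightarrow> \<xi> powr \<alpha> * (qt \<tau> \<xi> * Psi0 \<alpha> z0 + \<xi> powr (- \<tau>) * J2 \<alpha> \<tau> z0) \<and>
    Y \<longlonglongrightarrow> - (5/4) * \<xi> * \<xi> powr \<alpha> * Psi2 \<alpha> z0 \<and>
    (\<forall>\<^sub>F n in sequentially.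
      (LBINT s:{-1..z n}. (1 - F (1 - a n * \<xi> * (1 - s\<^sup>2))) * jac (a n * \<xi>) s) / (1 - F (1 - a n)) =
      \<xi> powr \<alpha> * Psi0 \<alpha> (z n) + A (1 / a n) * X n + a n * Y n)"
proof -
  define f where "f t = 1 - F (1 - 1 / t)" for t
  have [measurable]: "F \<in> borel_measurable borel" by (rule borel_measurable_mono[OF F(1)])
  have fm: "f \<in> borel_measurable borel" unfolding f_def by measurable
  have fpos: "f t > 0" if "t > 0" for t using F(5)[of "1 - 1 / t"] that by (simp add: f_def)
  have RVf: "second_order_RV f \<alpha> \<tau> A" using RV unfolding f_def .
  have A0: "(A \<longlongrightarrow> 0) at_top" and Anz: "\<forall>\<^sub>F t in at_top. A t \<noteq> 0"
    and L: "\<And>s. s > 0 \<Longrightarrow> ((\<lambda>t. (f (t * s) / f t - s powr (- \<alpha>)) / A t) \<longlongrightarrow> s powr (- \<alpha>) * bc \<tau> s) at_top"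
    using RVf by (auto simp: second_order_RV_def elim: eventually_mono)
  define t where "t n = 1 / a n" for n
  have t: "filterlim t at_top sequentially"
    unfolding t_def[abs_def] using filterlim_inverse_at_top[OF a] by (simp add: inverse_eq_divide)
  \<comment> \<open>The choice \<open>\<alpha> / 2\<close> makes the exponent negative, so the bound
    is largest at the smallest factor \<open>1 / \<xi>\<close>, which corresponds to
    \<open>s = 0\<close>.\<close>
  obtain C where C: "\<forall>\<^sub>F t in at_top. \<forall>s\<ge>1/\<xi>. \<bar>f (t * s) / f t - s powr (- \<alpha>)\<bar> \<le> C * \<bar>A t\<bar> * s powr (\<alpha>/2 - \<alpha>)"
    using second_order_RV_bound[OF RVf fm fpos \<tau>, of "\<alpha>/2" "1/\<xi>"] \<alpha> \<xi> by auto
  define K where "K = \<bar>C\<bar> * \<xi> powr (\<alpha>/2)"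
  define h where "h s = (\<xi> * (1 - s\<^sup>2)) powr \<alpha>" for s
  define \<rho> where "\<rho> n s = (1 - F (1 - a n * \<xi> * (1 - s\<^sup>2))) / (1 - F (1 - a n))" for n s
  have [measurable]: "h \<in> borel_measurable borel" "\<rho> n \<in> borel_measurable borel" for n
    unfolding h_def \<rho>_def by measurable
  have pos: "1 - s\<^sup>2 > 0" if "-1 < s" "s < 1" for s :: real
    using that abs_square_less_1[of s] by auto
  have \<rho>f: "\<rho> n s = f (t n * (1 / (\<xi> * (1 - s\<^sup>2)))) / f (t n)" if "0 < a n" for n s
    using that by (simp add: \<rho>_def f_def t_def mult.assoc)
  have hS: "h s = (1 / (\<xi> * (1 - s\<^sup>2))) powr (- \<alpha>)" if "-1 < s" "s < 1" for s
    using pos[OF that] \<xi> by (simp add: h_def powr_minus powr_divide)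
  have h_le: "0 \<le> h s" "h s \<le> \<xi> powr \<alpha>" if "-1 \<le> s" "s \<le> 1" for s
  proof -
    have "0 \<le> s\<^sup>2" "s\<^sup>2 \<le> 1" using sq_le_1[OF that] by auto
    then show "0 \<le> h s" "h s \<le> \<xi> powr \<alpha>" unfolding h_def using \<xi> \<alpha>
      by (auto intro!: powr_mono2 mult_left_le)
  qed
  have AT: "(\<lambda>n. A (t n)) \<longlonglongrightarrow> 0" by (rule filterlim_compose[OF A0 t])
  have Anz': "\<forall>\<^sub>F n in sequentially. A (t n) \<noteq> 0" by (rule eventually_compose_filterlim[OF Anz t])
  have E1: "\<forall>\<^sub>F n in sequentially. \<forall>s\<in>{-1<..<1}. \<bar>\<rho> n s - h s\<bar> \<le> K * \<bar>A (t n)\<bar>"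
    using eventually_compose_filterlim[OF C t] a(2)
  proof eventually_elim
    case (elim n)
    show ?case
    proof
      fix s :: real assume "s \<in> {-1<..<1}"
      then have s: "-1 < s" "s < 1" by auto
      define S where "S = 1 / (\<xi> * (1 - s\<^sup>2))"
      have "\<xi> * (1 - s\<^sup>2) \<le> \<xi>" using \<xi> by (simp add: mult_left_le)
      then have S: "S \<ge> 1 / \<xi>" unfolding S_def using \<xi> pos[OF s] by (intro divide_left_mono) auto
      have "\<bar>\<rho> n s - h s\<bar> \<le> C * \<bar>A (t n)\<bar> * S powr (\<alpha>/2 - \<alpha>)"
        unfolding \<rho>f[OF elim(2)] hS[OF s] S_def[symmetric] using elim(1) S by blast
      also have "\<dots> \<le> \<bar>C\<bar> * \<bar>A (t n)\<bar> * (1 / \<xi>) powr (\<alpha>/2 - \<alpha>)"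
        using S \<xi> \<alpha> by (intro mult_mono mult_right_mono powr_mono2') auto
      also have "(1 / \<xi>) powr (\<alpha>/2 - \<alpha>) = \<xi> powr (\<alpha>/2)"
        using \<xi> by (simp add: powr_divide powr_minus[symmetric] flip: powr_minus_divide)
      finally show "\<bar>\<rho> n s - h s\<bar> \<le> K * \<bar>A (t n)\<bar>" by (simp add: K_def mult.commute mult.left_commute)
    qed
  qed
  define gX where "gX n s = (\<rho> n s - h s) / A (t n)" for n s
  define gX0 where "gX0 s = \<xi> powr \<alpha> * (qt \<tau> \<xi> * (1 - s\<^sup>2) powr \<alpha> + \<xi> powr (- \<tau>) * ((1 - s\<^sup>2) powr \<alpha> * qt \<tau> (1 - s\<^sup>2)))" for s
  define gY where "gY n s = \<rho> n s * ((jac (a n * \<xi>) s - 1) / a n)" for n s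
  define gY0 where "gY0 s = - (5/4) * \<xi> * \<xi> powr \<alpha> * ((1 - s\<^sup>2) powr \<alpha> * s\<^sup>2)" for s :: real
  define X where "X n = (LBINT s:{-1..z n}. gX n s)" for n
  define Y where "Y n = (LBINT s:{-1..z n}. gY n s)" for n
  have limX: "(\<lambda>n. gX n s) \<longlonglongrightarrow> gX0 s" if s: "-1 < s" "s < 1" for s
  proof -
    define S where "S = 1 / (\<xi> * (1 - s\<^sup>2))"
    have S: "S > 0" using \<xi> pos[OF s] by (simp add: S_def)
    have "(\<lambda>n. (f (t n * S) / f (t n) - S powr (- \<alpha>)) / A (t n)) \<longlonglongrightarrow> S powr (- \<alpha>) * bc \<tau> S"
      by (rule filterlim_compose[OF L[OF S] t])
    moreover have "S powr (- \<alpha>) * bc \<tau> S = gX0 s"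
    proof -
      have "bc \<tau> S = qt \<tau> (\<xi> * (1 - s\<^sup>2))" unfolding S_def using \<xi> pos[OF s] by (intro qt_eq_bc[symmetric]) auto
      also have "\<dots> = qt \<tau> \<xi> + \<xi> powr (- \<tau>) * qt \<tau> (1 - s\<^sup>2)" using \<xi> pos[OF s] by (intro qt_mult) auto
      finally show ?thesis using \<xi> pos[OF s] unfolding S_def hS[OF s, symmetric] h_def gX0_def
        by (subst powr_mult) (auto simp: algebra_simps)
    qed
    moreover have "\<forall>\<^sub>F n in sequentially. (f (t n * S) / f (t n) - S powr (- \<alpha>)) / A (t n) = gX n s"
      using a(2) by eventually_elim (simp add: gX_def \<rho>f hS[OF s] S_def)
    ultimately show ?thesis by (auto intro: Lim_transform_eventually)
  qed
  have X: "X \<longlonglongrightarrow> (LBINT s:{-1..z0}. gX0 s)"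
    unfolding X_def[abs_def]
  proof (rule dominated_convergence_moving_endpoint[OF z, where K = K])
    show "\<forall>\<^sub>F n in sequentially. \<forall>s\<in>{-1<..<1}. \<bar>gX n s\<bar> \<le> K"
      using E1 Anz' by eventually_elim (auto simp: gX_def abs_divide divide_le_eq)
  qed (use limX in \<open>auto simp: gX_def gX0_def\<close>)
  have w: "(\<lambda>n. a n * \<xi>) \<longlonglongrightarrow> 0" "\<forall>\<^sub>F n in sequentially. 0 < a n * \<xi>"
    using tendsto_mult_right[OF a(1), of \<xi>] a(2) \<xi> by (auto elim: eventually_mono)
  \<comment> \<open>Makes \<open>2 * w / (1 - w) \<le> 4 * w\<close>, the origin of the constant
    \<open>4 * \<xi>\<close> below.\<close>
  have w_half: "\<forall>\<^sub>F n in sequentially. a n * \<xi> < 1/2" by (rule order_tendstoD(2)[OF w(1)]) simp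
  have A1: "\<forall>\<^sub>F n in sequentially. \<bar>A (t n)\<bar> < 1" by (rule order_tendstoD(2)[OF tendsto_rabs_zero[OF AT]]) simp
  have limY: "(\<lambda>n. gY n s) \<longlonglongrightarrow> gY0 s" if s: "-1 < s" "s < 1" for s
  proof -
    have "(\<lambda>n. gX n s * A (t n) + h s) \<longlonglongrightarrow> gX0 s * 0 + h s" by (intro tendsto_intros limX s AT)
    moreover have "\<forall>\<^sub>F n in sequentially. gX n s * A (t n) + h s = \<rho> n s"
      using Anz' by eventually_elim (simp add: gX_def)
    ultimately have \<rho>: "(\<lambda>n. \<rho> n s) \<longlonglongrightarrow> h s" by (auto intro: Lim_transform_eventually)
    have "(\<lambda>n. \<rho> n s * ((jac (a n * \<xi>) s - 1) / (a n * \<xi>) * \<xi>)) \<longlonglongrightarrow> h s * (- (5/4) * s\<^sup>2 * \<xi>)"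
      by (intro tendsto_intros \<rho> jac_first_order w)
    moreover have "h s * (- (5/4) * s\<^sup>2 * \<xi>) = gY0 s"
      using \<xi> pos[OF s] by (simp add: h_def gY0_def powr_mult)
    ultimately show ?thesis using \<xi> by (simp add: gY_def)
  qed
  have Y: "Y \<longlonglongrightarrow> (LBINT s:{-1..z0}. gY0 s)"
    unfolding Y_def[abs_def]
  proof (rule dominated_convergence_moving_endpoint[OF z, where K = "(\<xi> powr \<alpha> + K) * (4 * \<xi>)"])
    show "\<forall>\<^sub>F n in sequentially. \<forall>s\<in>{-1<..<1}. \<bar>gY n s\<bar> \<le> (\<xi> powr \<alpha> + K) * (4 * \<xi>)"
      using E1 A1 a(2) w_half
    proof eventually_elim
      case (elim n)
      show ?case
      proof
        fix s :: real assume s: "s \<in> {-1<..<1}"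
        have K0: "K \<ge> 0" by (simp add: K_def)
        have "K * \<bar>A (t n)\<bar> \<le> K * 1" using elim(2) K0 by (intro mult_left_mono) auto
        moreover have "\<bar>\<rho> n s - h s\<bar> \<le> K * \<bar>A (t n)\<bar>" using elim(1) s by blast
        moreover have "\<bar>h s\<bar> \<le> \<xi> powr \<alpha>" using h_le[of s] s by auto
        ultimately have 1: "\<bar>\<rho> n s\<bar> \<le> \<xi> powr \<alpha> + K" by linarith
        have wn: "0 < a n * \<xi>" "a n * \<xi> < 1" using elim \<xi> by auto
        have "\<bar>jac (a n * \<xi>) s - 1\<bar> \<le> 2 * (a n * \<xi>) / (1 - a n * \<xi>) * s\<^sup>2"
          using jac_diff_le[of "a n * \<xi>" s] unfolding kap_sq[OF wn] .
        also have "\<dots> \<le> 2 * (a n * \<xi>) / (1/2) * 1"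
          using elim wn s sq_le_1[of s] by (intro mult_mono divide_left_mono) auto
        finally have 2: "\<bar>(jac (a n * \<xi>) s - 1) / a n\<bar> \<le> 4 * \<xi>"
          using elim(3) by (simp add: abs_divide divide_le_eq mult.commute mult.left_commute)
        show "\<bar>gY n s\<bar> \<le> (\<xi> powr \<alpha> + K) * (4 * \<xi>)"
          unfolding gY_def abs_mult using 1 2 K0 by (intro mult_mono) auto
      qed
    qed
  qed (use limY in \<open>auto simp: gY_def gY0_def\<close>)
  have z01: "z0 \<le> 1" by (rule tendsto_upperbound[OF z]) simp
  note int0 = set_integrable_powr_one_minus_sq[OF less_imp_le[OF \<alpha>]]
  have "(LBINT s:{-1..z0}. gX0 s) = \<xi> powr \<alpha> * (LBINT s:{-1..z0}. qt \<tau> \<xi> * (1 - s\<^sup>2) powr \<alpha> + \<xi> powr (- \<tau>) * ((1 - s\<^sup>2) powr \<alpha> * qt \<tau> (1 - s\<^sup>2)))"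
    unfolding gX0_def by simp
  also have "(LBINT s:{-1..z0}. qt \<tau> \<xi> * (1 - s\<^sup>2) powr \<alpha> + \<xi> powr (- \<tau>) * ((1 - s\<^sup>2) powr \<alpha> * qt \<tau> (1 - s\<^sup>2))) =
      qt \<tau> \<xi> * Psi0 \<alpha> z0 + \<xi> powr (- \<tau>) * J2 \<alpha> \<tau> z0"
    using int0(1)[OF z01] set_integrable_powr_qt[OF \<alpha> \<tau> z01]
    by (subst set_integral_add) (auto simp: Psi0_def J2_eq[OF z0] intro!: set_integrable_mult_right)
  finally have X': "X \<longlonglongrightarrow> \<xi> powr \<alpha> * (qt \<tau> \<xi> * Psi0 \<alpha> z0 + \<xi> powr (- \<tau>) * J2 \<alpha> \<tau> z0)" using X by simp
  have Y': "Y \<longlonglongrightarrow> - (5/4) * \<xi> * \<xi> powr \<alpha> * Psi2 \<alpha> z0" using Y unfolding gY0_def Psi2_def by (simp only: set_integral_mult_right)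
  have "\<forall>\<^sub>F n in sequentially.
      (LBINT s:{-1..z n}. (1 - F (1 - a n * \<xi> * (1 - s\<^sup>2))) * jac (a n * \<xi>) s) / (1 - F (1 - a n)) =
      \<xi> powr \<alpha> * Psi0 \<alpha> (z n) + A (1 / a n) * X n + a n * Y n"
    using Anz' a(2) z(2)
  proof eventually_elim
    case (elim n)
    define B where "B = 1 / (1 - F (1 - a n))"
    have B: "B \<ge> 0" using F(3)[of "1 - a n"] by (simp add: B_def)
    have \<rho>b: "0 \<le> \<rho> n s" "\<rho> n s \<le> B" for s
      using F(2,3) F(3)[of "1 - a n"] by (auto simp: \<rho>_def B_def intro!: divide_right_mono)
    have i1: "set_integrable lborel {-1..z n} h"
      by (rule set_integrable_lborel_bounded[where B = "\<xi> powr \<alpha>"]) (use h_le elim in auto)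
    have i2: "set_integrable lborel {-1..z n} (\<rho> n)"
      by (rule set_integrable_lborel_bounded[where B = B]) (use \<rho>b in auto)
    have i3: "set_integrable lborel {-1..z n} (\<lambda>s. \<rho> n s * (jac (a n * \<xi>) s - 1))"
    proof (rule set_integrable_lborel_bounded[where B = "B * 1"])
      fix s
      have "\<bar>jac (a n * \<xi>) s - 1\<bar> \<le> 1" using jac_pos[of "a n * \<xi>" s] jac_le_1[of "a n * \<xi>" s] by simp
      then show "\<bar>\<rho> n s * (jac (a n * \<xi>) s - 1)\<bar> \<le> B * 1" unfolding abs_mult using \<rho>b[of s] B by (intro mult_mono) auto
    qed auto
    have "A (t n) * X n = (LBINT s:{-1..z n}. \<rho> n s - h s)"
      unfolding X_def gX_def using elim(1) by simp
    then have eX: "A (t n) * X n = (LBINT s:{-1..z n}. \<rho> n s) - (LBINT s:{-1..z n}. h s)"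
      using set_integral_diff(2)[OF i2 i1] by simp
    have eY: "a n * Y n = (LBINT s:{-1..z n}. \<rho> n s * (jac (a n * \<xi>) s - 1))"
      unfolding Y_def gY_def using elim(2) by simp
    have eh: "(LBINT s:{-1..z n}. h s) = \<xi> powr \<alpha> * Psi0 \<alpha> (z n)"
    proof -
      have "(LBINT s:{-1..z n}. h s) = (LBINT s:{-1..z n}. \<xi> powr \<alpha> * (1 - s\<^sup>2) powr \<alpha>)"
        using elim(3) \<xi> sq_le_1 by (intro set_lebesgue_integral_cong) (auto simp: h_def powr_mult)
      then show ?thesis by (simp add: Psi0_def)
    qed
    have "(LBINT s:{-1..z n}. (1 - F (1 - a n * \<xi> * (1 - s\<^sup>2))) * jac (a n * \<xi>) s) / (1 - F (1 - a n)) =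
      (LBINT s:{-1..z n}. \<rho> n s + \<rho> n s * (jac (a n * \<xi>) s - 1))"
    proof -
      have "(1 - F (1 - a n * \<xi> * (1 - s\<^sup>2))) * jac (a n * \<xi>) s / (1 - F (1 - a n)) = \<rho> n s + \<rho> n s * (jac (a n * \<xi>) s - 1)" for s
        unfolding \<rho>_def by (simp add: right_diff_distrib)
      then show ?thesis unfolding set_integral_divide_zero[symmetric] by simp
    qed
    also have "\<dots> = (LBINT s:{-1..z n}. \<rho> n s) + (LBINT s:{-1..z n}. \<rho> n s * (jac (a n * \<xi>) s - 1))"
      by (rule set_integral_add(2)[OF i2 i3])
    finally show ?case using eX eY eh by (simp add: t_def)
  qed
  with X' Y' show ?thesis by blast
qed

section \<open>First-order expansions along a null sequence\<close>

text \<open>The correction is a whole sequence, not a coefficient, because several unrelated null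
  sequences enter linearly and only their common scale \<open>r\<close> is known. Requiring it to be
  \<open>O(r)\<close> makes products of two corrections negligible once \<open>r\<close> tends to
  \<open>0\<close>.\<close>

definition first_order :: "(nat \<Rightarrow> real) \<Rightarrow> (nat \<Rightarrow> real) \<Rightarrow> real \<Rightarrow> (nat \<Rightarrow> real) \<Rightarrow> bool" where
  "first_order r X X0 L \<longleftrightarrow> (\<lambda>n. X n - X0 - L n) \<in> o(r) \<and> L \<in> O(r)"

lemma first_order_eqI:
  assumes "first_order r X X0 L" "\<And>n. L n = L' n" "X0 = X0'"
  shows "first_order r X X0' L'"
proof -
  have "L = L'" using assms(2) by auto
  then show ?thesis using assms by simp
qed

lemma first_order_cong:
  assumes "first_order r X X0 L" "\<forall>\<^sub>F n in sequentially. X n = Y n"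
  shows "first_order r Y X0 L"
proof -
  have "(\<lambda>n. X n - X0 - L n) \<in> o(r) \<longleftrightarrow> (\<lambda>n. Y n - X0 - L n) \<in> o(r)"
    by (rule landau_o.small.in_cong) (use assms(2) in \<open>auto elim: eventually_mono\<close>)
  then show ?thesis using assms by (simp add: first_order_def)
qed

lemma first_order_const: "first_order r (\<lambda>_. k) k (\<lambda>_. 0)"
  by (simp add: first_order_def)

lemma first_order_self: "a \<in> O(r) \<Longrightarrow> first_order r a 0 a"
  by (simp add: first_order_def)

lemma first_order_add:
  assumes "first_order r X X0 L" "first_order r Y Y0 K"
  shows "first_order r (\<lambda>n. X n + Y n) (X0 + Y0) (\<lambda>n. L n + K n)"
proof -
  have "(\<lambda>n. (X n - X0 - L n) + (Y n - Y0 - K n)) \<in> o(r)"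
    by (rule sum_in_smallo) (use assms in \<open>auto simp: first_order_def\<close>)
  then show ?thesis using assms by (auto simp: first_order_def algebra_simps intro: sum_in_bigo)
qed

lemma first_order_cmult:
  assumes "first_order r X X0 L"
  shows "first_order r (\<lambda>n. k * X n) (k * X0) (\<lambda>n. k * L n)"
proof -
  have "(\<lambda>n. k * (X n - X0 - L n)) \<in> o(r)"
    using assms by (cases "k = 0") (auto simp: first_order_def)
  then show ?thesis using assms by (cases "k = 0") (auto simp: first_order_def algebra_simps)
qed

lemma first_order_diff:
  assumes "first_order r X X0 L" "first_order r Y Y0 K"
  shows "first_order r (\<lambda>n. X n - Y n) (X0 - Y0) (\<lambda>n. L n - K n)"
  using first_order_add[OF assms(1) first_order_cmult[OF assms(2), of "-1"]] by simp

lemma first_order_bigo: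
  assumes "first_order r X X0 L"
  shows "(\<lambda>n. X n - X0) \<in> O(r)"
proof -
  have "(\<lambda>n. (X n - X0 - L n) + L n) \<in> O(r)"
    by (rule sum_in_bigo) (use assms in \<open>auto simp: first_order_def landau_o.small_imp_big\<close>)
  then show ?thesis by simp
qed

lemma first_order_tendsto:
  assumes "first_order r X X0 L" "r \<longlonglongrightarrow> 0"
  shows "X \<longlonglongrightarrow> X0"
proof -
  have "r \<in> o(\<lambda>_. 1)" using assms(2) by (intro smalloI_tendsto) auto
  then have "(\<lambda>n. X n - X0) \<in> o(\<lambda>_. 1)"
    by (rule landau_o.big_small_trans[OF first_order_bigo[OF assms(1)]])
  then have "(\<lambda>n. X n - X0) \<longlonglongrightarrow> 0" using smalloD_tendsto by fastforce
  then show ?thesis by (simp add: LIM_zero_iff)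
qed

lemma tendsto_0_mult_bigo:
  assumes "g \<longlonglongrightarrow> (0::real)" "h \<in> O(r)"
  shows "(\<lambda>n. g n * h n) \<in> o(r)"
proof -
  have "g \<in> o(\<lambda>_. 1)" using assms(1) by (intro smalloI_tendsto) auto
  from landau_o.small_big_mult[OF this assms(2)] show ?thesis by simp
qed

text \<open>Caratheodory's form of the derivative avoids dividing by \<open>X n - X0\<close>, which
  may vanish.\<close>

lemma first_order_compose:
  assumes f: "(f has_real_derivative d) (at X0)" and X: "first_order r X X0 L" and r: "r \<longlonglongrightarrow> 0"
  shows "first_order r (\<lambda>n. f (X n)) (f X0) (\<lambda>n. d * L n)"
proof -
  obtain g where g: "\<And>z. f z - f X0 = g z * (z - X0)" "isCont g X0" "g X0 = d"
    using f unfolding DERIV_caratheodory_within[of f d X0 UNIV, simplified] by (metis CARAT_DERIV f)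
  have "(\<lambda>n. g (X n)) \<longlonglongrightarrow> d" using isCont_tendsto_compose[OF g(2) first_order_tendsto[OF X r]] g(3) by simp
  then have "(\<lambda>n. g (X n) - d) \<longlonglongrightarrow> 0" by (simp add: LIM_zero)
  then have "(\<lambda>n. (g (X n) - d) * (X n - X0)) \<in> o(r)"
    by (rule tendsto_0_mult_bigo[OF _ first_order_bigo[OF X]])
  moreover have "(\<lambda>n. d * (X n - X0 - L n)) \<in> o(r)"
    using X by (cases "d = 0") (auto simp: first_order_def)
  ultimately have "(\<lambda>n. (g (X n) - d) * (X n - X0) + d * (X n - X0 - L n)) \<in> o(r)" by (rule sum_in_smallo)
  moreover have "(\<lambda>n. (g (X n) - d) * (X n - X0) + d * (X n - X0 - L n)) = (\<lambda>n. f (X n) - f X0 - d * L n)"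
    unfolding g(1) by (auto simp: algebra_simps)
  ultimately show ?thesis using X by (cases "d = 0") (auto simp: first_order_def)
qed

lemma first_order_mult:
  assumes X: "first_order r X X0 L" and Y: "first_order r Y Y0 K" and r: "r \<longlonglongrightarrow> 0"
  shows "first_order r (\<lambda>n. X n * Y n) (X0 * Y0) (\<lambda>n. X0 * K n + Y0 * L n)"
proof -
  have "(\<lambda>n. X n - X0) \<longlonglongrightarrow> 0" using first_order_tendsto[OF X r] by (simp add: LIM_zero)
  then have "(\<lambda>n. (X n - X0) * (Y n - Y0)) \<in> o(r)"
    by (rule tendsto_0_mult_bigo[OF _ first_order_bigo[OF Y]])
  moreover have "first_order r (\<lambda>n. X0 * Y n + Y0 * X n) (X0 * Y0 + Y0 * X0) (\<lambda>n. X0 * K n + Y0 * L n)"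
    by (intro first_order_add first_order_cmult X Y)
  ultimately have "(\<lambda>n. (X n - X0) * (Y n - Y0) + (X0 * Y n + Y0 * X n - (X0 * Y0 + Y0 * X0) - (X0 * K n + Y0 * L n))) \<in> o(r)"
    and "(\<lambda>n. X0 * K n + Y0 * L n) \<in> O(r)"
    unfolding first_order_def by (auto intro: sum_in_smallo)
  then show ?thesis by (simp add: first_order_def algebra_simps)
qed

lemma first_order_divide:
  assumes X: "first_order r X X0 L" and Y: "first_order r Y Y0 K" and r: "r \<longlonglongrightarrow> 0" and nz: "Y0 \<noteq> 0"
  shows "first_order r (\<lambda>n. X n / Y n) (X0 / Y0) (\<lambda>n. L n / Y0 - X0 * K n / Y0\<^sup>2)"
proof -
  have "(inverse has_real_derivative - (inverse Y0 ^ 2)) (at Y0)"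
    using nz by (auto intro!: derivative_eq_intros simp: power2_eq_square)
  from first_order_mult[OF X first_order_compose[OF this Y r] r]
  have "first_order r (\<lambda>n. X n * inverse (Y n)) (X0 * inverse Y0) (\<lambda>n. X0 * (- (inverse Y0 ^ 2) * K n) + inverse Y0 * L n)" .
  then show ?thesis
    unfolding divide_inverse[symmetric]
    by (rule first_order_eqI) (use nz in \<open>auto simp: field_simps power2_eq_square\<close>)
qed

lemma first_order_sqrt:
  assumes X: "first_order r X X0 L" and r: "r \<longlonglongrightarrow> 0" and pos: "X0 > 0"
  shows "first_order r (\<lambda>n. sqrt (X n)) (sqrt X0) (\<lambda>n. L n / (2 * sqrt X0))"
proof -
  have "(sqrt has_real_derivative inverse (sqrt X0) / 2) (at X0)" using pos by (rule DERIV_real_sqrt)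
  from first_order_compose[OF this X r] show ?thesis
    by (rule first_order_eqI) (auto simp: field_simps)
qed

section \<open>The moving endpoint of the sector\<close>

text \<open>The tangent of the corner angle divided by \<open>sqrt a\<close>, which has a finite
  limit: with \<open>\<rho> = 1 - 2 * a * l^2\<close> the numerator carries a factor
  \<open>a\<close> and \<open>sqrt (1 - \<rho>^2)\<close> a factor \<open>sqrt a\<close>.\<close>

definition tan_scaled :: "real \<Rightarrow> real \<Rightarrow> real \<Rightarrow> real \<Rightarrow> real" where
  "tan_scaled a l x y = ((y - x) / (1 + a * x) + 2 * l\<^sup>2) / (2 * l * sqrt (1 - a * l\<^sup>2))"

text \<open>With \<open>\<rho> = 1 - 2 a l\<^sup>2\<close> this solves \<open>slope (- a x) z = ((1 + a y) / (1 + a x) - \<rho>) / sqrt (1 - \<rho>\<^sup>2)\<close>.\<close>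

definition endpoint :: "real \<Rightarrow> real \<Rightarrow> real \<Rightarrow> real \<Rightarrow> real" where
  "endpoint a l x y = tan_scaled a l x y * sqrt ((1 + a * x) / (- x)) / sqrt (sqrt (1 + a * (tan_scaled a l x y)\<^sup>2) + 1)"

text \<open>With \<open>E\<close> the secant, the perfect-square identity for \<open>slope\<close>
  gives \<open>kap^2 * z^2 = 2 * (E - 1)\<close>. Writing \<open>E - 1\<close> as
  \<open>q^2 / (E + 1)\<close> lets the root carry the sign of \<open>q\<close> and stay smooth at
  \<open>q = 0\<close>.\<close>

lemma slope_solve:
  assumes "0 < kap w"
  shows "slope w (q * sqrt 2 / (kap w * sqrt (sqrt (1 + q\<^sup>2) + 1))) = q"
proof -
  define E where "E = sqrt (1 + q\<^sup>2)"
  have E: "E \<ge> 1" "E\<^sup>2 = 1 + q\<^sup>2" by (auto simp: E_def)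
  define z where "z = q * sqrt 2 / (kap w * sqrt (E + 1))"
  have kz: "kap w * z = q * sqrt 2 / sqrt (E + 1)" using assms by (simp add: z_def)
  have "(kap w)\<^sup>2 * z\<^sup>2 = 2 * q\<^sup>2 / (E + 1)"
    unfolding power_mult_distrib[symmetric] kz using E by (simp add: power_mult_distrib power_divide)
  also have "\<dots> = 2 * (E - 1)"
  proof -
    have "q\<^sup>2 = (E - 1) * (E + 1)" using E(2) by (simp add: power2_eq_square algebra_simps)
    then show ?thesis using E by simp
  qed
  finally have "1 + (kap w)\<^sup>2 * z\<^sup>2 / 4 = (E + 1) / 2" by (simp add: field_simps)
  then have "slope w z = q * sqrt 2 / sqrt (E + 1) * sqrt ((E + 1) / 2)" unfolding slope_def kz by simp
  also have "\<dots> = q" using E by (simp add: real_sqrt_divide)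
  finally show ?thesis by (simp add: z_def E_def)
qed

text \<open>The factor \<open>sqrt a\<close> in the slope cancels against the one in
  \<open>kap (- a * x)\<close>, so \<open>endpoint\<close> is regular as \<open>a\<close> tends to
  \<open>0\<close>.\<close>

lemma slope_endpoint:
  assumes a: "a > 0" and x: "x < 0" and l: "l > 0" and ax: "1 + a * x > 0" and al: "a * l\<^sup>2 < 1" and \<rho>: "\<rho> = 1 - 2 * a * l\<^sup>2"
  shows "slope (- a * x) (endpoint a l x y) = ((1 + a * y) / (1 + a * x) - \<rho>) / sqrt (1 - \<rho>\<^sup>2)"
proof -
  define T where "T = tan_scaled a l x y"
  define q where "q = sqrt a * T"
  have q2: "q\<^sup>2 = a * T\<^sup>2" using a by (simp add: q_def power_mult_distrib)
  have k: "kap (- a * x) = sqrt 2 * sqrt a / sqrt ((1 + a * x) / (- x))"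
  proof -
    have "kap (- a * x) = sqrt (2 * a / ((1 + a * x) / (- x)))"
      unfolding kap_def using x ax by (simp add: field_simps)
    then show ?thesis by (simp only: real_sqrt_divide real_sqrt_mult)
  qed
  have sq: "sqrt ((1 + a * x) / (- x)) > 0" using x ax by (simp add: divide_pos_neg)
  have kpos: "kap (- a * x) > 0" unfolding k using a sq by simp
  have "endpoint a l x y = q * sqrt 2 / (kap (- a * x) * sqrt (sqrt (1 + q\<^sup>2) + 1))"
    unfolding endpoint_def T_def[symmetric] k q2 using a sq by (simp add: q_def)
  then have "slope (- a * x) (endpoint a l x y) = q" using slope_solve[OF kpos] by simp
  also have "q = ((1 + a * y) / (1 + a * x) - \<rho>) / sqrt (1 - \<rho>\<^sup>2)"
  proof -
    have "1 - \<rho>\<^sup>2 = a * ((2 * l)\<^sup>2 * (1 - a * l\<^sup>2))" unfolding \<rho> by (simp add: power2_eq_square algebra_simps)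
    then have s: "sqrt (1 - \<rho>\<^sup>2) = sqrt a * (2 * l * sqrt (1 - a * l\<^sup>2))" using l by (simp add: real_sqrt_mult)
    have n: "(1 + a * y) / (1 + a * x) - \<rho> = a * ((y - x) / (1 + a * x) + 2 * l\<^sup>2)"
      unfolding \<rho> using ax by (simp add: field_simps)
    have "a = sqrt a * sqrt a" using a by simp
    then show ?thesis unfolding s n q_def T_def tan_scaled_def using a by (metis (no_types, lifting) mult.assoc mult_divide_mult_cancel_left order_less_irrefl real_sqrt_gt_zero times_divide_eq_right)
  qed
  finally show ?thesis .
qed

text \<open>The last term is split off because it cancels the boundary term of \<open>J1\<close>;
  what remains, divided by \<open>sqrt (2 * \<bar>x\<bar>)\<close>, is the bracket appearing in
  \<open>Qn\<close>.\<close>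

lemma endpoint_expansion:
  assumes r: "r \<longlonglongrightarrow> 0" and a: "a \<in> O(r)" and l: "first_order r l lam (\<lambda>n. \<gamma> * c n)"
    and lam: "lam > 0" and x: "x < 0"
  shows "first_order r (\<lambda>n. endpoint (a n) (l n) x y) (zx lam x y)
    (\<lambda>n. (c n * \<gamma> * (1 - (y - x) / (2 * lam\<^sup>2))
      - a n / 2 * (lam * (y - x) + x * (y - x) / lam + 3 * (y - x)\<^sup>2 / (4 * lam) + (y - x) ^ 3 / (8 * lam ^ 3))) / sqrt (2 * \<bar>x\<bar>)
      - a n * \<bar>x\<bar> * zx lam x y * (1/2 - 3/4 * (zx lam x y)\<^sup>2))"
proof -
  define d where "d = y - x"
  define \<xi> where "\<xi> = - x"
  define m where "m = lam + d / (2 * lam)"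
  have \<xi>: "\<xi> > 0" using x by (simp add: \<xi>_def)
  note a1 = first_order_self[OF a]
  have ax: "first_order r (\<lambda>n. 1 + x * a n) (1 + x * 0) (\<lambda>n. 0 + x * a n)"
    by (intro first_order_add first_order_const first_order_cmult a1)
  have l2: "first_order r (\<lambda>n. l n * l n) (lam * lam) (\<lambda>n. lam * (\<gamma> * c n) + lam * (\<gamma> * c n))"
    by (rule first_order_mult[OF l l r])
  have num: "first_order r (\<lambda>n. d / (1 + x * a n) + 2 * (l n * l n)) (d / (1 + x * 0) + 2 * (lam * lam))
     (\<lambda>n. (0 / (1 + x * 0) - d * (0 + x * a n) / (1 + x * 0)\<^sup>2) + 2 * (lam * (\<gamma> * c n) + lam * (\<gamma> * c n)))"
    by (intro first_order_add first_order_divide first_order_const ax first_order_cmult l2 r) simp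
  have al: "first_order r (\<lambda>n. 1 - a n * (l n * l n)) (1 - 0 * (lam * lam))
     (\<lambda>n. 0 - (0 * (lam * (\<gamma> * c n) + lam * (\<gamma> * c n)) + (lam * lam) * a n))"
    by (intro first_order_diff first_order_const first_order_mult a1 l2 r)
  have sal: "first_order r (\<lambda>n. sqrt (1 - a n * (l n * l n))) 1 (\<lambda>n. - (lam * lam) * a n / 2)"
    by (rule first_order_eqI[OF first_order_sqrt[OF al r]]) auto
  have den: "first_order r (\<lambda>n. (2 * l n) * sqrt (1 - a n * (l n * l n))) ((2 * lam) * 1)
     (\<lambda>n. (2 * lam) * (- (lam * lam) * a n / 2) + 1 * (2 * (\<gamma> * c n)))"
    by (intro first_order_mult first_order_cmult l sal r)
  \<comment> \<open>The correction of the scaled tangent, whose limit is \<open>m\<close>. The three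
    contributions come from \<open>1 + a * x\<close>, from \<open>sqrt (1 - a * l^2)\<close> and
    from \<open>l - lam\<close>.\<close>
  define LT where "LT n = a n * (- x * d / (2 * lam) + m * lam\<^sup>2 / 2) + c n * \<gamma> * (1 - d / (2 * lam\<^sup>2))" for n
  define T where "T n = tan_scaled (a n) (l n) x y" for n
  have T: "first_order r T m LT"
  proof -
    have "first_order r (\<lambda>n. (d / (1 + x * a n) + 2 * (l n * l n)) / ((2 * l n) * sqrt (1 - a n * (l n * l n)))) m LT"
      by (rule first_order_eqI[OF first_order_divide[OF num den r]])
         (use lam in \<open>auto simp: m_def LT_def field_simps power2_eq_square power3_eq_cube\<close>)
    then show ?thesis unfolding T_def[abs_def] tan_scaled_def d_def power2_eq_square by (simp add: mult.commute)
  qed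
  have aT: "first_order r (\<lambda>n. 1 + a n * (T n * T n)) (1 + 0 * (m * m)) (\<lambda>n. 0 + (0 * (m * LT n + m * LT n) + m * m * a n))"
    by (intro first_order_add first_order_const first_order_mult a1 T r)
  have "first_order r (\<lambda>n. sqrt (1 + a n * (T n * T n)) + 1) (sqrt (1 + 0 * (m * m)) + 1)
      (\<lambda>n. (0 + (0 * (m * LT n + m * LT n) + m * m * a n)) / (2 * sqrt (1 + 0 * (m * m))) + 0)"
    by (intro first_order_add first_order_const first_order_sqrt[OF aT r]) simp
  then have s1: "first_order r (\<lambda>n. sqrt (1 + a n * (T n * T n)) + 1) 2 (\<lambda>n. m * m * a n / 2)"
    by (rule first_order_eqI) auto
  have s2: "first_order r (\<lambda>n. sqrt (sqrt (1 + a n * (T n * T n)) + 1)) (sqrt 2) (\<lambda>n. m * m * a n / 2 / (2 * sqrt 2))"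
    by (rule first_order_sqrt[OF s1 r]) simp
  have "first_order r (\<lambda>n. 1 / \<xi> * (1 + x * a n)) (1 / \<xi> * (1 + x * 0)) (\<lambda>n. 1 / \<xi> * (0 + x * a n))"
    by (intro first_order_cmult ax)
  then have ax2: "first_order r (\<lambda>n. 1 / \<xi> * (1 + x * a n)) (1 / \<xi>) (\<lambda>n. - a n)"
    by (rule first_order_eqI) (use \<xi> in \<open>auto simp: \<xi>_def field_simps\<close>)
  have "first_order r (\<lambda>n. sqrt (1 / \<xi> * (1 + x * a n))) (sqrt (1 / \<xi>)) (\<lambda>n. - a n / (2 * sqrt (1 / \<xi>)))"
    by (rule first_order_sqrt[OF ax2 r]) (use \<xi> in simp)
  then have s3: "first_order r (\<lambda>n. sqrt (1 / \<xi> * (1 + x * a n))) (1 / sqrt \<xi>) (\<lambda>n. - a n * sqrt \<xi> / 2)"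
    by (rule first_order_eqI) (use \<xi> in \<open>auto simp: real_sqrt_divide\<close>)
  have sq2: "sqrt (2 * \<bar>x\<bar>) = sqrt 2 * sqrt \<xi>"
    using x by (simp only: \<xi>_def real_sqrt_mult abs_of_neg)
  define z0 where "z0 = zx lam x y"
  have z0: "z0 = m / (sqrt 2 * sqrt \<xi>)"
    unfolding z0_def zx_def m_def d_def sq2 ..
  define sx where "sx = sqrt \<xi>"
  have sx: "sx > 0" "\<xi> = sx * sx" using \<xi> by (auto simp: sx_def)
  define st where "st = sqrt (2::real)"
  have st: "st > 0" "st * st = 2" by (auto simp: st_def)
  have mz: "m = z0 * st * sx" using z0 st sx unfolding sx_def[symmetric] st_def[symmetric] by (simp add: field_simps)
  have fin: "first_order r (\<lambda>n. T n * sqrt (1 / \<xi> * (1 + x * a n)) / sqrt (sqrt (1 + a n * (T n * T n)) + 1))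
     z0 (\<lambda>n. LT n / (st * sx) - a n * \<xi> * z0 / 2 - a n * \<xi> * z0 ^ 3 / 4)"
  proof (rule first_order_eqI[OF first_order_divide[OF first_order_mult[OF T s3 r] s2 r]])
    show "m * (1 / sqrt \<xi>) / sqrt 2 = z0" unfolding z0 by simp
    fix n
    have "(m * (- a n * sx / 2) + 1 / sx * LT n) / st - m * (1 / sx) * (m * m * a n / 2 / (2 * st)) / st\<^sup>2 =
       LT n / (st * sx) - a n * (m / st) * sx / 2 - a n * m * m * m / (sx * st * (st * st) * 4)"
      using st(1) sx(1) by (simp add: field_simps power2_eq_square)
    also have "a n * (m / st) * sx / 2 = a n * \<xi> * z0 / 2" using st(1) by (simp add: mz sx(2))
    also have "a n * m * m * m / (sx * st * (st * st) * 4) = a n * \<xi> * z0 ^ 3 / 4"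
      using st(1) sx(1) by (simp add: mz sx(2) power3_eq_cube)
    finally show "(m * (- a n * sqrt \<xi> / 2) + 1 / sqrt \<xi> * LT n) / sqrt 2 - m * (1 / sqrt \<xi>) * (m * m * a n / 2 / (2 * sqrt 2)) / (sqrt 2)\<^sup>2 =
       LT n / (st * sx) - a n * \<xi> * z0 / 2 - a n * \<xi> * z0 ^ 3 / 4" unfolding sx_def st_def .
  qed simp
  have "first_order r (\<lambda>n. endpoint (a n) (l n) x y) z0 (\<lambda>n. LT n / (st * sx) - a n * \<xi> * z0 / 2 - a n * \<xi> * z0 ^ 3 / 4)"
    using fin unfolding endpoint_def T_def[symmetric] \<xi>_def power2_eq_square by (simp add: mult.commute)
  then show ?thesis unfolding z0_def[symmetric]
  proof (rule first_order_eqI)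
    fix n
    define Br where "Br = lam * (y - x) + x * (y - x) / lam + 3 * (y - x)\<^sup>2 / (4 * lam) + (y - x) ^ 3 / (8 * lam ^ 3)"
    \<comment> \<open>The bracket of \<open>Qn\<close> differs from the tangent correction by a cube
      of \<open>m\<close>, worth \<open>\<xi> * z0 ^ 3\<close> after scaling. Together with the
      corrections from the two roots in \<open>endpoint\<close> it forms
      \<open>- \<xi> * z0 * (1/2 - 3/4 * z0^2)\<close>.\<close>
    have "- Br / 2 = (- x * d / (2 * lam) + m * lam\<^sup>2 / 2) - m ^ 3 / 2"
      unfolding Br_def m_def d_def[symmetric] using lam
      by (simp add: field_simps power2_eq_square power3_eq_cube)
    then have Br: "- x * d / (2 * lam) + m * lam\<^sup>2 / 2 = - Br / 2 + m ^ 3 / 2" by simp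
    have "m ^ 3 / 2 / (st * sx) = \<xi> * z0 ^ 3"
    proof -
      have "m ^ 3 = z0 ^ 3 * (st * st) * \<xi> * (st * sx)" unfolding mz sx(2) by (simp add: power3_eq_cube)
      then show ?thesis using st sx by simp
    qed
    then have m3: "a n * (m ^ 3 / 2) / (st * sx) = a n * (\<xi> * z0 ^ 3)" by (metis times_divide_eq_right)
    have "LT n / (st * sx) = (c n * \<gamma> * (1 - d / (2 * lam\<^sup>2)) - a n / 2 * Br) / (st * sx) + a n * (\<xi> * z0 ^ 3)"
      unfolding LT_def Br m3[symmetric] add_divide_distrib[symmetric]
      by (rule arg_cong[where f = "\<lambda>v. v / (st * sx)"]) (simp add: field_simps)
    moreover have "st * sx = sqrt (2 * \<bar>x\<bar>)" by (simp only: st_def sx_def sq2)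
    moreover have "\<bar>x\<bar> = \<xi>" using x by (simp add: \<xi>_def)
    ultimately show "LT n / (st * sx) - a n * \<xi> * z0 / 2 - a n * \<xi> * z0 ^ 3 / 4 =
      (c n * \<gamma> * (1 - (y - x) / (2 * lam\<^sup>2)) - a n / 2 * Br) / sqrt (2 * \<bar>x\<bar>) - a n * \<bar>x\<bar> * z0 * (1/2 - 3/4 * z0\<^sup>2)"
      by (simp add: d_def algebra_simps power2_eq_square power3_eq_cube)
  qed simp
qed

section \<open>Expansion of the expected number of exceedances\<close>

lemma first_order_mult_tendsto:
  assumes "b \<in> O(r)" "X \<longlonglongrightarrow> V"
  shows "first_order r (\<lambda>n. b n * X n) 0 (\<lambda>n. V * b n)"
proof -
  have "(\<lambda>n. (X n - V) * b n) \<in> o(r)"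
    by (rule tendsto_0_mult_bigo[OF _ assms(1)]) (use assms(2) in \<open>simp add: LIM_zero\<close>)
  moreover have "(\<lambda>n. V * b n) \<in> O(r)" using assms(1) by (cases "V = 0") auto
  ultimately show ?thesis by (simp add: first_order_def algebra_simps)
qed

text \<open>Dividing by \<open>sect F (a n) 1\<close> is multiplying by \<open>n\<close>. The ratio
  of the two \<open>kap\<close> factors raises the exponent from \<open>\<alpha>\<close> to
  \<open>\<alpha> + 1/2\<close>, and its correction \<open>(\<xi> - 1) / 2\<close> supplies the
  terms \<open>1/2\<close> of \<open>J1\<close> and \<open>I1\<close>. The outer minus sign reflects
  that \<open>Qn\<close> corrects the logarithm of the distribution function, while the ratio counts
  exceedances.\<close>

lemma sector_ratio_expansion:
  assumes F: "mono F" "\<And>t. 0 \<le> F t" "\<And>t. F t \<le> 1" "F 1 = 1" "\<And>t. t < 1 \<Longrightarrow> F t < 1"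
    and RV: "second_order_RV (\<lambda>t. 1 - F (1 - 1 / t)) \<alpha> \<tau> A" and \<alpha>: "\<alpha> > 0" and \<tau>: "\<tau> \<le> 0"
    and a: "a \<longlonglongrightarrow> 0" "\<forall>\<^sub>F n in sequentially. 0 < a n" and \<xi>: "\<xi> > 0"
    and r: "r \<longlonglongrightarrow> 0" and aO: "a \<in> O(r)" and AO: "(\<lambda>n. A (1 / a n)) \<in> O(r)"
    and z: "first_order r z z0 Lz" and z0: "-1 < z0" "z0 < 1"
  shows "first_order r (\<lambda>n. sect F (a n * \<xi>) (z n) / sect F (a n) 1) (\<xi> powr (\<alpha> + 1/2) * psi \<alpha> z0)
    (\<lambda>n. - (\<xi> powr (\<alpha> + 1/2) *
       (- a n * \<xi> / c_alpha \<alpha> * J1 \<alpha> z0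
        - A (1 / a n) * \<xi> powr (- \<tau>) / c_alpha \<alpha> * J2 \<alpha> \<tau> z0
        + psi \<alpha> z0 * (- A (1 / a n) * qt \<tau> \<xi> + a n / c_alpha \<alpha> * I1 \<alpha> + A (1 / a n) / c_alpha \<alpha> * I2 \<alpha> \<tau>)
        - (1 - z0\<^sup>2) powr \<alpha> / c_alpha \<alpha> * (Lz n + a n * \<xi> * z0 * (1/2 - 3/4 * z0\<^sup>2)))))"
proof -
  define ca where "ca = c_alpha \<alpha>"
  have ca: "ca > 0" using c_alpha_pos[OF \<alpha>] by (simp add: ca_def)
  define An where "An n = A (1 / a n)" for n
  have AO': "An \<in> O(r)" using AO by (simp add: An_def[abs_def])
  have zt: "z \<longlonglongrightarrow> z0" by (rule first_order_tendsto[OF z r])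
  have z1: "\<forall>\<^sub>F n in sequentially. z n \<le> 1" using order_tendstoD(2)[OF zt z0(2)] by (rule eventually_mono) simp
  obtain X Y where XY: "X \<longlonglongrightarrow> \<xi> powr \<alpha> * (qt \<tau> \<xi> * Psi0 \<alpha> z0 + \<xi> powr (- \<tau>) * J2 \<alpha> \<tau> z0)"
    "Y \<longlonglongrightarrow> - (5/4) * \<xi> * \<xi> powr \<alpha> * Psi2 \<alpha> z0"
    "\<forall>\<^sub>F n in sequentially.
      (LBINT s:{-1..z n}. (1 - F (1 - a n * \<xi> * (1 - s\<^sup>2))) * jac (a n * \<xi>) s) / (1 - F (1 - a n)) =
      \<xi> powr \<alpha> * Psi0 \<alpha> (z n) + A (1 / a n) * X n + a n * Y n"
    using tail_integral_expansion[OF F RV \<alpha> \<tau> a \<xi> zt z1] z0 by auto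
  obtain X1 Y1 where XY1: "X1 \<longlonglongrightarrow> 1 powr \<alpha> * (qt \<tau> 1 * Psi0 \<alpha> 1 + 1 powr (- \<tau>) * J2 \<alpha> \<tau> 1)"
    "Y1 \<longlonglongrightarrow> - (5/4) * 1 * 1 powr \<alpha> * Psi2 \<alpha> 1"
    "\<forall>\<^sub>F n in sequentially.
      (LBINT s:{-1..1}. (1 - F (1 - a n * 1 * (1 - s\<^sup>2))) * jac (a n * 1) s) / (1 - F (1 - a n)) =
      1 powr \<alpha> * Psi0 \<alpha> 1 + A (1 / a n) * X1 n + a n * Y1 n"
    using tail_integral_expansion[OF F RV \<alpha> \<tau> a, of 1 "\<lambda>_. 1" 1] by auto
  define p where "p = \<xi> powr \<alpha>"
  define t where "t = \<xi> powr (- \<tau>)"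
  define \<Psi> where "\<Psi> = Psi0 \<alpha> z0"
  define P2 where "P2 = Psi2 \<alpha> z0"
  define j2 where "j2 = J2 \<alpha> \<tau> z0"
  define i2 where "i2 = I2 \<alpha> \<tau>"
  define P21 where "P21 = Psi2 \<alpha> 1"
  define q where "q = qt \<tau> \<xi>"
  define D where "D = (1 - z0\<^sup>2) powr \<alpha>"
  define B where "B n = (LBINT s:{-1..z n}. (1 - F (1 - a n * \<xi> * (1 - s\<^sup>2))) * jac (a n * \<xi>) s) / (1 - F (1 - a n))" for n
  define B1 where "B1 n = (LBINT s:{-1..1}. (1 - F (1 - a n * (1 - s\<^sup>2))) * jac (a n) s) / (1 - F (1 - a n))" for n
  have fB: "first_order r B (p * \<Psi>) (\<lambda>n. p * (D * Lz n) + (p * (q * \<Psi> + t * j2)) * An n + (- (5/4) * \<xi> * p * P2) * a n)"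
  proof (rule first_order_cong)
    show "first_order r (\<lambda>n. p * Psi0 \<alpha> (z n) + An n * X n + a n * Y n) (p * \<Psi>)
      (\<lambda>n. p * (D * Lz n) + (p * (q * \<Psi> + t * j2)) * An n + (- (5/4) * \<xi> * p * P2) * a n)"
      by (rule first_order_eqI[OF first_order_add[OF first_order_add[OF first_order_cmult[OF
            first_order_compose[OF Psi0_has_derivative[OF \<alpha> z0] z r]]
            first_order_mult_tendsto[OF AO' XY(1)]] first_order_mult_tendsto[OF aO XY(2)]]])
         (auto simp: p_def \<Psi>_def D_def q_def t_def j2_def P2_def)
    show "\<forall>\<^sub>F n in sequentially. p * Psi0 \<alpha> (z n) + An n * X n + a n * Y n = B n"
      using XY(3) by eventually_elim (simp add: B_def p_def An_def)
  qed
  have fB1: "first_order r B1 ca (\<lambda>n. i2 * An n + (- (5/4) * P21) * a n)"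
  proof (rule first_order_cong)
    have "qt \<tau> 1 = 0" by (simp add: qt_def)
    then show "first_order r (\<lambda>n. ca + An n * X1 n + a n * Y1 n) ca (\<lambda>n. i2 * An n + (- (5/4) * P21) * a n)"
      by (intro first_order_eqI[OF first_order_add[OF first_order_add[OF first_order_const
            first_order_mult_tendsto[OF AO' XY1(1)]] first_order_mult_tendsto[OF aO XY1(2)]]])
         (auto simp: i2_def P21_def I2_eq)
    show "\<forall>\<^sub>F n in sequentially. ca + An n * X1 n + a n * Y1 n = B1 n"
      using XY1(3) by eventually_elim (simp add: B1_def An_def ca_def Psi0_at_1[OF \<alpha>])
  qed
  define sx where "sx = sqrt \<xi>"
  have sx: "sx > 0" "\<xi> = sx * sx" using \<xi> by (auto simp: sx_def)
  \<comment> \<open>The square of the ratio of the \<open>kap\<close> factors, a rational function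
    of \<open>a n\<close>.\<close>
  have k1: "first_order r (\<lambda>n. (\<xi> + (- \<xi>) * a n) / (1 + (- \<xi>) * a n)) ((\<xi> + (- \<xi>) * 0) / (1 + (- \<xi>) * 0))
      (\<lambda>n. (0 + (- \<xi>) * a n) / (1 + (- \<xi>) * 0) - (\<xi> + (- \<xi>) * 0) * (0 + (- \<xi>) * a n) / (1 + (- \<xi>) * 0)\<^sup>2)"
    by (intro first_order_divide first_order_add first_order_const first_order_cmult first_order_self aO r) simp
  have fk: "first_order r (\<lambda>n. kap (a n * \<xi>) / kap (a n)) sx (\<lambda>n. a n * sx * (\<xi> - 1) / 2)"
  proof (rule first_order_cong)
    show "first_order r (\<lambda>n. sqrt ((\<xi> + (- \<xi>) * a n) / (1 + (- \<xi>) * a n))) sx (\<lambda>n. a n * sx * (\<xi> - 1) / 2)"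
      by (rule first_order_eqI[OF first_order_sqrt[OF k1 r]])
         (use \<xi> sx in \<open>auto simp: sx_def[symmetric] sx(2) field_simps\<close>)
    have "(\<lambda>n. a n * \<xi>) \<longlonglongrightarrow> 0" using tendsto_mult_right[OF a(1), of \<xi>] by simp
    then have "\<forall>\<^sub>F n in sequentially. a n * \<xi> < 1" by (rule order_tendstoD) simp
    moreover have "\<forall>\<^sub>F n in sequentially. a n < 1" by (rule order_tendstoD(2)[OF a(1)]) simp
    ultimately show "\<forall>\<^sub>F n in sequentially. sqrt ((\<xi> + (- \<xi>) * a n) / (1 + (- \<xi>) * a n)) = kap (a n * \<xi>) / kap (a n)"
      using a(2)
    proof eventually_elim
      case (elim n)
      have "(\<xi> + (- \<xi>) * a n) / (1 + (- \<xi>) * a n) = (2 * (a n * \<xi>) / (1 - a n * \<xi>)) / (2 * a n / (1 - a n))"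
        using elim by (simp add: divide_simps) (simp add: algebra_simps)
      then show ?case unfolding kap_def by (simp only: real_sqrt_divide)
    qed
  qed
  have main: "first_order r (\<lambda>n. (kap (a n * \<xi>) / kap (a n)) * (B n / B1 n)) (sx * (p * \<Psi> / ca))
    (\<lambda>n. sx * ((p * (D * Lz n) + (p * (q * \<Psi> + t * j2)) * An n + (- (5/4) * \<xi> * p * P2) * a n) / ca
        - (p * \<Psi>) * (i2 * An n + (- (5/4) * P21) * a n) / ca\<^sup>2) + (p * \<Psi> / ca) * (a n * sx * (\<xi> - 1) / 2))"
    by (intro first_order_mult first_order_divide fk fB fB1 r) (use ca in simp)
  have J1z: "J1 \<alpha> z0 = \<Psi> / 2 - 5/4 * P2 - D * z0 * (1/2 - 3/4 * z0\<^sup>2)"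
    using J1_eq[OF \<alpha>, of z0] z0 by (simp add: \<Psi>_def P2_def D_def)
  \<comment> \<open>At the right end of the interval the boundary term of the integration by parts
    vanishes.\<close>
  have I1: "I1 \<alpha> = ca / 2 - 5/4 * P21"
    unfolding I1_def using J1_eq[OF \<alpha>, of 1] Psi0_at_1[OF \<alpha>] by (simp add: ca_def P21_def)
  have psi: "psi \<alpha> z0 = \<Psi> / ca" using psi_eq[of z0 \<alpha>] z0 by (simp add: \<Psi>_def ca_def)
  have pw: "\<xi> powr (\<alpha> + 1/2) = p * sx" unfolding p_def sx_def by (simp add: powr_add powr_half_sqrt \<xi> less_imp_le)
  show ?thesis
  proof (rule first_order_cong[OF first_order_eqI[OF main]])
    show "sx * (p * \<Psi> / ca) = \<xi> powr (\<alpha> + 1/2) * psi \<alpha> z0" by (simp add: pw psi)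
    show "\<forall>\<^sub>F n in sequentially. kap (a n * \<xi>) / kap (a n) * (B n / B1 n) = sect F (a n * \<xi>) (z n) / sect F (a n) 1"
      using a(2)
    proof eventually_elim
      case (elim n)
      then have "1 - F (1 - a n) > 0" using F(5)[of "1 - a n"] by simp
      then show ?case by (simp add: sect_def B_def B1_def)
    qed
    fix n
    define W where "W = z0 * (1/2 - 3/4 * z0\<^sup>2)"
    have "sx * ((p * (D * Lz n) + (p * (q * \<Psi> + t * j2)) * An n + (- (5/4) * \<xi> * p * P2) * a n) / ca
        - (p * \<Psi>) * (i2 * An n + (- (5/4) * P21) * a n) / ca\<^sup>2) + (p * \<Psi> / ca) * (a n * sx * (\<xi> - 1) / 2) =
      - (p * sx * (- a n * \<xi> / ca * (\<Psi> / 2 - 5/4 * P2 - D * W) - An n * t / ca * j2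
        + \<Psi> / ca * (- An n * q + a n / ca * (ca / 2 - 5/4 * P21) + An n / ca * i2)
        - D / ca * (Lz n + a n * \<xi> * W)))"
      using ca by (simp add: field_simps power2_eq_square)
    then show "sx * ((p * (D * Lz n) + (p * (q * \<Psi> + t * j2)) * An n + (- (5/4) * \<xi> * p * P2) * a n) / ca
        - (p * \<Psi>) * (i2 * An n + (- (5/4) * P21) * a n) / ca\<^sup>2) + (p * \<Psi> / ca) * (a n * sx * (\<xi> - 1) / 2) =
      - (\<xi> powr (\<alpha> + 1/2) *
       (- a n * \<xi> / c_alpha \<alpha> * J1 \<alpha> z0
        - A (1 / a n) * \<xi> powr (- \<tau>) / c_alpha \<alpha> * J2 \<alpha> \<tau> z0
        + psi \<alpha> z0 * (- A (1 / a n) * qt \<tau> \<xi> + a n / c_alpha \<alpha> * I1 \<alpha> + A (1 / a n) / c_alpha \<alpha> * I2 \<alpha> \<tau>)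
        - (1 - z0\<^sup>2) powr \<alpha> / c_alpha \<alpha> * (Lz n + a n * \<xi> * z0 * (1/2 - 3/4 * z0\<^sup>2))))"
      unfolding ca_def[symmetric] An_def[symmetric] J1z I1 psi pw
        t_def[symmetric] j2_def[symmetric] q_def[symmetric] i2_def[symmetric] D_def[symmetric]
      by (simp add: W_def mult.assoc)
  qed
qed

section \<open>From expected exceedances to the law of the maxima\<close>

text \<open>Two terms of the logarithm must be kept: after multiplication by \<open>n\<close> the
  square still contributes at order \<open>1 / n\<close>, whereas the cube is of order
  \<open>1 / n^2\<close>.\<close>

lemma ln_one_minus_third_order:
  fixes p :: real
  assumes "0 \<le> p" "p \<le> 1/2"
  shows "\<bar>ln (1 - p) + p + p\<^sup>2 / 2\<bar> \<le> 2 * p ^ 3"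
proof (cases "p = 0")
  case False
  then have p: "0 < p" using assms by simp
  define g where "g x = ln (1 - x) + x + x\<^sup>2 / 2" for x :: real
  have "\<exists>c>0. c < p \<and> g p - g 0 = (p - 0) * (- c\<^sup>2 / (1 - c))"
  proof (rule MVT2[OF p])
    fix x assume "0 \<le> x" "x \<le> p"
    then have "1 - x > 0" using assms by simp
    then show "(g has_real_derivative - x\<^sup>2 / (1 - x)) (at x)"
      unfolding g_def by (auto intro!: derivative_eq_intros simp: field_simps power2_eq_square)
  qed
  then obtain c where c: "0 < c" "c < p" "g p = p * (- c\<^sup>2 / (1 - c))" by (auto simp: g_def)
  have "\<bar>g p\<bar> = p * (c\<^sup>2 / (1 - c))" using c p assms by (simp add: abs_mult)
  also have "\<dots> \<le> p * (p\<^sup>2 / (1/2))" using c p assms by (intro mult_left_mono frac_le power_mono) auto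
  finally have "\<bar>g p\<bar> \<le> p * (p\<^sup>2 / (1/2))" .
  then show ?thesis by (simp add: g_def power3_eq_cube power2_eq_square mult.assoc)
qed simp

text \<open>\<open>Np\<close> is \<open>n\<close> times the one-step exceedance probability.
  Expanding the logarithm before exponentiating produces both the correction \<open>Q\<close> and
  the term \<open>- K^2 / 2 * (1 / n)\<close>.\<close>

lemma power_expansion:
  assumes r: "r \<longlonglongrightarrow> 0" and nO: "(\<lambda>n. 1 / real n) \<in> O(r)"
    and Np: "first_order r Np K (\<lambda>n. - Q n)" and nonneg: "\<forall>\<^sub>F n in sequentially. 0 \<le> Np n"
  shows "first_order r (\<lambda>n. (1 - Np n / real n) ^ n) (exp (- K)) (\<lambda>n. exp (- K) * (Q n - K\<^sup>2 / 2 * (1 / real n)))"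
proof -
  have Nt: "Np \<longlonglongrightarrow> K" by (rule first_order_tendsto[OF Np r])
  have p0: "(\<lambda>n. Np n * (1 / real n)) \<longlonglongrightarrow> K * 0" by (intro tendsto_mult Nt lim_1_over_n)
  then have small: "\<forall>\<^sub>F n in sequentially. Np n / real n < 1/2" by (intro order_tendstoD(2)[of _ "K * 0"]) auto
  define g where "g n = real n * (ln (1 - Np n / real n) + Np n / real n + (Np n / real n)\<^sup>2 / 2)" for n
  have "g \<in> o(r)"
  proof -
    have "(\<lambda>n. 2 * Np n ^ 3 * (1 / real n)) \<longlonglongrightarrow> 2 * K ^ 3 * 0" by (intro tendsto_intros Nt lim_1_over_n)
    then have "(\<lambda>n. 2 * Np n ^ 3 * (1 / real n) * (1 / real n)) \<in> o(r)"
      by (intro tendsto_0_mult_bigo nO) simp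
    moreover have "g \<in> O(\<lambda>n. 2 * Np n ^ 3 * (1 / real n) * (1 / real n))"
    proof (rule bigoI[where c = 1])
      show "\<forall>\<^sub>F n in sequentially. norm (g n) \<le> 1 * norm (2 * Np n ^ 3 * (1 / real n) * (1 / real n))"
        using nonneg small eventually_gt_at_top[of 0]
      proof eventually_elim
        case (elim n)
        have "\<bar>ln (1 - Np n / real n) + Np n / real n + (Np n / real n)\<^sup>2 / 2\<bar> \<le> 2 * (Np n / real n) ^ 3"
          using elim by (intro ln_one_minus_third_order) auto
        then have "\<bar>g n\<bar> \<le> real n * (2 * (Np n / real n) ^ 3)"
          unfolding g_def abs_mult by (simp add: mult_left_mono)
        also have "\<dots> = 2 * Np n ^ 3 * (1 / real n) * (1 / real n)"
          using elim by (simp add: power3_eq_cube field_simps)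
        finally show ?case by (simp add: elim)
      qed
    qed
    ultimately show ?thesis by (rule landau_o.big_small_trans[rotated])
  qed
  then have g: "first_order r g 0 (\<lambda>_. 0)" by (simp add: first_order_def)
  have N2: "first_order r (\<lambda>n. Np n * Np n * (1 / real n)) (K * K * 0) (\<lambda>n. (K * K) * (1 / real n) + 0 * (K * (- Q n) + K * (- Q n)))"
    by (intro first_order_mult Np first_order_self nO r)
  have "first_order r (\<lambda>n. (-1) * Np n + (-1/2) * (Np n * Np n * (1 / real n)) + g n) (- K) (\<lambda>n. Q n - K\<^sup>2 / 2 * (1 / real n))"
    by (rule first_order_eqI[OF first_order_add[OF first_order_add[OF first_order_cmult[OF Np] first_order_cmult[OF N2]] g]])
       (auto simp: power2_eq_square)
  then have "first_order r (\<lambda>n. exp ((-1) * Np n + (-1/2) * (Np n * Np n * (1 / real n)) + g n)) (exp (- K))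
      (\<lambda>n. exp (- K) * (Q n - K\<^sup>2 / 2 * (1 / real n)))"
    by (rule first_order_compose[OF DERIV_exp _ r])
  then show ?thesis
  proof (rule first_order_cong)
    show "\<forall>\<^sub>F n in sequentially. exp ((-1) * Np n + (-1/2) * (Np n * Np n * (1 / real n)) + g n) = (1 - Np n / real n) ^ n"
      using small eventually_gt_at_top[of 0]
    proof eventually_elim
      case (elim n)
      have "(-1) * Np n + (-1/2) * (Np n * Np n * (1 / real n)) + g n = real n * ln (1 - Np n / real n)"
        using elim by (simp add: g_def field_simps power2_eq_square)
      then show ?case using elim by (simp add: exp_of_nat_mult)
    qed
  qed
qed

text \<open>The remainder is a witness sequence \<open>e\<close>, and the identity holds eventually
  because \<open>a n\<close> is positive only from some index on. The error scale uses the absolute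
  value of \<open>c n\<close>, so that opposite signs cannot cancel in the sum and each summand
  stays bounded by the scale.\<close>

theorem theorem1:
  fixes M :: "'a measure" and R \<Theta> :: "'a \<Rightarrow> real"
    and N :: "'b measure" and X :: "nat \<Rightarrow> nat \<Rightarrow> 'b \<Rightarrow> real \<times> real"
    and \<rho> c a :: "nat \<Rightarrow> real" and F G A :: "real \<Rightarrow> real"
    and \<alpha> \<tau> lam \<gamma> x y :: real
  assumes M: "prob_space M"
    and R_meas: "R \<in> borel_measurable M" and \<Theta>_meas: "\<Theta> \<in> borel_measurable M"
    and indep: "prob_space.indep_var M borel R borel \<Theta>"
    and unif: "distr M lborel \<Theta> = uniform_measure lborel {0..<2*pi}"
    and R_pos: "AE \<omega> in M. R \<omega> > 0"
    and F_def: "F = cdf (distr M borel R)"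
    and F_end: "Sup {t. F t < 1} = 1"
    and G_def: "G = cdf (distr M borel (\<lambda>\<omega>. R \<omega> * cos (\<Theta> \<omega>)))"
    and a_def: "a = (\<lambda>n. 1 - gen_inv G (1 - 1 / real n))"
    and \<rho>_range: "\<And>n. 0 < \<rho> n \<and> \<rho> n < 1"
    and N: "prob_space N"
    and X_indep: "\<And>n. prob_space.indep_vars N (\<lambda>_. borel) (X n) {1..n}"
    and X_distr: "\<And>n i. i \<in> {1..n} \<Longrightarrow> distr N borel (X n i) =
        distr M borel (\<lambda>\<omega>. (R \<omega> * cos (\<Theta> \<omega>),
            \<rho> n * (R \<omega> * cos (\<Theta> \<omega>)) + sqrt (1 - (\<rho> n)\<^sup>2) * (R \<omega> * sin (\<Theta> \<omega>))))"
    and RV2: "second_order_RV (\<lambda>t. 1 - F (1 - 1 / t)) \<alpha> \<tau> A"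
    and \<alpha>_pos: "\<alpha> > 0" and \<tau>_nonpos: "\<tau> \<le> 0"
    and lam_pos: "lam > 0"
    and c_lim: "c \<longlonglongrightarrow> 0" and c_nz: "\<And>n. c n \<noteq> 0"
    and \<gamma>_lim: "(\<lambda>n. (sqrt ((1 - \<rho> n) / (2 * a n)) - lam) / c n) \<longlonglongrightarrow> \<gamma>"
    and x_neg: "x < 0" and y_neg: "y < 0"
    and xy_cond: "lam\<^sup>2 + x + y + (x - y)\<^sup>2 / (4 * lam\<^sup>2) < 0"
  shows "\<exists>e :: nat \<Rightarrow> real.
     e \<in> o(\<lambda>n. a n + \<bar>c n\<bar> + \<bar>A (1 / a n)\<bar> + 1 / real n) \<and>
     (\<forall>\<^sub>F n in sequentially.
        measure N {\<omega> \<in> space N.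
            Max ((\<lambda>i. fst (X n i \<omega>)) ` {1..n}) \<le> 1 + a n * x \<and>
            Max ((\<lambda>i. snd (X n i \<omega>)) ` {1..n}) \<le> 1 + a n * y}
        - H_lim \<alpha> lam x y
      = H_lim \<alpha> lam x y *
          (- 1/2 * (1 / real n) *
              (\<bar>x\<bar> powr (\<alpha> + 1/2) * psi \<alpha> (zx lam x y)
               + \<bar>y\<bar> powr (\<alpha> + 1/2) * psi \<alpha> (zy lam x y))\<^sup>2
           + Qn \<alpha> \<tau> lam \<gamma> (a n) (c n) (A (1 / a n)) x y
           + e n))"
proof -
  interpret M: prob_space M by fact
  interpret N: prob_space N by fact
  interpret S: spherical M R \<Theta>
    by unfold_locales (use R_meas \<Theta>_meas indep unif R_pos in auto)
  interpret D: prob_space S.D by (rule S.prob_space_D)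
  interpret D: real_distribution S.D by standard auto
  have FD: "F = cdf S.D" unfolding F_def S.D_def ..
  have F_mono: "mono F" unfolding FD by (simp add: D.cdf_nondecreasing mono_def)
  have F_le1: "F t \<le> 1" for t unfolding FD by (rule D.cdf_bounded_prob)
  have F_ge0: "0 \<le> F t" for t unfolding FD by (rule D.cdf_nonneg)
  have f_mono: "1 - F (1 - 1 / t) \<le> 1 - F (1 - 1 / s)" if "0 < s" "s \<le> t" for s t
    using that by (intro diff_left_mono monoD[OF F_mono] divide_left_mono) auto
  note f_lim = second_order_RV_tendsto_0[OF RV2 \<alpha>_pos _ f_mono, simplified]
  have F_lt1: "F t < 1" if "t < 1" for t
    using f_lim(1)[of "1 / (1 - t)"] F_le1 that by simp
  have F1: "F 1 = 1"
  proof -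
    have "(\<lambda>n. 1 - F (1 - 1 / 2 ^ n)) \<longlonglongrightarrow> 0" using f_lim(2) F_le1 by simp
    moreover have "1 - F 1 \<le> 1 - F (1 - 1 / 2 ^ n)" for n :: nat
      by (intro diff_left_mono monoD[OF F_mono]) simp
    ultimately have "1 - F 1 \<le> 0" by (intro LIMSEQ_le_const) auto
    then show ?thesis using F_le1[of 1] by simp
  qed
  have a_0: "a \<longlonglongrightarrow> 0" and a_ev: "\<forall>\<^sub>F n in sequentially. 0 < a n \<and> a n < 1 \<and> sect F (a n) 1 = 1 / real n"
    using S.quantile_S1[OF FD F1 F_lt1 a_def[unfolded G_def]] by auto
  have a_pos: "\<forall>\<^sub>F n in sequentially. 0 < a n" using a_ev by (rule eventually_mono) simp

  define r where "r = (\<lambda>n. a n + \<bar>c n\<bar> + \<bar>A (1 / a n)\<bar> + 1 / real n)"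
  have A_0: "(\<lambda>n. A (1 / a n)) \<longlonglongrightarrow> 0"
  proof (rule filterlim_compose[of A])
    show "(A \<longlongrightarrow> 0) at_top" using RV2 by (simp add: second_order_RV_def)
    show "filterlim (\<lambda>n. 1 / a n) at_top sequentially"
      using filterlim_inverse_at_top[OF a_0 a_pos] by (simp add: inverse_eq_divide)
  qed
  have "(\<lambda>n. a n + \<bar>c n\<bar> + \<bar>A (1 / a n)\<bar> + 1 / real n) \<longlonglongrightarrow> 0 + \<bar>0\<bar> + \<bar>0\<bar> + 0"
    by (intro tendsto_intros a_0 c_lim A_0 lim_1_over_n)
  then have r_0: "r \<longlonglongrightarrow> 0" by (simp add: r_def)
  have bigO: "h \<in> O(r)" if "\<And>n. 0 < a n \<Longrightarrow> \<bar>h n\<bar> \<le> r n" for h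
  proof (rule bigoI[where c = 1])
    show "\<forall>\<^sub>F n in sequentially. norm (h n) \<le> 1 * norm (r n)"
      using a_pos by eventually_elim (use that in force)
  qed
  have aO: "a \<in> O(r)" and cO: "c \<in> O(r)" and AO: "(\<lambda>n. A (1 / a n)) \<in> O(r)" and nO: "(\<lambda>n. 1 / real n) \<in> O(r)"
    by (rule bigO; simp add: r_def)+

  \<comment> \<open>The sequence \<open>\<lambda>_n\<close> of the statement; it encodes
    \<open>\<rho> n\<close> as \<open>1 - 2 * a n * (l n)^2\<close>.\<close>
  define l where "l n = sqrt ((1 - \<rho> n) / (2 * a n))" for n
  have l_exp: "first_order r l lam (\<lambda>n. \<gamma> * c n)"
  proof -
    have "(\<lambda>n. (l n - lam) / c n - \<gamma>) \<longlonglongrightarrow> 0" using \<gamma>_lim unfolding l_def by (simp add: LIM_zero)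
    from tendsto_0_mult_bigo[OF this cO] have "(\<lambda>n. ((l n - lam) / c n - \<gamma>) * c n) \<in> o(r)" .
    moreover have "(\<lambda>n. ((l n - lam) / c n - \<gamma>) * c n) = (\<lambda>n. l n - lam - \<gamma> * c n)"
      using c_nz by (auto simp: field_simps)
    ultimately have "(\<lambda>n. l n - lam - \<gamma> * c n) \<in> o(r)" by simp
    moreover have "(\<lambda>n. \<gamma> * c n) \<in> O(r)" using cO by (cases "\<gamma> = 0") auto
    ultimately show ?thesis by (simp add: first_order_def)
  qed
  have l_lim: "l \<longlonglongrightarrow> lam" by (rule first_order_tendsto[OF l_exp r_0])

  have zy_zx: "zy lam x y = zx lam y x" by (simp add: zx_def zy_def)
  \<comment> \<open>The assumed inequality is exactly
    \<open>(lam + (q - p) / (2 * lam))^2 < 2 * \<bar>p\<bar>\<close>. It places the limiting corner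
    strictly inside both angular ranges, where \<open>Psi0\<close> is differentiable.\<close>
  have z_in: "-1 < zx lam p q \<and> zx lam p q < 1" if "p < 0" "lam\<^sup>2 + p + q + (p - q)\<^sup>2 / (4 * lam\<^sup>2) < 0" for p q
  proof -
    have "(lam + (q - p) / (2 * lam))\<^sup>2 = lam\<^sup>2 + (q - p) + (p - q)\<^sup>2 / (4 * lam\<^sup>2)"
      using lam_pos by (simp add: power2_eq_square field_simps)
    then have "(lam + (q - p) / (2 * lam))\<^sup>2 < 2 * \<bar>p\<bar>" using that by simp
    moreover have "(zx lam p q)\<^sup>2 = (lam + (q - p) / (2 * lam))\<^sup>2 / (2 * \<bar>p\<bar>)"
      unfolding zx_def power_divide by simp
    moreover have "0 < 2 * \<bar>p\<bar>" using that(1) by simp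
    ultimately have "(zx lam p q)\<^sup>2 < 1" by (metis divide_less_eq_1_pos)
    then have "\<bar>zx lam p q\<bar> < 1" by (simp add: abs_square_less_1)
    then show ?thesis by auto
  qed
  have zX: "-1 < zx lam x y" "zx lam x y < 1" and zY: "-1 < zx lam y x" "zx lam y x < 1"
    using z_in[OF x_neg xy_cond] z_in[of y x] y_neg xy_cond by (auto simp: power2_commute add_ac)

  define Z1 where "Z1 n = endpoint (a n) (l n) x y" for n
  define Z2 where "Z2 n = endpoint (a n) (l n) y x" for n
  note Z1 = endpoint_expansion[OF r_0 aO l_exp lam_pos x_neg, of y, folded Z1_def]
  note Z2 = endpoint_expansion[OF r_0 aO l_exp lam_pos y_neg, of x, folded Z2_def]
  define N1 where "N1 n = sect F (a n * \<bar>x\<bar>) (Z1 n) / sect F (a n) 1" for n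
  define N2 where "N2 n = sect F (a n * \<bar>y\<bar>) (Z2 n) / sect F (a n) 1" for n
  have x0: "\<bar>x\<bar> > 0" and y0: "\<bar>y\<bar> > 0" using x_neg y_neg by auto
  note N1 = sector_ratio_expansion[OF F_mono F_ge0 F_le1 F1 F_lt1 RV2 \<alpha>_pos \<tau>_nonpos a_0 a_pos x0 r_0 aO AO Z1 zX, folded N1_def]
  note N2 = sector_ratio_expansion[OF F_mono F_ge0 F_le1 F1 F_lt1 RV2 \<alpha>_pos \<tau>_nonpos a_0 a_pos y0 r_0 aO AO Z2 zY, folded N2_def]

  define K where "K = \<bar>x\<bar> powr (\<alpha> + 1/2) * psi \<alpha> (zx lam x y) + \<bar>y\<bar> powr (\<alpha> + 1/2) * psi \<alpha> (zy lam x y)"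
  define Q where "Q n = Qn \<alpha> \<tau> lam \<gamma> (a n) (c n) (A (1 / a n)) x y" for n
  have NQ: "first_order r (\<lambda>n. N1 n + N2 n) K (\<lambda>n. - Q n)"
  proof (rule first_order_eqI[OF first_order_add[OF N1 N2]])
    fix n
    \<comment> \<open>By symmetry the \<open>y\<close> part is the \<open>x\<close> part with the
      thresholds exchanged. Writing \<open>y\<close> as \<open>x + (y - x)\<close> in its bracket
      turns the coefficient \<open>3\<close> into \<open>1\<close>, which explains the asymmetric
      look of \<open>Qn\<close>.\<close>
    have swap: "- (a n / 2 * (lam * (x - y) + y * (x - y) / lam + 3 * (x - y)\<^sup>2 / (4 * lam) + (x - y) ^ 3 / (8 * lam ^ 3))) =
      a n / 2 * (lam * (y - x) + x * (y - x) / lam + (y - x)\<^sup>2 / (4 * lam) + (y - x) ^ 3 / (8 * lam ^ 3))"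
      using lam_pos by (simp add: field_simps power2_eq_square power3_eq_cube)
    \<comment> \<open>Here the split-off part \<open>w\<close> of the endpoint displacement cancels
      the boundary term of \<open>J1\<close>.\<close>
    have frac: "D / k * (b / s - w + w) = D / (k * s) * b" for D k b s w :: real by simp
    show "- (\<bar>x\<bar> powr (\<alpha> + 1/2) *
       (- a n * \<bar>x\<bar> / c_alpha \<alpha> * J1 \<alpha> (zx lam x y)
        - A (1 / a n) * \<bar>x\<bar> powr (- \<tau>) / c_alpha \<alpha> * J2 \<alpha> \<tau> (zx lam x y)
        + psi \<alpha> (zx lam x y) * (- A (1 / a n) * qt \<tau> \<bar>x\<bar> + a n / c_alpha \<alpha> * I1 \<alpha> + A (1 / a n) / c_alpha \<alpha> * I2 \<alpha> \<tau>)
        - (1 - (zx lam x y)\<^sup>2) powr \<alpha> / c_alpha \<alpha> * ((c n * \<gamma> * (1 - (y - x) / (2 * lam\<^sup>2))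
      - a n / 2 * (lam * (y - x) + x * (y - x) / lam + 3 * (y - x)\<^sup>2 / (4 * lam) + (y - x) ^ 3 / (8 * lam ^ 3))) / sqrt (2 * \<bar>x\<bar>)
      - a n * \<bar>x\<bar> * zx lam x y * (1/2 - 3/4 * (zx lam x y)\<^sup>2) + a n * \<bar>x\<bar> * zx lam x y * (1/2 - 3/4 * (zx lam x y)\<^sup>2))))
     + - (\<bar>y\<bar> powr (\<alpha> + 1/2) *
       (- a n * \<bar>y\<bar> / c_alpha \<alpha> * J1 \<alpha> (zx lam y x)
        - A (1 / a n) * \<bar>y\<bar> powr (- \<tau>) / c_alpha \<alpha> * J2 \<alpha> \<tau> (zx lam y x)
        + psi \<alpha> (zx lam y x) * (- A (1 / a n) * qt \<tau> \<bar>y\<bar> + a n / c_alpha \<alpha> * I1 \<alpha> + A (1 / a n) / c_alpha \<alpha> * I2 \<alpha> \<tau>)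
        - (1 - (zx lam y x)\<^sup>2) powr \<alpha> / c_alpha \<alpha> * ((c n * \<gamma> * (1 - (x - y) / (2 * lam\<^sup>2))
      - a n / 2 * (lam * (x - y) + y * (x - y) / lam + 3 * (x - y)\<^sup>2 / (4 * lam) + (x - y) ^ 3 / (8 * lam ^ 3))) / sqrt (2 * \<bar>y\<bar>)
      - a n * \<bar>y\<bar> * zx lam y x * (1/2 - 3/4 * (zx lam y x)\<^sup>2) + a n * \<bar>y\<bar> * zx lam y x * (1/2 - 3/4 * (zx lam y x)\<^sup>2))))
     = - Q n"
      unfolding Q_def Qn_def Let_def zy_zx frac minus_add_distrib[symmetric]
        diff_conv_add_uminus[of "c n * \<gamma> * (1 - (x - y) / (2 * lam\<^sup>2))"] swap ..
  next
    show "\<bar>x\<bar> powr (\<alpha> + 1 / 2) * psi \<alpha> (zx lam x y) + \<bar>y\<bar> powr (\<alpha> + 1 / 2) * psi \<alpha> (zx lam y x) = K"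
      unfolding K_def zy_zx by (rule refl)
  qed

  define P where "P n = measure N {\<omega> \<in> space N.
            Max ((\<lambda>i. fst (X n i \<omega>)) ` {1..n}) \<le> 1 + a n * x \<and>
            Max ((\<lambda>i. snd (X n i \<omega>)) ` {1..n}) \<le> 1 + a n * y}" for n
  define p where "p n = measure M {\<omega> \<in> space M. R \<omega> * cos (\<Theta> \<omega>) \<le> 1 + a n * x \<and>
      \<rho> n * (R \<omega> * cos (\<Theta> \<omega>)) + sqrt (1 - (\<rho> n)\<^sup>2) * (R \<omega> * sin (\<Theta> \<omega>)) \<le> 1 + a n * y}" for n
  have P_p: "P n = p n ^ n" if "n \<ge> 1" for n
  proof -
    define E where "E = {..1 + a n * x} \<times> {..1 + a n * y}"
    have E: "E \<in> sets borel" unfolding E_def by (intro borel_closed closed_Times) auto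
    have rv: "X n i \<in> measurable N borel" if "i \<in> {1..n}" for i
      using X_indep[of n] that unfolding N.indep_vars_def by auto
    have "{\<omega> \<in> space N. Max ((\<lambda>i. fst (X n i \<omega>)) ` {1..n}) \<le> 1 + a n * x \<and>
            Max ((\<lambda>i. snd (X n i \<omega>)) ` {1..n}) \<le> 1 + a n * y} = (\<Inter>i\<in>{1..n}. X n i -` E \<inter> space N)"
      using that by (auto simp: E_def mem_Times_iff)
    then have "P n = measure N (\<Inter>i\<in>{1..n}. X n i -` E \<inter> space N)" by (simp add: P_def)
    also have "\<dots> = (\<Prod>i\<in>{1..n}. measure N (X n i -` E \<inter> space N))"
      using that E by (intro N.indep_varsD_finite[OF X_indep]) auto
    also have "\<dots> = (\<Prod>i\<in>{1..n}. p n)"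
    proof (rule prod.cong[OF refl])
      fix i assume i: "i \<in> {1..n}"
      have "measure N (X n i -` E \<inter> space N) = measure (distr N borel (X n i)) E"
        using rv[OF i] E by (simp add: measure_distr)
      also have "\<dots> = p n"
        unfolding X_distr[OF i] p_def using E R_meas \<Theta>_meas
        by (subst measure_distr) (auto simp: E_def intro!: arg_cong[where f = "measure M"])
      finally show "measure N (X n i -` E \<inter> space N) = p n" .
    qed
    finally show ?thesis by simp
  qed
  have ax1: "\<forall>\<^sub>F n in sequentially. 1 + a n * k > 0" for k
  proof -
    have "(\<lambda>n. 1 + a n * k) \<longlonglongrightarrow> 1 + 0 * k" by (intro tendsto_intros a_0)
    then show ?thesis by (rule order_tendstoD) simp
  qed
  have al1: "\<forall>\<^sub>F n in sequentially. a n * (l n)\<^sup>2 < 1"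
  proof -
    have "(\<lambda>n. a n * (l n)\<^sup>2) \<longlonglongrightarrow> 0 * lam\<^sup>2" by (intro tendsto_intros a_0 l_lim)
    then show ?thesis by (rule order_tendstoD) simp
  qed
  have l_pos: "\<forall>\<^sub>F n in sequentially. l n > 0" by (rule order_tendstoD(1)[OF l_lim lam_pos])
  have Z_lim: "Z1 \<longlonglongrightarrow> zx lam x y" "Z2 \<longlonglongrightarrow> zx lam y x"
    by (rule first_order_tendsto[OF Z1 r_0], rule first_order_tendsto[OF Z2 r_0])
  have Z_ev: "\<forall>\<^sub>F n in sequentially. -1 < Z1 n \<and> Z1 n < 1 \<and> -1 < Z2 n \<and> Z2 n < 1"
    using zX zY order_tendstoD[OF Z_lim(1)] order_tendstoD[OF Z_lim(2)] by (auto intro!: eventually_conj)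
  have p_eq: "\<forall>\<^sub>F n in sequentially. p n = 1 - (N1 n + N2 n) / real n"
    using a_ev ax1[of x] ax1[of y] al1 l_pos Z_ev eventually_gt_at_top[of 0]
  proof eventually_elim
    case (elim n)
    \<comment> \<open>Squaring undoes the root because \<open>1 - \<rho> n\<close> and
      \<open>a n\<close> are positive.\<close>
    have \<rho>n: "\<rho> n = 1 - 2 * a n * (l n)\<^sup>2" using elim \<rho>_range[of n] by (simp add: l_def)
    have w: "0 < - a n * x" "- a n * x < 1" "0 < - a n * y" "- a n * y < 1"
      using elim x_neg y_neg by (auto simp: mult_pos_neg)
    have "p n = 1 - (sect F (- a n * x) (Z1 n) + sect F (- a n * y) (Z2 n))"
      using S.prob_both_le[OF FD F1 w, of "\<rho> n" "Z1 n" "Z2 n"] \<rho>_range[of n] elim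
        slope_endpoint[of "a n" x "l n" "\<rho> n" y] slope_endpoint[of "a n" y "l n" "\<rho> n" x] \<rho>n x_neg y_neg
      by (auto simp: p_def Z1_def Z2_def)
    then show ?case using elim x_neg y_neg by (simp add: N1_def N2_def add_divide_distrib)
  qed
  \<comment> \<open>Read off from the fact that \<open>p n\<close> is a probability.\<close>
  have N_nonneg: "\<forall>\<^sub>F n in sequentially. 0 \<le> N1 n + N2 n"
    using p_eq eventually_gt_at_top[of 0]
  proof eventually_elim
    case (elim n)
    have "p n \<le> 1" unfolding p_def by (rule M.prob_le_1)
    then show ?case using elim by (simp add: zero_le_divide_iff)
  qed
  have P_exp: "first_order r P (exp (- K)) (\<lambda>n. exp (- K) * (Q n - K\<^sup>2 / 2 * (1 / real n)))"
  proof (rule first_order_cong[OF power_expansion[OF r_0 nO NQ N_nonneg]])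
    show "\<forall>\<^sub>F n in sequentially. (1 - (N1 n + N2 n) / real n) ^ n = P n"
      using p_eq eventually_ge_at_top[of 1] by eventually_elim (simp add: P_p)
  qed
  define H where "H = H_lim \<alpha> lam x y"
  have H: "H = exp (- K)" by (simp add: H_def H_lim_def K_def)
  \<comment> \<open>Everything the expansion leaves over, divided by the fixed positive number
    \<open>H\<close> to match the factored form of the claim.\<close>
  define e where "e n = 1 / H * (P n - H - H * (Q n - K\<^sup>2 / 2 * (1 / real n)))" for n
  have "e \<in> o(r)"
    unfolding e_def[abs_def] using P_exp unfolding first_order_def H[symmetric] by (simp add: H)
  moreover have "P n - H = H * (- 1/2 * (1 / real n) * K\<^sup>2 + Q n + e n)" for n
  proof -
    have "H \<noteq> 0" by (simp add: H)
    then have "H * e n = P n - H - H * (Q n - K\<^sup>2 / 2 * (1 / real n))" by (simp add: e_def)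
    then show ?thesis by (simp add: algebra_simps)
  qed
  ultimately show ?thesis unfolding r_def P_def H_def K_def Q_def by (intro exI[of _ e]) auto
qed

end
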